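(* Let $\{\xi_k\}_{k=0}^\infty$ be a sequence of independent identically distributed real- or complex-valued random variables with $\mathbf{P}(\xi_0=0)<1$, and let $G_n(z)=\xi_0+\xi_1z+\dots+\xi_nz^n$. Then the empirical distribution $S_n/n$ of the arguments of the zeros of $G_n$ converges almost surely to the uniform distribution, i.e. $$\mathbf{P}\left\{\frac1nS_n(\alpha,\beta)\underset{n\to\infty}{\longrightarrow}\frac{\beta-\alpha}{2\pi}\right\}=1$$ for any $\alpha,\beta$ such that $0\leqslant\alpha<\beta\leqslant2\pi$.
   Context: For $0\leqslant\alpha<\beta\leqslant2\pi$, $S_n(\alpha,\beta)$ denotes the number of zeros $z\in\mathbb{C}$ of $G_n$, counted with multiplicity, with $\alpha\leqslant\arg z\leqslant\beta$, where $\arg z\in[0,2\pi)$ (with the convention $\arg 0=0$). On the event that $G_n$ is identically zero (which a.s. occurs for only finitely many $n$) put $S_n=0$. *)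

theory Defs
  imports
    "HOL-Probability.Probability"
    "HOL-Computational_Algebra.Polynomial"
begin

definition random_poly :: "(nat \<Rightarrow> 'a \<Rightarrow> complex) \<Rightarrow> nat \<Rightarrow> 'a \<Rightarrow> complex poly" where
  "random_poly \<xi> n \<omega> = (\<Sum>k\<le>n. monom (\<xi> k \<omega>) k)"

lemma poly_random_poly: "poly (random_poly \<xi> n \<omega>) z = (\<Sum>k\<le>n. \<xi> k \<omega> * z ^ k)"
  by (simp add: random_poly_def poly_sum poly_monom)

(* Arg2pi takes values in [0, 2 pi), with Arg2pi 0 = 0; order z p is the multiplicity of
   the zero z of p. *)
definition sector_zeros :: "complex poly \<Rightarrow> real \<Rightarrow> real \<Rightarrow> nat" where
  "sector_zeros p \<alpha> \<beta> =
     (if p = 0 then 0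
      else (\<Sum>z | poly p z = 0 \<and> \<alpha> \<le> Arg2pi z \<and> Arg2pi z \<le> \<beta>. order z p))"

end

theory Submission
  imports
    Defs
    "HOL-Computational_Algebra.Fundamental_Theorem_Algebra"
    "HOL-Real_Asymp.Real_Asymp"
begin

text \<open>
  By Weyl's criterion it suffices that the sums of \<open>(z / \<bar>z\<bar>)\<^sup>m\<close> over the zeros \<open>z\<close> of \<open>G\<^sub>n\<close> are
  \<open>o(n)\<close> for every \<open>m > 0\<close>. Such a sum is, up to the factor \<open>m / 2\<close>, the integral over \<open>s = ln \<bar>z\<bar>\<close> of the
  \<open>m\<close>-th mode of the zeros, which is essentially the \<open>m\<close>-th Fourier coefficient of \<open>ln \<bar>G\<^sub>n\<bar>\<close> on the circle of
  radius \<open>exp s\<close>. That coefficient is at most the maximum minus the mean of \<open>ln \<bar>G\<^sub>n\<bar>\<close> on the circle, and at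
  most \<open>n\<close> in any case. For \<open>s\<close> in a segment on which a single term of \<open>G\<^sub>n\<close> dominates with margin \<open>\<eta>\<close>, a
  differential Harnack inequality bounds the difference of maximum and mean by \<open>exp (C / \<eta>)\<close> up to a
  logarithmic factor; with \<open>\<eta>\<close> a large multiple of \<open>1 / ln n\<close> this is \<open>o(n)\<close> with room to spare, while the
  ends of the segments contribute \<open>O(\<eta> n)\<close> each.

  Segments correspond to vertices of the Newton polygon, and each vertex is a strict record of
  \<open>\<bar>\<xi>\<^sub>0\<bar>, \<bar>\<xi>\<^sub>1\<bar>, \<dots>\<close> read from the left or from the right. By exchangeability there are almost surely
  \<open>O(ln n)\<close> records in total and at most \<open>c ln n\<close> beyond position \<open>n powr (1 - \<kappa>)\<close>, with \<open>c\<close> arbitrarily small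
  for small \<open>\<kappa>\<close>, whatever the distribution of \<open>\<xi>\<^sub>0\<close>. For the remaining vertices, close to \<open>0\<close> or \<open>n\<close>,
  the bound \<open>\<bar>a\<^sub>k\<bar> \<le> (n choose k) M\<close> of a coefficient by the Mahler measure replaces the Harnack inequality.
\<close>

section \<open>Fourier modes of the zeros on a circle\<close>

text \<open>Since no moment is assumed, the moduli of the coefficients may spread over arbitrarily
  many scales: the zeros need not gather near the unit circle, and no single circle sees all of
  them. This forces the integration over every radius. The margin \<eta> cannot shrink faster than 1
  / ln n: Harnack is carried along a whole circle by discs of radius proportional to \<eta>, at the
  cost exp (C / \<eta>), which must remain a power of n below 1. With such an \<eta> each end of a
  segment still costs a multiple of n / ln n, so the general bound of order ln n for the number of
  vertices would yield only O(n). The gain comes from the positions between n powr (1 - \<kappa>)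
  and n, which carry only about \<kappa> ln n records, so that c can be sent to 0. Vertices closer
  to an end are still of order ln n in number, but there the logarithm of the binomial coefficient
  is at most n powr (1 - \<kappa>) ln n, which survives any power of ln n.\<close>

lemma has_integral_cis:
  fixes j :: int
  shows "((\<lambda>t. cis (of_int j * t)) has_integral (if j = 0 then 2 * pi else 0)) {0..2*pi}"
proof (cases "j = 0")
  case True
  then show ?thesis
    using has_integral_const_real[of "1::complex" 0 "2*pi"] by (simp add: scaleR_conv_of_real)
next
  case False
  have "((\<lambda>t. cis (of_int j * t)) has_integral
          (cis (of_int j * (2*pi)) / (\<i> * of_int j) - cis (of_int j * 0) / (\<i> * of_int j))) {0..2*pi}"
    using False
    by (intro fundamental_theorem_of_calculus)
       (auto intro!: derivative_eq_intros simp: cis_conv_exp has_vector_derivative_def[symmetric]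
         scaleR_conv_of_real  field_simps
         intro!: has_vector_derivative_real_field)
  moreover have "cis (of_int j * (2*pi)) = 1"
    using cis_multiple_2pi[of "of_int j"] by (simp add: mult_ac)
  ultimately show ?thesis using False by simp
qed


text \<open>The logarithmic series in \<open>x * cis (- t)\<close> contains only the frequencies - k
  with k \<ge> 1 and converges uniformly, so integrating term by term leaves at most the term k =
  j.\<close>

lemma has_integral_Ln_cis:
  fixes x :: complex and j :: int
  assumes x: "cmod x < 1"
  shows "((\<lambda>t. cis (of_int j * t) * ln (1 - x * cis (- t))) has_integral
           (if j > 0 then - (2 * pi * x ^ nat j / of_int j) else 0)) {0..2*pi}"
proof -
  \<comment> \<open>The term k = 0 vanishes because \<open>x ^ 0 / of_nat 0 = 0\<close>, so the sums
    may start at 0.\<close>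
  define u where "u k t = - (x ^ k / of_nat k) * cis (of_int (j - int k) * t)" for k t
  have u_sums: "(\<lambda>k. u k t) sums (cis (of_int j * t) * ln (1 - x * cis (- t)))" for t
  proof -
    have "(\<lambda>k. - ((x * cis (- t)) ^ k) / of_nat k) sums ln (1 - x * cis (- t))"
      using Ln_series'[of "- (x * cis (- t))"] x by (simp add: norm_mult)
    from sums_mult[OF this, of "cis (of_int j * t)"]
    have "(\<lambda>k. cis (of_int j * t) * (- ((x * cis (- t)) ^ k) / of_nat k)) sums
            (cis (of_int j * t) * ln (1 - x * cis (- t)))" .
    moreover have "cis (of_int j * t) * (- ((x * cis (- t)) ^ k) / of_nat k) = u k t" for k
    proof -
      have "u k t = - (x ^ k / of_nat k) * cis (of_int j * t + of_nat k * (- t))"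
        by (simp add: u_def left_diff_distrib)
      also have "\<dots> = - (x ^ k / of_nat k) * (cis (of_int j * t) * cis (- t) ^ k)"
        by (simp only: cis_mult[symmetric] Complex.DeMoivre)
      finally show ?thesis by (simp add: power_mult_distrib)
    qed
    ultimately show ?thesis by simp
  qed
  have "uniform_limit {0..2*pi} (\<lambda>n t. \<Sum>k<n. u k t) (\<lambda>t. \<Sum>k. u k t) sequentially"
  proof (rule Weierstrass_m_test)
    show "cmod (u k t) \<le> cmod x ^ k" for k t
    proof (cases k)
      case (Suc l)
      have "cmod x ^ k * 1 \<le> cmod x ^ k * real k"
        using Suc by (intro mult_left_mono) auto
      then show ?thesis using Suc
        by (simp add: u_def norm_mult norm_divide norm_power divide_le_eq del: of_nat_Suc)
    qed (simp add: u_def)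
    show "summable (\<lambda>k. cmod x ^ k)"
      using x by (simp add: summable_geometric)
  qed
  then have lim: "uniform_limit {0..2*pi} (\<lambda>n t. \<Sum>k<n. u k t)
      (\<lambda>t. cis (of_int j * t) * ln (1 - x * cis (- t))) sequentially"
    using u_sums by (simp add: sums_iff)
  have int: "((\<lambda>t. \<Sum>k<n. u k t) has_integral
      (\<Sum>k<n. if int k = j then - (2 * pi * x ^ k / of_nat k) else 0)) {0..2*pi}" for n
  proof (rule has_integral_sum)
    show "(u k has_integral (if int k = j then - (2 * pi * x ^ k / of_nat k) else 0)) {0..2*pi}" for k
      using has_integral_mult_right[OF has_integral_cis[of "j - int k"], of "- (x ^ k / of_nat k)"]
      by (auto simp: u_def[abs_def] mult_ac split: if_splits)
  qed simp
  have cont: "continuous_on {0..2*pi} (u k)" for k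
    unfolding u_def[abs_def] cis_conv_exp by (intro continuous_intros)
  obtain I J where IJ: "\<And>n. ((\<lambda>t. \<Sum>k<n. u k t) has_integral I n) {0..2*pi}"
      "((\<lambda>t. cis (of_int j * t) * ln (1 - x * cis (- t))) has_integral J) {0..2*pi}" "I \<longlonglongrightarrow> J"
    by (rule uniform_limit_integral[OF lim]) (auto intro!: continuous_on_sum cont)
  have "I n = (if j > 0 then - (2 * pi * x ^ nat j / of_int j) else 0)" if "n > nat j" for n
  proof -
    have "I n = (\<Sum>k<n. if int k = j then - (2 * pi * x ^ k / of_nat k) else 0)"
      by (rule has_integral_unique[OF IJ(1) int])
    also have "\<dots> = (\<Sum>k<n. if k = nat j then (if j > 0 then - (2 * pi * x ^ nat j / of_int j) else 0) else 0)"
      by (rule sum.cong) (auto)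
    finally show ?thesis using that by simp
  qed
  then have "I \<longlonglongrightarrow> (if j > 0 then - (2 * pi * x ^ nat j / of_int j) else 0)"
    by (intro tendsto_eventually eventually_sequentiallyI[of "Suc (nat j)"]) auto
  with IJ show ?thesis using LIMSEQ_unique by blast
qed

lemma Re_of_real_mult: "Re (of_real c * w) = c * Re w"
  by simp

lemma has_integral_ln_cmod_cis:
  fixes x :: complex
  assumes x: "cmod x < 1"
  shows "((\<lambda>t. ln (cmod (1 - x * cis (- t)))) has_integral 0) {0..2*pi}"
    and "m > 0 \<Longrightarrow> ((\<lambda>t. ln (cmod (1 - x * cis (- t))) * Re (e * cis (of_nat m * t)))
           has_integral - (pi * Re (e * x ^ m) / m)) {0..2*pi}"
proof -
  have nz: "1 - x * cis (- t) \<noteq> 0" for t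
    using x by (metis eq_iff_diff_eq_0 norm_cis norm_mult norm_one mult.right_neutral less_irrefl)
  have *: "ln (cmod (1 - x * cis (- t))) = Re (ln (1 - x * cis (- t)))" for t
    using nz[of t] by simp
  show "((\<lambda>t. ln (cmod (1 - x * cis (- t)))) has_integral 0) {0..2*pi}"
    unfolding * using has_integral_Re[OF has_integral_Ln_cis[OF x, of 0]] by simp
  assume m: "m > 0"
  \<comment> \<open>The conjugate half has frequency - m, which the logarithm does not contain; it
    integrates to 0, and pi remains instead of 2 * pi.\<close>
  have eq: "ln (cmod (1 - x * cis (- t))) * Re (e * cis (of_nat m * t)) =
      1/2 * (Re (e * (cis (of_int (int m) * t) * ln (1 - x * cis (- t)))) +
             Re (cnj e * (cis (of_int (- int m) * t) * ln (1 - x * cis (- t)))))" for t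
  proof -
    have Re: "Re v * Re u = 1/2 * (Re (u * v) + Re (cnj u * v))" for u v
      by (simp add: field_simps)
    have "cnj (cis (of_nat m * t)) = cis (of_int (- int m) * t)"
      by (simp add: cis_cnj)
    then show ?thesis
      unfolding * using Re[of "ln (1 - x * cis (- t))" "e * cis (of_nat m * t)"]
      by (simp only: complex_cnj_mult mult.assoc of_int_of_nat_eq)
  qed
  have "((\<lambda>t. ln (cmod (1 - x * cis (- t))) * Re (e * cis (of_nat m * t))) has_integral
      1/2 * (Re (e * (- (2 * pi * x ^ m / of_nat m))) + Re (cnj e * 0))) {0..2*pi}"
    unfolding eq
    by (intro has_integral_mult_right has_integral_add has_integral_Re)
       (use has_integral_Ln_cis[OF x, of "int m"] has_integral_Ln_cis[OF x, of "- int m"] m in \<open>auto split: if_splits\<close>)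
  moreover have "1/2 * (Re (e * (- (2 * pi * x ^ m / of_nat m))) + Re (cnj e * 0)) = - (pi * Re (e * x ^ m) / m)"
  proof -
    have "e * (- (2 * pi * x ^ m / of_nat m)) = of_real (- 2 * pi / m) * (e * x ^ m)"
      by (simp add: field_simps)
    then have "Re (e * (- (2 * pi * x ^ m / of_nat m))) = - 2 * pi / m * Re (e * x ^ m)"
      using Re_of_real_mult by metis
    then have "1/2 * (Re (e * (- (2 * pi * x ^ m / of_nat m))) + Re (cnj e * 0)) = 1/2 * (- 2 * pi / m * Re (e * x ^ m))"
      by (simp only: mult_zero_right zero_complex.sel add_0_right)
    also have "\<dots> = - (pi * Re (e * x ^ m) / m)"
      by (simp del: times_complex.sel)
    finally show ?thesis .
  qed
  ultimately show "((\<lambda>t. ln (cmod (1 - x * cis (- t))) * Re (e * cis (of_nat m * t)))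
           has_integral - (pi * Re (e * x ^ m) / m)) {0..2*pi}"
    by simp
qed

text \<open>This is \<open>d / R\<close> for \<open>\<bar>d\<bar> \<le> R\<close> and \<open>R / cnj d\<close> otherwise. Up to a constant its \<open>m\<close>-th power is the \<open>m\<close>-th
  Fourier coefficient of \<open>ln \<bar>z - d\<bar>\<close> on the circle \<open>\<bar>z\<bar> = R\<close>.\<close>
definition refl_pos :: "real \<Rightarrow> complex \<Rightarrow> complex" where
  "refl_pos R d = of_real (R / (max R (cmod d))\<^sup>2) * d"

text \<open>Taking out the larger of R and |d| leaves |1 - x cis (- t)| with x =
  \<open>refl_pos R d\<close> of modulus below 1; for d outside the circle a conjugation turns cis t
  into cis (- t). The first formula is Jensen's for a single linear factor.\<close>

lemma has_integral_ln_circle: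
  fixes d e :: complex
  assumes R: "R > 0" "cmod d \<noteq> R"
  shows "((\<lambda>t. ln (cmod (of_real R * cis t - d))) has_integral 2 * pi * ln (max R (cmod d))) {0..2*pi}"
    and "m > 0 \<Longrightarrow> ((\<lambda>t. ln (cmod (of_real R * cis t - d)) * Re (e * cis (of_nat m * t)))
           has_integral - (pi * Re (e * refl_pos R d ^ m) / m)) {0..2*pi}"
proof -
  have zero: "((\<lambda>t. Re (e * cis (of_nat m * t))) has_integral 0) {0..2*pi}" if "m > 0"
    using has_integral_Re[OF has_integral_mult_right[OF has_integral_cis[of "int m"], of e]] that by simp
  define x where "x = refl_pos R d"
  have x: "cmod x < 1 \<and> (\<forall>t. cmod (of_real R * cis t - d) = max R (cmod d) * cmod (1 - x * cis (- t)))"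
  proof (cases "cmod d < R")
    case True
    have "x = d / of_real R"
      using True R by (simp add: x_def refl_pos_def max_def power2_eq_square field_simps)
    moreover have "of_real R * cis t - d = of_real R * cis t * (1 - d / of_real R * cis (-t))" for t
    proof -
      have "of_real R * cis t * (d / of_real R * cis (-t)) = (of_real R / of_real R) * d * (cis t * cis (- t))"
        by simp
      also have "\<dots> = d" using R by (simp add: cis_mult)
      finally show ?thesis by (simp only: right_diff_distrib mult_1_right)
    qed
    ultimately show ?thesis using True R by (auto simp: norm_mult norm_divide max_def)
  next
    case False
    then have d: "cmod d > R" "d \<noteq> 0" using R by auto
    have x: "x = of_real R / cnj d"
    proof -
      have "x = of_real R * d / (d * cnj d)"
        using d R by (simp add: x_def refl_pos_def max_def complex_norm_square[symmetric])
      then show ?thesis using d by simp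
    qed
    have "cmod (of_real R * cis t - d) = cmod d * cmod (1 - of_real R / cnj d * cis (-t))" for t
    proof -
      have "of_real R * cis t - d = - d * (1 - of_real R / d * cis t)"
        using d by (simp add: field_simps)
      then have "cmod (of_real R * cis t - d) = cmod d * cmod (1 - of_real R / d * cis t)"
        by (simp add: norm_mult)
      also have "cmod (1 - of_real R / d * cis t) = cmod (cnj (1 - of_real R / d * cis t))"
        by (simp only: complex_mod_cnj)
      finally show ?thesis by (simp add: cis_cnj)
    qed
    then show ?thesis using x d R by (simp add: norm_divide max_def)
  qed
  have nz: "cmod (1 - x * cis (- t)) > 0" for t
  proof -
    have "cmod (x * cis (- t)) < 1" using x by (simp add: norm_mult)
    then have "x * cis (- t) \<noteq> 1" by auto
    then show ?thesis by simp
  qed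
  have eq: "ln (cmod (of_real R * cis t - d)) = ln (max R (cmod d)) + ln (cmod (1 - x * cis (- t)))" for t
  proof -
    have "cmod (of_real R * cis t - d) = max R (cmod d) * cmod (1 - x * cis (- t))"
      using x by blast
    moreover have "max R (cmod d) > 0" using less_le_trans[OF R(1) max.cobounded1] .
    ultimately show ?thesis using nz[of t] by (simp only: ln_mult) simp
  qed
  show "((\<lambda>t. ln (cmod (of_real R * cis t - d))) has_integral 2 * pi * ln (max R (cmod d))) {0..2*pi}"
    unfolding eq
    using has_integral_add[OF has_integral_const_real[of "ln (max R (cmod d))" 0 "2*pi"]
        has_integral_ln_cmod_cis(1)[OF conjunct1[OF x]]] by simp
  assume m: "m > 0"
  show "((\<lambda>t. ln (cmod (of_real R * cis t - d)) * Re (e * cis (of_nat m * t)))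
           has_integral - (pi * Re (e * refl_pos R d ^ m) / m)) {0..2*pi}"
    unfolding eq ring_distribs
    using has_integral_add[OF has_integral_mult_right[OF zero[OF m], of "ln (max R (cmod d))"]
        has_integral_ln_cmod_cis(2)[OF conjunct1[OF x] m, of e]] by (simp only: x_def mult_zero_right add_0)
qed


lemma has_integral_ln_circle_weighted:
  fixes d e :: complex
  assumes "R > 0" "cmod d \<noteq> R" "m > 0"
  shows "((\<lambda>t. ln (cmod (of_real R * cis t - d)) * (1 + Re (e * cis (of_nat m * t))))
           has_integral 2 * pi * (ln (max R (cmod d)) - Re (e * refl_pos R d ^ m) / (2 * m))) {0..2*pi}"
proof -
  have eq: "2 * pi * (ln (max R (cmod d)) - Re (e * refl_pos R d ^ m) / (2 * m)) =
      2 * pi * ln (max R (cmod d)) + - (pi * Re (e * refl_pos R d ^ m) / m)"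
    using assms(3) by (simp add: right_diff_distrib del: times_complex.sel)
  show ?thesis
    unfolding eq distrib_left mult_1_right
    using has_integral_add[OF has_integral_ln_circle(1)[OF assms(1,2)]
        has_integral_ln_circle(2)[OF assms(1,2,3), of e]] .
qed

lemma has_integral_sum_mset:
  fixes f :: "'b \<Rightarrow> real \<Rightarrow> real"
  assumes "\<And>z. z \<in># zs \<Longrightarrow> (f z has_integral I z) S"
  shows "((\<lambda>t. \<Sum>z\<in>#zs. f z t) has_integral (\<Sum>z\<in>#zs. I z)) S"
  using assms by (induction zs) (auto intro!: has_integral_add)

text \<open>Everything is measured from the centre c of the circle, so a zero z enters as z - c and
  the origin as - c. The circle meets no zero, and for nonzero k the origin lies outside it, hence
  each logarithm has the integral known for one linear factor.\<close>

lemma mode_ineq_aux: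
  fixes zs :: "complex multiset"
  assumes R: "R > 0" and m: "m > 0" and e: "cmod e = 1" and c: "k = 0 \<or> R < cmod c"
    and nz: "\<And>z. z \<in># zs \<Longrightarrow> cmod (z - c) \<noteq> R"
    and le: "\<And>t. A + (\<Sum>z\<in>#zs. ln (cmod (of_real R * cis t - (z - c))))
               - k * ln (cmod (of_real R * cis t - (- c))) \<le> \<beta>"
  shows "A + (\<Sum>z\<in>#zs. ln (max R (cmod (z - c))) - Re (e * refl_pos R (z - c) ^ m) / (2 * m))
           - k * (ln (max R (cmod (- c))) - Re (e * refl_pos R (- c) ^ m) / (2 * m)) \<le> \<beta>"
    (is "?L \<le> _")
proof -
  \<comment> \<open>Since |e| = 1 the weight is nonnegative, so a pointwise bound may be integrated
    against it; its total mass is 2 * pi.\<close>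
  define w where "w t = 1 + Re (e * cis (of_nat m * t))" for t
  have w: "w t \<ge> 0" for t
    using abs_Re_le_cmod[of "e * cis (of_nat m * t)"] e by (simp add: w_def norm_mult del: times_complex.sel)
  have iw: "(w has_integral 2 * pi) {0..2*pi}"
    using has_integral_add[OF has_integral_const_real[of 1 0 "2*pi"]
        has_integral_Re[OF has_integral_mult_right[OF has_integral_cis[of "int m"], of e]]] m
    by (simp add: w_def[abs_def] del: times_complex.sel)
  have int1: "((\<lambda>t. ln (cmod (of_real R * cis t - d)) * w t)
      has_integral 2 * pi * (ln (max R (cmod d)) - Re (e * refl_pos R d ^ m) / (2 * m))) {0..2*pi}"
    if "cmod d \<noteq> R" for d
    unfolding w_def by (rule has_integral_ln_circle_weighted[OF R that m])
  have int2: "((\<lambda>t. k * (ln (cmod (of_real R * cis t - (- c))) * w t))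
      has_integral k * (2 * pi * (ln (max R (cmod (- c))) - Re (e * refl_pos R (- c) ^ m) / (2 * m)))) {0..2*pi}"
  proof (cases "k = 0")
    case False
    then show ?thesis using c by (intro has_integral_mult_right int1) auto
  qed simp
  have int3: "((\<lambda>t. \<Sum>z\<in>#zs. ln (cmod (of_real R * cis t - (z - c))) * w t) has_integral
     (\<Sum>z\<in>#zs. 2 * pi * (ln (max R (cmod (z - c))) - Re (e * refl_pos R (z - c) ^ m) / (2 * m)))) {0..2*pi}"
    by (intro has_integral_sum_mset int1 nz)
  have int4: "((\<lambda>t. A * w t + (\<Sum>z\<in>#zs. ln (cmod (of_real R * cis t - (z - c))) * w t)
            - k * (ln (cmod (of_real R * cis t - (- c))) * w t)) has_integral
      A * (2 * pi) + (\<Sum>z\<in>#zs. 2 * pi * (ln (max R (cmod (z - c))) - Re (e * refl_pos R (z - c) ^ m) / (2 * m)))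
           - k * (2 * pi * (ln (max R (cmod (- c))) - Re (e * refl_pos R (- c) ^ m) / (2 * m)))) {0..2*pi}"
    by (intro has_integral_diff has_integral_add has_integral_mult_right iw int2 int3)
  have int5: "((\<lambda>t. \<beta> * w t) has_integral \<beta> * (2 * pi)) {0..2*pi}"
    by (intro has_integral_mult_right iw)
  have "A * (2 * pi) + (\<Sum>z\<in>#zs. 2 * pi * (ln (max R (cmod (z - c))) - Re (e * refl_pos R (z - c) ^ m) / (2 * m)))
           - k * (2 * pi * (ln (max R (cmod (- c))) - Re (e * refl_pos R (- c) ^ m) / (2 * m))) \<le> \<beta> * (2 * pi)"
  proof (rule has_integral_le[OF int4 int5])
    fix t
    have "A * w t + (\<Sum>z\<in>#zs. ln (cmod (of_real R * cis t - (z - c))) * w t)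
            - k * (ln (cmod (of_real R * cis t - (- c))) * w t) =
         (A + (\<Sum>z\<in>#zs. ln (cmod (of_real R * cis t - (z - c))))
               - k * ln (cmod (of_real R * cis t - (- c)))) * w t"
      by (simp add: ring_distribs sum_mset_distrib_right)
    also have "\<dots> \<le> \<beta> * w t"
      by (intro mult_right_mono le w)
    finally show "A * w t + (\<Sum>z\<in>#zs. ln (cmod (of_real R * cis t - (z - c))) * w t)
            - k * (ln (cmod (of_real R * cis t - (- c))) * w t) \<le> \<beta> * w t" .
  qed
  also have "A * (2 * pi) + (\<Sum>z\<in>#zs. 2 * pi * (ln (max R (cmod (z - c))) - Re (e * refl_pos R (z - c) ^ m) / (2 * m)))
           - k * (2 * pi * (ln (max R (cmod (- c))) - Re (e * refl_pos R (- c) ^ m) / (2 * m))) = 2 * pi * ?L"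
    unfolding sum_mset_distrib_left[symmetric] by (simp add: algebra_simps del: times_complex.sel)
  finally have "2 * pi * ?L \<le> 2 * pi * \<beta>"
    by (simp add: mult.commute)
  then show ?thesis by (simp only: mult_le_cancel_left_pos pi_gt_zero zero_less_mult_iff zero_less_numeral simp_thms)
qed

lemma tendsto_sum_mset:
  fixes f :: "'b \<Rightarrow> 'c \<Rightarrow> real"
  assumes "\<And>z. z \<in># zs \<Longrightarrow> (f z \<longlongrightarrow> I z) F"
  shows "((\<lambda>t. \<Sum>z\<in>#zs. f z t) \<longlongrightarrow> (\<Sum>z\<in>#zs. I z)) F"
  using assms by (induction zs) (auto intro!: tendsto_add)

lemma tendsto_refl_pos:
  assumes "R > 0"
  shows "((\<lambda>r. refl_pos r d) \<longlongrightarrow> refl_pos R d) (at_right R)"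
proof -
  have "max R (cmod d) \<noteq> 0" using less_le_trans[OF assms max.cobounded1, of "cmod d"] by simp
  then show ?thesis unfolding refl_pos_def by (intro tendsto_intros) auto
qed

text \<open>Integrate \<open>\<beta> - ln \<bar>p\<bar> + k ln \<bar>z\<bar> \<ge> 0\<close> against the nonnegative weight \<open>1 + Re (e * cis (m * t))\<close> over
  the circle; circles through zeros are reached as limits of larger ones.\<close>
theorem mode_ineq:
  fixes zs :: "complex multiset" and \<beta> :: "real \<Rightarrow> real"
  assumes R: "R > 0" and m: "m > 0" and e: "cmod e = 1" and \<delta>: "\<delta> > 0"
    and c: "k = 0 \<or> R + \<delta> \<le> cmod c"
    and le: "\<And>z. R \<le> cmod (z - c) \<Longrightarrow> cmod (z - c) < R + \<delta> \<Longrightarrow> z \<notin># zs \<Longrightarrow>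
               A + (\<Sum>w\<in>#zs. ln (cmod (z - w))) - k * ln (cmod z) \<le> \<beta> (cmod (z - c))"
    and \<beta>: "(\<beta> \<longlongrightarrow> \<beta> R) (at_right R)"
  shows "A + (\<Sum>z\<in>#zs. ln (max R (cmod (z - c))) - Re (e * refl_pos R (z - c) ^ m) / (2 * m))
           - k * (ln (max R (cmod (- c))) - Re (e * refl_pos R (- c) ^ m) / (2 * m)) \<le> \<beta> R"
proof (rule tendsto_le[OF _ \<beta>])
  have max: "max R x \<noteq> 0" for x using less_le_trans[OF R max.cobounded1, of x] by simp
  show "((\<lambda>r. A + (\<Sum>z\<in>#zs. ln (max r (cmod (z - c))) - Re (e * refl_pos r (z - c) ^ m) / (2 * m))
           - k * (ln (max r (cmod (- c))) - Re (e * refl_pos r (- c) ^ m) / (2 * m))) \<longlongrightarrow>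
     A + (\<Sum>z\<in>#zs. ln (max R (cmod (z - c))) - Re (e * refl_pos R (z - c) ^ m) / (2 * m))
           - k * (ln (max R (cmod (- c))) - Re (e * refl_pos R (- c) ^ m) / (2 * m))) (at_right R)"
    by (intro tendsto_sum_mset tendsto_add tendsto_diff tendsto_mult tendsto_const tendsto_divide
        tendsto_ln tendsto_max tendsto_Re tendsto_power tendsto_refl_pos R max) (use m in auto)
  have "finite ((\<lambda>z. cmod (z - c)) ` set_mset zs)" by simp
  then have "\<forall>\<^sub>F r in at_right R. r \<notin> (\<lambda>z. cmod (z - c)) ` set_mset zs - {R}"
    by (intro eventually_at_topological[THEN iffD2] exI[of _ "- ((\<lambda>z. cmod (z - c)) ` set_mset zs - {R})"]
          conjI open_Compl finite_imp_closed) auto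
  moreover have "\<forall>\<^sub>F r in at_right R. R < r \<and> r < R + \<delta>"
    using \<delta> by (auto simp: eventually_at_right_field intro!: exI[of _ "R + \<delta>"])
  ultimately show "\<forall>\<^sub>F r in at_right R. A + (\<Sum>z\<in>#zs. ln (max r (cmod (z - c))) - Re (e * refl_pos r (z - c) ^ m) / (2 * m))
           - k * (ln (max r (cmod (- c))) - Re (e * refl_pos r (- c) ^ m) / (2 * m)) \<le> \<beta> r"
  proof eventually_elim
    case (elim r)
    show ?case
    proof (rule mode_ineq_aux[OF _ m e])
      show "r > 0" "k = 0 \<or> r < cmod c" using elim R c by auto
      show "cmod (z - c) \<noteq> r" if "z \<in># zs" for z using that elim by auto
      fix t
      define z where "z = c + of_real r * cis t"
      have z: "cmod (z - c) = r" using \<open>r > 0\<close> by (simp add: z_def norm_mult)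
      have "z \<notin># zs" using elim z by auto
      from le[OF _ _ this] elim z
      have "A + (\<Sum>w\<in>#zs. ln (cmod (z - w))) - k * ln (cmod z) \<le> \<beta> r" by simp
      moreover have "cmod (z - w) = cmod (of_real r * cis t - (w - c))"
          "cmod z = cmod (of_real r * cis t - (- c))" for w
        by (simp_all add: z_def algebra_simps)
      ultimately show "A + (\<Sum>z\<in>#zs. ln (cmod (of_real r * cis t - (z - c))))
               - k * ln (cmod (of_real r * cis t - (- c))) \<le> \<beta> r" by (simp only:)
    qed
  qed
qed simp


lemma sum_mset_Re_power:
  "(\<Sum>z\<in>#zs. g z - Re (e * f z ^ m) / c) = (\<Sum>z\<in>#zs. g z) - Re (e * (\<Sum>z\<in>#zs. f z ^ m)) / (c :: real)"
  by (induction zs) (simp_all add: ring_distribs add_divide_distrib del: times_complex.sel)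

text \<open>The phase e is free: rotating the mode sum S onto the negative real axis makes - Re (e *
  S) equal to |S|. The gap between an upper bound of ln |p| on the circle and its mean therefore
  controls every mode.\<close>

corollary jensen_mode:
  fixes zs :: "complex multiset" and \<beta> :: "real \<Rightarrow> real"
  assumes r: "r > 0" and m: "m > 0" and \<delta>: "\<delta> > 0"
    and le: "\<And>z. r \<le> cmod z \<Longrightarrow> cmod z < r + \<delta> \<Longrightarrow> z \<notin># zs \<Longrightarrow>
               A + (\<Sum>w\<in>#zs. ln (cmod (z - w))) \<le> \<beta> (cmod z)"
    and \<beta>: "(\<beta> \<longlongrightarrow> \<beta> r) (at_right r)"
  shows "A + (\<Sum>z\<in>#zs. ln (max r (cmod z))) + cmod (\<Sum>z\<in>#zs. refl_pos r z ^ m) / (2 * m) \<le> \<beta> r"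
proof -
  define S where "S = (\<Sum>z\<in>#zs. refl_pos r z ^ m)"
  obtain e where e: "cmod e = 1" "e * S = - of_real (cmod S)"
  proof (cases "S = 0")
    case True
    then show ?thesis using that[of 1] by simp
  next
    case False
    show ?thesis
    proof (rule that[of "- cnj S / of_real (cmod S)"])
      show "cmod (- cnj S / of_real (cmod S)) = 1" using False by (simp add: norm_divide)
      show "- cnj S / of_real (cmod S) * S = - of_real (cmod S)"
        using False by (simp add: complex_norm_square mult.commute flip: power2_eq_square)
          (simp add: complex_norm_square[symmetric] power2_eq_square mult.commute)
    qed
  qed
  have "A + (\<Sum>z\<in>#zs. ln (max r (cmod (z - 0))) - Re (e * refl_pos r (z - 0) ^ m) / real (2 * m))
           - 0 * (ln (max r (cmod (- 0))) - Re (e * refl_pos r (- 0) ^ m) / real (2 * m)) \<le> \<beta> r"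
    by (rule mode_ineq[where \<delta> = \<delta>]) (use assms e in auto)
  then show ?thesis
    unfolding sum_mset_Re_power using e by (simp add: S_def[symmetric])
qed

section \<open>A Harnack inequality on dominated annuli\<close>

text \<open>\<open>log_cap (R\<^sup>2) (\<bar>c - w\<bar>\<^sup>2) / 2\<close> is the area mean of \<open>ln \<bar>z - w\<bar>\<close> over the disc of radius \<open>R\<close> around \<open>c\<close>.\<close>
definition log_cap :: "real \<Rightarrow> real \<Rightarrow> real" where
  "log_cap \<rho> q = (if q \<ge> \<rho> then ln q else ln \<rho> - 1 + q / \<rho>)"

text \<open>Together with \<open>log_cap_le\<close> this places the area mean between the value at
  the centre and the mean over the bounding circle, as for any subharmonic function.\<close>

lemma log_cap_ge: "\<rho> > 0 \<Longrightarrow> q > 0 \<Longrightarrow> log_cap \<rho> q \<ge> ln q"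
  using ln_le_minus_one[of "q / \<rho>"] by (simp add: log_cap_def ln_div)

lemma log_cap_le: "\<rho> > 0 \<Longrightarrow> log_cap \<rho> q \<le> ln (max \<rho> q)"
  by (simp add: log_cap_def max_def)

text \<open>The two branches agree in value and slope at q = \<rho>. Hence area means can be
  differentiated while the disc moves across zeros, which plain logarithms would not allow.\<close>

lemma DERIV_log_cap:
  assumes "\<rho> > 0"
  shows "(log_cap \<rho> has_real_derivative 1 / max \<rho> q) (at q)"
proof -
  consider "q > \<rho>" | "q < \<rho>" | "q = \<rho>" by linarith
  then show ?thesis
  proof cases
    case 1
    have "(ln has_real_derivative 1 / max \<rho> q) (at q)"
      using 1 assms DERIV_ln_divide[of q] by (simp add: max_def)
    then show ?thesis
      by (rule has_field_derivative_transform_within_open[where S = "{\<rho><..}"])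
         (use 1 in \<open>auto simp: log_cap_def\<close>)
  next
    case 2
    have "((\<lambda>q. ln \<rho> - 1 + q / \<rho>) has_real_derivative 1 / max \<rho> q) (at q)"
      using 2 assms by (auto intro!: derivative_eq_intros simp: max_def)
    then show ?thesis
      by (rule has_field_derivative_transform_within_open[where S = "{..<\<rho>}"])
         (use 2 in \<open>auto simp: log_cap_def\<close>)
  next
    case 3
    have "(ln has_real_derivative 1 / \<rho>) (at \<rho> within {\<rho>..})"
      using DERIV_ln_divide[OF assms] by (rule has_field_derivative_at_within)
    then have 1: "(log_cap \<rho> has_real_derivative 1 / \<rho>) (at \<rho> within {\<rho>..})"
      by (rule has_field_derivative_transform_within[where d = 1]) (auto simp: log_cap_def)
    have "((\<lambda>q. ln \<rho> - 1 + q / \<rho>) has_real_derivative 1 / \<rho>) (at \<rho> within {..\<rho>})"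
      using assms by (auto intro!: derivative_eq_intros)
    then have 2: "(log_cap \<rho> has_real_derivative 1 / \<rho>) (at \<rho> within {..\<rho>})"
      by (rule has_field_derivative_transform_within[where d = 1]) (use assms in \<open>auto simp: log_cap_def\<close>)
    from 1 2 have "(log_cap \<rho> has_real_derivative 1 / \<rho>) (at \<rho> within {..\<rho>} \<union> {\<rho>..})"
      by (simp only: has_field_derivative_iff Lim_within_Un)
    moreover have "{..\<rho>} \<union> {\<rho>..} = UNIV" by auto
    ultimately show ?thesis using 3 by simp
  qed
qed

lemma sum_geometric_dist:
  fixes q :: real
  assumes "0 \<le> q" "q < 1" "k \<le> n"
  shows "(\<Sum>j\<le>n. q ^ nat \<bar>int j - int k\<bar>) \<le> 2 / (1 - q)"
proof -
  have geo: "(\<Sum>i\<in>A. q ^ i) \<le> 1 / (1 - q)" if "finite A" for A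
  proof -
    have "(\<Sum>i\<in>A. q ^ i) \<le> (\<Sum>i. q ^ i)"
      using assms that by (intro sum_le_suminf summable_geometric) auto
    then show ?thesis using assms by (simp add: suminf_geometric)
  qed
  have un: "{..n} = {..<k} \<union> {k..n}" using assms by auto
  then have "(\<Sum>j\<le>n. q ^ nat \<bar>int j - int k\<bar>) =
      (\<Sum>j\<in>{..<k}. q ^ nat \<bar>int j - int k\<bar>) + (\<Sum>j\<in>{k..n}. q ^ nat \<bar>int j - int k\<bar>)"
    unfolding un by (intro sum.union_disjoint) auto
  also have "(\<Sum>j\<in>{..<k}. q ^ nat \<bar>int j - int k\<bar>) = (\<Sum>i\<in>(\<lambda>j. k - j) ` {..<k}. q ^ i)"
    by (subst sum.reindex) (auto intro!: sum.cong inj_onI arg_cong[of _ _ "\<lambda>i. q ^ i"])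
  also have "(\<Sum>j\<in>{k..n}. q ^ nat \<bar>int j - int k\<bar>) = (\<Sum>i\<in>(\<lambda>j. j - k) ` {k..n}. q ^ i)"
    by (subst sum.reindex) (auto intro!: sum.cong inj_onI arg_cong[of _ _ "\<lambda>i. q ^ i"])
  also have "(\<Sum>i\<in>(\<lambda>j. k - j) ` {..<k}. q ^ i) + (\<Sum>i\<in>(\<lambda>j. j - k) ` {k..n}. q ^ i) \<le> 1 / (1 - q) + 1 / (1 - q)"
    by (intro add_mono geo) auto
  finally show ?thesis by simp
qed

text \<open>A coefficient is a Fourier coefficient, hence at most the maximum on the circle. The
  range [- 2 pi, 0] is deliberate: growth estimates run only forward in t, and from such a start
  they cover all of [0, 2 pi].\<close>

lemma coeff_le_max_circle:
  fixes b :: "nat \<Rightarrow> complex"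
  assumes "k \<le> n"
  obtains t where "-2*pi \<le> t" "t \<le> 0" "cmod (b k) \<le> cmod (\<Sum>j\<le>n. b j * cis t ^ j)"
proof -
  define f where "f t = cmod (\<Sum>j\<le>n. b j * cis t ^ j)" for t
  have "continuous_on {-2*pi..0} f"
    unfolding f_def cis_conv_exp by (intro continuous_intros)
  moreover have "compact {-2*pi..0}" "{-2*pi..0} \<noteq> {}" by auto
  ultimately obtain t where t: "t \<in> {-2*pi..0}" "\<And>u. u \<in> {-2*pi..0} \<Longrightarrow> f u \<le> f t"
    using continuous_attains_sup[of "{-2*pi..0}" f] by blast
  have le: "f u \<le> f t" if "u \<in> {0..2*pi}" for u
  proof -
    have "cis (u - 2 * pi) = cis u" by (simp add: complex_eq_iff cos_diff sin_diff)
    then have "f u = f (u - 2 * pi)" by (simp add: f_def)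
    also have "\<dots> \<le> f t" using that by (intro t(2)) auto
    finally show ?thesis .
  qed
  have "((\<lambda>t. \<Sum>j\<le>n. b j * cis (of_int (int j - int k) * t)) has_integral
      (\<Sum>j\<le>n. b j * of_real (if int j - int k = 0 then 2 * pi else 0))) {0..2*pi}"
    by (intro has_integral_sum has_integral_mult_right has_integral_cis) auto
  also have "(\<Sum>j\<le>n. b j * of_real (if int j - int k = 0 then 2 * pi else 0)) =
      (\<Sum>j\<le>n. if j = k then of_real (2 * pi) * b k else 0)"
    by (intro sum.cong) auto
  also have "\<dots> = of_real (2 * pi) * b k" using assms by simp
  finally have int: "((\<lambda>t. \<Sum>j\<le>n. b j * cis (of_int (int j - int k) * t)) has_integral of_real (2 * pi) * b k) {0..2*pi}" .
  have "cmod (of_real (2 * pi) * b k) \<le> f t * measure lborel {0..2*pi}"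
  proof (rule has_integral_bound_real[OF _ finite.emptyI int])
    show "0 \<le> f t" by (simp add: f_def)
    fix u assume "u \<in> {0..2*pi} - {}"
    then have u: "u \<in> {0..2*pi}" by simp
    have "b j * cis (of_int (int j - int k) * u) = cis (- (real k * u)) * (b j * cis u ^ j)" for j
    proof -
      have "of_int (int j - int k) * u = - (real k * u) + real j * u" by (simp add: left_diff_distrib)
      then have "cis (of_int (int j - int k) * u) = cis (- (real k * u)) * cis u ^ j"
        by (simp only: cis_mult[symmetric] Complex.DeMoivre)
      then show ?thesis by simp
    qed
    then have "(\<Sum>j\<le>n. b j * cis (of_int (int j - int k) * u)) = cis (- (real k * u)) * (\<Sum>j\<le>n. b j * cis u ^ j)"
      by (simp only: sum_distrib_left)
    then have "cmod (\<Sum>j\<le>n. b j * cis (of_int (int j - int k) * u)) = f u"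
      by (simp add: f_def norm_mult)
    then show "cmod (\<Sum>j\<le>n. b j * cis (of_int (int j - int k) * u)) \<le> f t" using le[OF u] by simp
  qed
  then have "cmod (b k) \<le> f t" by (simp add: norm_mult)
  then show ?thesis using that[of t] t(1) by (auto simp: f_def)
qed


text \<open>With \<open>e = - cnj (\<i> * cis t)\<close> the derivative is
  \<open>Re (e * refl_pos R (w - cis t)) / R\<close>. Moving the disc along the unit circle thus
  produces the first Fourier mode on its boundary, which is how \<open>mode_ineq\<close> with m = 1
  comes to bound a derivative.\<close>

lemma ln_cmod_cis_cap:
  fixes w :: complex
  assumes "R > 0"
  defines "q \<equiv> \<lambda>t. (cmod (cis t - w))\<^sup>2"
  shows "((\<lambda>t. log_cap (R\<^sup>2) (q t) / 2) has_real_derivative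
           - Re ((w - cis t) * cnj (\<i> * cis t)) / (max R (cmod (w - cis t)))\<^sup>2) (at t)"
proof -
  have q: "q = (\<lambda>t. 1 + (cmod w)\<^sup>2 - 2 * (Re w * cos t + Im w * sin t))"
  proof
    fix t
    have "q t = (cos t)\<^sup>2 + (sin t)\<^sup>2 + (cmod w)\<^sup>2 - 2 * (Re w * cos t + Im w * sin t)"
      unfolding q_def cmod_power2 by (simp add: power2_eq_square algebra_simps)
    then show "q t = 1 + (cmod w)\<^sup>2 - 2 * (Re w * cos t + Im w * sin t)" by simp
  qed
  have dq: "(q has_real_derivative 2 * (Re w * sin t - Im w * cos t)) (at t)"
    unfolding q by (auto intro!: derivative_eq_intros simp: algebra_simps)
  have R2: "R\<^sup>2 > 0" using assms by simp
  have "((\<lambda>t. log_cap (R\<^sup>2) (q t) / 2) has_real_derivative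
          1 / max (R\<^sup>2) (q t) * (2 * (Re w * sin t - Im w * cos t)) / 2) (at t)"
    by (intro DERIV_cdivide DERIV_chain2[OF DERIV_log_cap[OF R2] dq])
  moreover have "max (R\<^sup>2) (q t) = (max R (cmod (w - cis t)))\<^sup>2"
    using assms by (auto simp: max_def q_def norm_minus_commute abs_le_square_iff[symmetric])
  moreover have "Re ((w - cis t) * cnj (\<i> * cis t)) = - (Re w * sin t - Im w * cos t)"
    by (simp add: algebra_simps)
  moreover have "1 / x * (2 * y) / 2 = - (- y) / x" for x y :: real by simp
  ultimately show ?thesis by (simp only:)
qed

text \<open>If \<open>w\<close> is within \<open>R\<close> of the unit circle, it is pushed radially to modulus \<open>1 + R\<close>, which dominates the
  capped logarithm and avoids the logarithmic singularity.\<close>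
lemma cap_mean_bound:
  fixes w :: complex
  assumes R: "0 < R" "R \<le> 1/4"
  shows "\<exists>f I. (f has_integral I) {0..2*pi} \<and>
     I \<le> 2 * pi * (ln (max 1 (cmod w)) / 2 + ln (max (exp (8*R)) (cmod w)) / 4 + ln (max (exp (- 8*R)) (cmod w)) / 4) \<and>
     (\<forall>t. log_cap (R\<^sup>2) ((cmod (cis t - w))\<^sup>2) / 2 \<le> f t)"
proof (cases "\<bar>cmod w - 1\<bar> < R")
  case False
  have ge: "cmod (cis t - w) \<ge> R" for t
    using norm_triangle_ineq3[of w "cis t"] norm_triangle_ineq3[of "cis t" w] False
    by (simp add: norm_minus_commute)
  have "((\<lambda>t. ln (cmod (of_real 1 * cis t - w))) has_integral 2 * pi * ln (max 1 (cmod w))) {0..2*pi}"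
    using False R by (intro has_integral_ln_circle) auto
  then have int: "((\<lambda>t. ln (cmod (cis t - w))) has_integral 2 * pi * ln (max 1 (cmod w))) {0..2*pi}"
    by simp
  have "log_cap (R\<^sup>2) ((cmod (cis t - w))\<^sup>2) / 2 \<le> ln (cmod (cis t - w))" for t
    using ge[of t] R by (simp add: log_cap_def power_mono ln_realpow)
  \<comment> \<open>Midpoint convexity of max s (ln |w|) in the logarithmic radius s, applied to the
    points 8 * R and - 8 * R.\<close>
  moreover have "ln (max 1 (cmod w)) \<le> ln (max 1 (cmod w)) / 2 + ln (max (exp (8*R)) (cmod w)) / 4 + ln (max (exp (- 8*R)) (cmod w)) / 4"
  proof (cases "cmod w \<le> 1")
    case True
    have "ln (max (exp (8*R)) (cmod w)) \<ge> ln (exp (8*R))" "ln (max (exp (- 8*R)) (cmod w)) \<ge> ln (exp (- 8*R))"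
      by (subst ln_le_cancel_iff; simp add: less_max_iff_disj)+
    with True show ?thesis by (simp add: max_def)
  next
    case w: False
    have "ln (max (exp (8*R)) (cmod w)) \<ge> ln (cmod w)" "ln (max (exp (- 8*R)) (cmod w)) \<ge> ln (cmod w)"
      using order.strict_trans[OF zero_less_one, of "cmod w"] w
      by (auto simp: less_max_iff_disj intro!: ln_le_cancel_iff[THEN iffD2])
    with w show ?thesis by (simp add: max_def)
  qed
  ultimately show ?thesis using int by (intro exI conjI allI) (auto intro!: mult_left_mono)
next
  case True
  define u where "u = w / of_real (cmod w)"
  have w0: "cmod w > 0" "w \<noteq> 0" using True R by auto
  have u: "cmod u = 1" "w = of_real (cmod w) * u" using w0 by (auto simp: u_def norm_divide)
  define w' where "w' = of_real (1 + R) * u"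
  have w': "cmod w' = 1 + R" using u R by (simp only: w'_def norm_mult norm_of_real) simp
  have "((\<lambda>t. ln (cmod (of_real 1 * cis t - w'))) has_integral 2 * pi * ln (max 1 (cmod w'))) {0..2*pi}"
    using w' R by (intro has_integral_ln_circle) auto
  then have int: "((\<lambda>t. ln (cmod (cis t - w'))) has_integral 2 * pi * ln (1 + R)) {0..2*pi}"
    using w' R by (simp add: max_def)
  \<comment> \<open>In this form both summands can be compared when r moves from |w|, which is
    within R of 1, to 1 + R: neither decreases.\<close>
  have sq: "(cmod (cis t - of_real r * u))\<^sup>2 = (1 - r)\<^sup>2 + r * (2 * (1 - Re (cnj u * cis t)))" for t r
  proof -
    have "(cmod (cis t - of_real r * u))\<^sup>2 = (cmod (cis t))\<^sup>2 + r\<^sup>2 * (cmod u)\<^sup>2 - 2 * r * Re (cnj u * cis t)"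
      unfolding cmod_power2 by (simp add: power2_eq_square algebra_simps)
    also have "\<dots> = (1 - r)\<^sup>2 + r * (2 * (1 - Re (cnj u * cis t)))"
      using u by (simp add: power2_eq_square algebra_simps)
    finally show ?thesis .
  qed
  have g: "0 \<le> 2 * (1 - Re (cnj u * cis t))" for t
    using complex_Re_le_cmod[of "cnj u * cis t"] u by (simp add: norm_mult del: times_complex.sel)
  have le: "log_cap (R\<^sup>2) ((cmod (cis t - w))\<^sup>2) / 2 \<le> ln (cmod (cis t - w'))" for t
  proof -
    have "(cmod (cis t - w'))\<^sup>2 \<ge> R\<^sup>2"
      using g[of t] R unfolding w'_def sq by (simp add: del: times_complex.sel)
    moreover from this have pos: "cmod (cis t - w') > 0"
      using R by (metis abs_norm_cancel abs_le_square_iff abs_of_pos less_le_trans)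
    moreover have "(cmod (cis t - w'))\<^sup>2 \<ge> (cmod (cis t - w))\<^sup>2"
    proof -
      have "(1 - cmod w)\<^sup>2 \<le> (1 - (1 + R))\<^sup>2"
        using True by (subst abs_le_square_iff[symmetric]) auto
      moreover have "cmod w * (2 * (1 - Re (cnj u * cis t))) \<le> (1 + R) * (2 * (1 - Re (cnj u * cis t)))"
        using True by (intro mult_right_mono g) auto
      ultimately show ?thesis
        unfolding w'_def sq by (subst u(2), subst sq) linarith
    qed
    ultimately have "log_cap (R\<^sup>2) ((cmod (cis t - w))\<^sup>2) \<le> ln ((cmod (cis t - w'))\<^sup>2)"
      using R pos by (intro order.trans[OF log_cap_le] ln_le_cancel_iff[THEN iffD2]) (auto simp: less_max_iff_disj)
    with pos show ?thesis by (simp add: ln_realpow)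
  qed
  \<comment> \<open>Here the convexity gain is used up: the radius exp (8 * R) contributes 2 * R,
    the other two terms lose at most R / 2 together, and ln (1 + R) is at most R.\<close>
  have "ln (1 + R) \<le> ln (max 1 (cmod w)) / 2 + ln (max (exp (8*R)) (cmod w)) / 4 + ln (max (exp (- 8*R)) (cmod w)) / 4"
  proof -
    have 1: "ln (1 + R) \<le> R" using R by (intro ln_add_one_self_le_self) auto
    have "1 + (- 2 * R) \<le> exp (- 2 * R)" "1 + 8 * R \<le> exp (8 * R)" by (rule exp_ge_add_one_self)+
    moreover have "exp (- 2 * R) \<le> cmod w"
    proof -
      have "exp (- 2 * R) * (1 + 2 * R) \<le> exp (- 2 * R) * exp (2 * R)"
        by (intro mult_left_mono exp_ge_add_one_self) auto
      then have "exp (- 2 * R) * (1 + 2 * R) \<le> 1" by (simp flip: exp_add)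
      then have "exp (- 2 * R) \<le> 1 / (1 + 2 * R)" using R by (simp add: field_simps)
      also have "\<dots> \<le> 1 - R"
      proof -
        have "0 \<le> R * (1 - 2 * R)" using R by auto
        then have "1 \<le> (1 - R) * (1 + 2 * R)" by (simp add: algebra_simps)
        then show ?thesis using R by (simp add: field_simps)
      qed
      finally show ?thesis using True by linarith
    qed
    moreover have "exp (- 8 * R) \<le> exp (- 2 * R)" using R by simp
    ultimately have e: "exp (- 2 * R) \<le> cmod w" "cmod w \<le> exp (8 * R)" "exp (- 8 * R) \<le> cmod w"
      using True R by linarith+
    have 2: "ln (max (exp (8*R)) (cmod w)) = 8 * R" using e by (simp add: max_def)
    have 3: "ln (max (exp (-8*R)) (cmod w)) = ln (cmod w)" using e by (simp add: max_def)
    have 4: "ln (cmod w) \<ge> - 2 * R" using e(1) w0 by (subst ln_ge_iff) auto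
    have 5: "ln (max 1 (cmod w)) \<ge> 0" by (intro ln_ge_zero) simp
    show ?thesis unfolding 2 3 using 1 4 5 R by linarith
  qed
  with int le show ?thesis by (intro exI conjI allI) (auto intro!: mult_left_mono)
qed


lemma exp_growth:
  fixes a :: "real \<Rightarrow> real"
  assumes "\<And>t. (a has_real_derivative a' t) (at t)" "\<And>t. a' t \<le> K * a t" "s \<le> t"
  shows "a t \<le> a s * exp (K * (t - s))"
proof -
  have "a t * exp (- K * t) \<le> a s * exp (- K * s)"
  proof (rule DERIV_nonpos_imp_nonincreasing[OF assms(3)])
    fix x
    have "((\<lambda>t. a t * exp (- K * t)) has_real_derivative (a' x - K * a x) * exp (- K * x)) (at x)"
      by (auto intro!: derivative_eq_intros assms(1) simp: algebra_simps)
    moreover have "(a' x - K * a x) * exp (- K * x) \<le> 0"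
      using assms(2)[of x] by (intro mult_nonpos_nonneg) auto
    ultimately show "\<exists>y. ((\<lambda>t. a t * exp (- K * t)) has_real_derivative y) (at x) \<and> y \<le> 0" by blast
  qed
  then have "a t * exp (- K * t) * exp (K * t) \<le> a s * exp (- K * s) * exp (K * t)"
    by (intro mult_right_mono) auto
  then show ?thesis by (simp add: mult.assoc right_diff_distrib flip: exp_add)
qed

text \<open>If the \<open>k\<close>-th term dominates on an annulus around the unit circle, the mean of
  \<open>ln \<bar>p\<bar>\<close> over that circle cannot be very negative: the disc averages \<open>a t\<close> of
  \<open>\<beta> + k ln \<bar>z\<bar> - ln \<bar>p z\<bar> \<ge> 0\<close> along the circle satisfy the differential Harnack inequality
  \<open>a' \<le> (2 / R) a\<close>.\<close>
theorem dominated_annulus_mode_bound: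
  fixes b :: "nat \<Rightarrow> complex"
  assumes fact: "\<And>z. (\<Sum>j\<le>n. b j * z ^ j) = L * (\<Prod>w\<in>#zs. z - w)" and L: "L \<noteq> 0"
    and k: "k \<le> n" "b k = 1"
    and dom: "\<And>j. j \<le> n \<Longrightarrow> cmod (b j) \<le> exp (- \<eta> * \<bar>real j - real k\<bar>)"
    and \<eta>: "0 < \<eta>" "\<eta> \<le> 1" and m: "m > 0"
  shows "cmod (\<Sum>w\<in>#zs. refl_pos 1 w ^ m) \<le> 4 * real m * (ln (6/\<eta>) * exp (256 * pi / \<eta>))"
proof -
  define A where "A = ln (cmod L)"
  define \<beta> where "\<beta> = ln (6/\<eta>)"
  \<comment> \<open>Discs of radius 2 * R about points of the unit circle stay in the annulus with
    logarithmic radii between - \<eta> / 2 and \<eta> / 2, and so do the radii exp (8 * R) and exp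
    (- 8 * R).\<close>
  define R where "R = \<eta> / 32"
  \<comment> \<open>The growth rate is 2 / R = 64 / \<eta>, over an angle of at most 4 * pi.\<close>
  define E where "E = \<beta> * exp (256 * pi / \<eta>)"
  have \<beta>: "\<beta> > 0" using \<eta> by (simp add: \<beta>_def)
  have R: "0 < R" "R \<le> 1/4" using \<eta> by (auto simp: R_def)
  have lnp: "ln (cmod (\<Sum>j\<le>n. b j * z ^ j)) = A + (\<Sum>w\<in>#zs. ln (cmod (z - w)))"
    if "z \<notin># zs" for z
  proof -
    have "cmod (\<Prod>w\<in>#zs. z - w) > 0 \<and> ln (cmod (\<Prod>w\<in>#zs. z - w)) = (\<Sum>w\<in>#zs. ln (cmod (z - w)))"
      using that by (induction zs) (auto simp: norm_mult ln_mult)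
    then show ?thesis using L unfolding fact by (simp add: norm_mult ln_mult A_def)
  qed
  \<comment> \<open>Half of the margin \<eta> absorbs the deviation of |z| from 1; the other half is
    the decay rate of the geometric series with ratio q.\<close>
  have upper: "cmod (\<Sum>j\<le>n. b j * z ^ j) \<le> cmod z ^ k * (6/\<eta>)"
    if z: "exp (-\<eta>/2) \<le> cmod z" "cmod z \<le> exp (\<eta>/2)" for z
  proof -
    define q where "q = exp (-\<eta>/2)"
    have q: "0 \<le> q" "q < 1" "q * q = exp (-\<eta>)" using \<eta> by (auto simp: q_def simp flip: exp_add)
    have z0: "cmod z > 0" using z exp_gt_zero less_le_trans by blast
    have q': "cmod z \<le> inverse q" "inverse (cmod z) \<le> inverse q"
      using z(2) le_imp_inverse_le[OF z(1)] by (simp_all add: q_def exp_minus)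
    have tm: "cmod (b j * z ^ j) \<le> cmod z ^ k * q ^ nat \<bar>int j - int k\<bar>" if j: "j \<le> n" for j
    proof -
      define d where "d = nat \<bar>int j - int k\<bar>"
      have d: "\<bar>real j - real k\<bar> = real d" by (simp add: d_def)
      have b: "cmod (b j) \<le> q ^ d * q ^ d"
      proof -
        have "q ^ d * q ^ d = exp (real d * - \<eta>)"
          by (simp only: power_mult_distrib[symmetric] q(3) exp_of_nat_mult)
        then show ?thesis using dom[OF j] by (simp add: d mult.commute)
      qed
      have zj: "cmod z ^ j * q ^ d \<le> cmod z ^ k"
      proof (cases "j \<ge> k")
        case True
        then have j: "j = k + d" by (simp add: d_def)
        have "cmod z ^ d * q ^ d \<le> 1"
        proof -
          have "cmod z * q \<le> inverse q * q" using q' q by (intro mult_right_mono) auto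
          also have "\<dots> = 1" by (simp add: q_def)
          finally have "(cmod z * q) ^ d \<le> 1" using z0 q by (intro power_le_one) auto
          then show ?thesis by (simp only: power_mult_distrib)
        qed
        then have "cmod z ^ k * (cmod z ^ d * q ^ d) \<le> cmod z ^ k * 1" by (intro mult_left_mono) auto
        then show ?thesis by (simp add: j power_add mult.assoc)
      next
        case False
        then have kj: "k = j + d" by (simp add: d_def)
        have "q ^ d \<le> cmod z ^ d" using z q by (intro power_mono) (auto simp: q_def)
        then show ?thesis by (simp add: kj power_add mult_left_mono)
      qed
      have "cmod (b j * z ^ j) \<le> q ^ d * q ^ d * cmod z ^ j"
        unfolding norm_mult norm_power using b by (intro mult_right_mono) auto
      also have "\<dots> = (cmod z ^ j * q ^ d) * q ^ d" by simp
      also have "\<dots> \<le> cmod z ^ k * q ^ d" using zj q by (intro mult_right_mono) auto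
      finally show ?thesis by (simp add: d_def)
    qed
    have "cmod (\<Sum>j\<le>n. b j * z ^ j) \<le> (\<Sum>j\<le>n. cmod z ^ k * q ^ nat \<bar>int j - int k\<bar>)"
      by (intro sum_norm_le tm) auto
    also have "\<dots> \<le> cmod z ^ k * (2 / (1 - q))"
      unfolding sum_distrib_left[symmetric] using q k by (intro mult_left_mono sum_geometric_dist) auto
    also have "2 / (1 - q) \<le> 6 / \<eta>"
    proof -
      have "q * (1 + \<eta>/2) \<le> q * exp (\<eta>/2)" using q by (intro mult_left_mono exp_ge_add_one_self) auto
      then have "q * (1 + \<eta>/2) \<le> 1" by (simp add: q_def flip: exp_add)
      then have "q \<le> 1 / (1 + \<eta>/2)" using \<eta> by (simp add: field_simps)
      also have "\<dots> \<le> 1 - \<eta> / 3"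
      proof -
        have "0 \<le> \<eta> * (1 - \<eta>) / 6" using \<eta> by auto
        then have "1 \<le> (1 - \<eta> / 3) * (1 + \<eta>/2)" by (simp add: field_simps)
        then show ?thesis using \<eta> by (simp add: divide_le_eq)
      qed
      finally show ?thesis using \<eta> q by (simp add: field_simps)
    qed
    finally show ?thesis by (simp add: mult_left_mono)
  qed
  have upper_ln: "A + (\<Sum>w\<in>#zs. ln (cmod (z - w))) \<le> \<beta> + k * ln (cmod z)"
    if z: "exp (-\<eta>/2) \<le> cmod z" "cmod z \<le> exp (\<eta>/2)" "z \<notin># zs" for z
  proof -
    have z0: "cmod z > 0" using z exp_gt_zero less_le_trans by blast
    have "(\<Sum>j\<le>n. b j * z ^ j) \<noteq> 0" using z(3) L unfolding fact by auto
    then have "ln (cmod (\<Sum>j\<le>n. b j * z ^ j)) \<le> ln (cmod z ^ k * (6/\<eta>))"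
      using upper[OF z(1,2)] z0 \<eta> by (intro ln_le_cancel_iff[THEN iffD2]) auto
    also have "\<dots> = \<beta> + k * ln (cmod z)"
      unfolding \<beta>_def using z0 \<eta> by (subst ln_mult) (auto simp: ln_realpow)
    finally show ?thesis using lnp[OF z(3)] by simp
  qed
  define h where "h w t = log_cap (R\<^sup>2) ((cmod (cis t - w))\<^sup>2) / 2" for w t
  define h' where "h' w t = - Re ((w - cis t) * cnj (\<i> * cis t)) / (max R (cmod (w - cis t)))\<^sup>2" for w t
  \<comment> \<open>The term k ln |z| leaves no trace: it is harmonic on the disc, so its area mean
    is its value 0 at the centre \<open>cis t\<close>.\<close>
  define a where "a t = \<beta> - A - (\<Sum>w\<in>#zs. h w t)" for t
  have da: "(a has_real_derivative - (\<Sum>w\<in>#zs. h' w t)) (at t)" for t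
  proof -
    have dh: "(h w has_real_derivative h' w t) (at t)" for w
      unfolding h_def h'_def by (rule ln_cmod_cis_cap[OF R(1)])
    have "((\<lambda>t. \<Sum>w\<in>#zs. h w t) has_real_derivative (\<Sum>w\<in>#zs. h' w t)) (at t)"
      by (induction zs) (auto intro!: derivative_intros dh)
    then show ?thesis unfolding a_def by (auto intro!: derivative_eq_intros)
  qed
  \<comment> \<open>This is \<open>mode_ineq\<close> for m = 1 on the circle of radius R about
    \<open>cis t\<close>; e is the tangential direction that turns the first mode into the
    derivative of \<open>a\<close>.\<close>
  have da_le: "- (\<Sum>w\<in>#zs. h' w t) \<le> 2 / R * a t" for t
  proof -
    define e where "e = - cnj (\<i> * cis t)"
    have lo: "exp (-\<eta>/2) \<le> 1 - 2 * R"
    proof -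
      have "exp (-\<eta>/2) * (1 + \<eta>/2) \<le> exp (-\<eta>/2) * exp (\<eta>/2)" by (intro mult_left_mono exp_ge_add_one_self) auto
      then have "exp (-\<eta>/2) * (1 + \<eta>/2) \<le> 1" by (simp flip: exp_add)
      then have "exp (-\<eta>/2) \<le> 1 / (1 + \<eta>/2)" using \<eta> by (simp add: field_simps)
      also have "\<dots> \<le> 1 - 2 * R"
      proof -
        have "0 \<le> \<eta> * (14 - \<eta>) / 32" using \<eta> by auto
        then have "1 \<le> (1 - 2 * R) * (1 + \<eta>/2)" by (simp add: R_def field_simps)
        then show ?thesis using \<eta> by (simp add: divide_le_eq)
      qed
      finally show ?thesis .
    qed
    have hi: "1 + 2 * R \<le> exp (\<eta>/2)"
      unfolding R_def using exp_ge_add_one_self[of "\<eta>/2"] \<eta> by linarith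
    have "A + (\<Sum>w\<in>#zs. ln (max R (cmod (w - cis t))) - Re (e * refl_pos R (w - cis t) ^ 1) / real (2 * 1))
        - real k * (ln (max R (cmod (- cis t))) - Re (e * refl_pos R (- cis t) ^ 1) / real (2 * 1)) \<le> (\<lambda>_. \<beta>) R"
    proof (rule mode_ineq[where \<delta> = R])
      show "cmod e = 1" by (simp add: e_def norm_mult)
      fix z assume z: "R \<le> cmod (z - cis t)" "cmod (z - cis t) < R + R" "z \<notin># zs"
      have "cmod z \<le> 1 + 2 * R" "cmod z \<ge> 1 - 2 * R"
        using norm_triangle_ineq2[of z "cis t"] norm_triangle_ineq2[of "cis t" z] z
        by (auto simp: norm_minus_commute)
      then show "A + (\<Sum>w\<in>#zs. ln (cmod (z - w))) - real k * ln (cmod z) \<le> \<beta>"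
        using upper_ln[of z] lo hi z(3) by simp
    qed (use R in auto)
    \<comment> \<open>Again k ln |z| drops out: its value at the centre is 0, and its gradient there
      is radial, hence orthogonal to e.\<close>
    moreover have "ln (max R (cmod (- cis t))) = 0" using R by (simp add: max_def)
    moreover have "Re (e * refl_pos R (- cis t)) = 0"
      using R by (simp add: e_def refl_pos_def max_def)
    moreover have "Re (e * refl_pos R (w - cis t)) = R * h' w t" for w
      by (simp add: e_def refl_pos_def h'_def algebra_simps add_divide_distrib diff_divide_distrib)
    ultimately have "A + (\<Sum>w\<in>#zs. ln (max R (cmod (w - cis t))) - R / 2 * h' w t) \<le> \<beta>"
      by simp
    moreover have "(\<Sum>w\<in>#zs. h w t) - R / 2 * (\<Sum>w\<in>#zs. h' w t) \<le> (\<Sum>w\<in>#zs. ln (max R (cmod (w - cis t))) - R / 2 * h' w t)"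
    proof -
      have "h w t \<le> ln (max R (cmod (w - cis t)))" for w
      proof -
        have "h w t \<le> ln (max (R\<^sup>2) ((cmod (cis t - w))\<^sup>2)) / 2"
          unfolding h_def using R by (intro divide_right_mono log_cap_le) auto
        also have "max (R\<^sup>2) ((cmod (cis t - w))\<^sup>2) = (max R (cmod (w - cis t)))\<^sup>2"
          using R by (auto simp: max_def norm_minus_commute abs_le_square_iff[symmetric])
        also have "ln \<dots> / 2 = ln (max R (cmod (w - cis t)))"
          using R by (subst ln_realpow) (auto simp: less_max_iff_disj)
        finally show ?thesis .
      qed
      then have "(\<Sum>w\<in>#zs. h w t - R / 2 * h' w t) \<le> (\<Sum>w\<in>#zs. ln (max R (cmod (w - cis t))) - R / 2 * h' w t)"
        by (intro sum_mset_mono) auto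
      also have "(\<Sum>w\<in>#zs. h w t - R / 2 * h' w t) = (\<Sum>w\<in>#zs. h w t) - R / 2 * (\<Sum>w\<in>#zs. h' w t)"
        by (induction zs) (simp_all add: algebra_simps)
      finally show ?thesis .
    qed
    ultimately have "- (R / 2 * (\<Sum>w\<in>#zs. h' w t)) \<le> a t" by (simp add: a_def)
    then have "2 / R * - (R / 2 * (\<Sum>w\<in>#zs. h' w t)) \<le> 2 / R * a t"
      using R by (intro mult_left_mono) auto
    then show ?thesis using R by simp
  qed
  have a_le: "a t \<le> E" if t: "t \<in> {0..2*pi}" for t
  proof -
    \<comment> \<open>At some point of the circle |p| is at least |b k| = 1; there the sub-mean
      value property gives a s \<le> \<beta>, the starting value for Harnack.\<close>
    obtain s where s: "-2*pi \<le> s" "s \<le> 0" "cmod (b k) \<le> cmod (\<Sum>j\<le>n. b j * cis s ^ j)"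
      using coeff_le_max_circle[OF k(1)] by blast
    have nz: "cis s \<notin># zs"
    proof
      assume "cis s \<in># zs"
      then have P: "(\<Prod>w\<in>#zs. cis s - w) = 0" by (auto simp: prod_mset_zero_iff)
      show False using s(3) k(2) unfolding fact P by simp
    qed
    have "A + (\<Sum>w\<in>#zs. ln (cmod (cis s - w))) \<ge> 0"
      using s(3) k(2) unfolding lnp[OF nz, symmetric] by simp
    moreover have "(\<Sum>w\<in>#zs. ln (cmod (cis s - w))) \<le> (\<Sum>w\<in>#zs. h w s)"
    proof (rule sum_mset_mono)
      fix w assume "w \<in># zs"
      then have "cmod (cis s - w) > 0" using nz by auto
      then show "ln (cmod (cis s - w)) \<le> h w s"
        using log_cap_ge[of "R\<^sup>2" "(cmod (cis s - w))\<^sup>2"] R by (simp add: h_def ln_realpow)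
    qed
    ultimately have "a s \<le> \<beta>" by (simp add: a_def)
    have "a t \<le> a s * exp (2 / R * (t - s))"
      using s t by (intro exp_growth[OF da da_le]) auto
    also have "\<dots> \<le> \<beta> * exp (2 / R * (t - s))"
      using \<open>a s \<le> \<beta>\<close> by (intro mult_right_mono) auto
    also have "\<dots> \<le> \<beta> * exp (2 / R * (4 * pi))"
    proof -
      have "2 / R * (t - s) \<le> 2 / R * (4 * pi)" using s t R by (intro mult_left_mono) auto
      then show ?thesis using \<beta> by (intro mult_left_mono) auto
    qed
    also have "\<dots> = E" by (simp add: E_def R_def)
    finally show ?thesis .
  qed
  define B where "B w = ln (max 1 (cmod w)) / 2 + ln (max (exp (8*R)) (cmod w)) / 4
                      + ln (max (exp (- 8*R)) (cmod w)) / 4" for w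
  have "\<forall>w. \<exists>f I. (f has_integral I) {0..2*pi} \<and> I \<le> 2 * pi * B w \<and> (\<forall>t. h w t \<le> f t)"
    using cap_mean_bound[OF R] by (simp add: B_def h_def)
  then obtain f I where fI: "\<And>w. (f w has_integral I w) {0..2*pi}" "\<And>w. I w \<le> 2 * pi * B w"
      "\<And>w t. h w t \<le> f w t"
    by metis
  \<comment> \<open>Averaging a t \<le> E over the circle bounds the mean of ln |p| from below; the
    majorants f w have explicitly bounded integrals, unlike the capped logarithms h w.\<close>
  have "(\<beta> - A - E) * (2 * pi) \<le> (\<Sum>w\<in>#zs. I w)"
  proof (rule has_integral_le)
    show "((\<lambda>_. \<beta> - A - E) has_integral (\<beta> - A - E) * (2 * pi)) {0..2*pi}"
      using has_integral_const_real[of "\<beta> - A - E" 0 "2*pi"] by (simp add: mult.commute)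
    show "((\<lambda>t. \<Sum>w\<in>#zs. f w t) has_integral (\<Sum>w\<in>#zs. I w)) {0..2*pi}"
      by (intro has_integral_sum_mset fI)
    fix t assume "t \<in> {0..2*pi}"
    moreover have "(\<Sum>w\<in>#zs. h w t) \<le> (\<Sum>w\<in>#zs. f w t)" by (intro sum_mset_mono fI)
    ultimately show "\<beta> - A - E \<le> (\<Sum>w\<in>#zs. f w t)" using a_le[of t] by (simp add: a_def)
  qed
  also have "\<dots> \<le> (\<Sum>w\<in>#zs. 2 * pi * B w)" by (intro sum_mset_mono fI)
  also have "\<dots> = (\<Sum>w\<in>#zs. B w) * (2 * pi)" unfolding sum_mset_distrib_left[symmetric] by simp
  finally have mean: "\<beta> - E \<le> A + (\<Sum>w\<in>#zs. B w)" by simp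
  \<comment> \<open>By Jensen's formula this is the mean of ln |p| over the circle of radius
    r.\<close>
  define N where "N r = A + (\<Sum>w\<in>#zs. ln (max r (cmod w)))" for r
  have AB: "A + (\<Sum>w\<in>#zs. B w) = N 1 / 2 + N (exp (8*R)) / 4 + N (exp (- 8*R)) / 4"
  proof -
    have "(\<Sum>w\<in>#zs. B w) = (\<Sum>w\<in>#zs. ln (max 1 (cmod w))) / 2 + (\<Sum>w\<in>#zs. ln (max (exp (8*R)) (cmod w))) / 4
        + (\<Sum>w\<in>#zs. ln (max (exp (-8*R)) (cmod w))) / 4"
      by (induction zs) (simp_all add: B_def field_simps)
    then show ?thesis unfolding N_def by (simp add: field_simps)
  qed
  have jensen: "N (exp s) + cmod (\<Sum>w\<in>#zs. refl_pos (exp s) w ^ m) / (2 * m) \<le> \<beta> + k * s"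
    if s: "-\<eta>/2 \<le> s" "s < \<eta>/2" for s :: real
  proof -
    have "N (exp s) + cmod (\<Sum>w\<in>#zs. refl_pos (exp s) w ^ m) / real (2 * m) \<le> (\<lambda>r. \<beta> + k * ln r) (exp s)"
      unfolding N_def
    proof (rule jensen_mode[where \<delta> = "exp (\<eta>/2) - exp s"])
      fix z assume z: "exp s \<le> cmod z" "cmod z < exp s + (exp (\<eta>/2) - exp s)" "z \<notin># zs"
      have "exp (-\<eta>/2) \<le> exp s" using s by simp
      then have "exp (-\<eta>/2) \<le> cmod z" using z(1) by (rule order.trans)
      with z show "A + (\<Sum>w\<in>#zs. ln (cmod (z - w))) \<le> \<beta> + real k * ln (cmod z)"
        by (intro upper_ln) auto
    next
      show "((\<lambda>r. \<beta> + k * ln r) \<longlongrightarrow> \<beta> + k * ln (exp s)) (at_right (exp s))"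
        by (intro tendsto_intros) auto
    qed (use m s in auto)
    then show ?thesis by simp
  qed
  have jensen_N: "N (exp s) \<le> \<beta> + k * s" if "-\<eta>/2 \<le> s" "s < \<eta>/2" for s :: real
  proof -
    have "0 \<le> cmod (\<Sum>w\<in>#zs. refl_pos (exp s) w ^ m) / (2 * m)" by simp
    then show ?thesis using jensen[OF that] by linarith
  qed
  \<comment> \<open>The symmetric choice of the two auxiliary radii makes the terms linear in k
    cancel, so a lower bound for N 1 alone is left, and the Jensen inequality at s = 0 can be
    applied to it.\<close>
  have "N (exp (8*R)) \<le> \<beta> + k * (8 * R)" "N (exp (-8*R)) \<le> \<beta> + k * (-8 * R)"
    using \<eta> by (intro jensen_N; simp add: R_def)+
  then have "N 1 \<ge> \<beta> - 2 * E" using mean unfolding AB by simp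
  moreover have "N 1 + cmod (\<Sum>w\<in>#zs. refl_pos 1 w ^ m) / (2 * m) \<le> \<beta>"
    using jensen[of 0] \<eta> by simp
  ultimately have "cmod (\<Sum>w\<in>#zs. refl_pos 1 w ^ m) / (2 * m) \<le> 2 * E" by linarith
  then show ?thesis using m by (simp add: E_def \<beta>_def field_simps)
qed

section \<open>The Newton polygon\<close>

lemma poly_eq_prod_proots:
  "poly p z = lead_coeff p * (\<Prod>w\<in>#proots p. z - w)" for p :: "complex poly"
proof -
  have lin: "poly [:- w, 1:] z = z - w" for w :: complex
    by simp
  have "poly p z = poly (smult (lead_coeff p) (\<Prod>w\<in>#proots p. [:-w, 1:])) z"
    by (simp only: complex_poly_decompose_multiset)
  also have "\<dots> = lead_coeff p * (\<Prod>w\<in>#proots p. z - w)"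
    by (simp only: poly_smult poly_prod_mset lin)
  finally show ?thesis .
qed

lemma ln_cmod_poly:
  fixes p :: "complex poly"
  assumes "p \<noteq> 0" "z \<notin># proots p"
  shows "ln (cmod (poly p z)) = ln (cmod (lead_coeff p)) + (\<Sum>w\<in>#proots p. ln (cmod (z - w)))"
proof -
  have "cmod (\<Prod>w\<in>#M. z - w) > 0 \<and> ln (cmod (\<Prod>w\<in>#M. z - w)) = (\<Sum>w\<in>#M. ln (cmod (z - w)))"
    if "z \<notin># M" for M
    using that by (induction M) (auto simp: norm_mult ln_mult)
  note P = this[OF assms(2)]
  have "ln (cmod (poly p z)) = ln (cmod (lead_coeff p) * cmod (\<Prod>w\<in>#proots p. z - w))"
    by (subst poly_eq_prod_proots) (simp only: norm_mult)
  also have "\<dots> = ln (cmod (lead_coeff p)) + ln (cmod (\<Prod>w\<in>#proots p. z - w))"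
    using P assms(1) by (intro ln_mult_pos) (simp_all del: zero_less_norm_iff, simp)
  finally show ?thesis using P by simp
qed

lemma prod_mset_max_pos:
  assumes "(r :: real) > 0"
  shows "(\<Prod>w\<in>#M. max r (f w)) > 0"
proof (induction M)
  case (add w M)
  moreover have "max r (f w) > 0" using less_le_trans[OF assms max.cobounded1] .
  ultimately show ?case by (simp only: image_mset_add_mset prod_mset.add_mset mult_pos_pos)
qed simp

text \<open>Up to sign the coefficient is a sum of binomially many products of k-independent shape,
  each of which, times r ^ k, is at most the product of all max r |w|: the Mahler measure of the
  monic polynomial on the circle of radius r. The induction step is Pascal's rule.\<close>

lemma coeff_prod_linear_bound:
  fixes M :: "complex multiset"
  assumes "r > 0"
  shows "cmod (coeff (\<Prod>w\<in>#M. [:-w, 1:]) k) * r ^ k \<le> real (size M choose k) * (\<Prod>w\<in>#M. max r (cmod w))"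
proof (induction M arbitrary: k)
  case empty
  then show ?case by (cases k) (auto simp: coeff_1)
next
  case (add w M)
  define P where "P = (\<Prod>w\<in>#M. [:-w, 1:])"
  define Q where "Q = (\<Prod>w\<in>#M. max r (cmod w))"
  have IH: "cmod (coeff P k) * r ^ k \<le> real (size M choose k) * Q" for k
    unfolding P_def Q_def by (rule add.IH)
  have Q: "Q \<ge> 0" unfolding Q_def using prod_mset_max_pos[OF assms] by (rule less_imp_le)
  have P: "(\<Prod>w\<in>#add_mset w M. [:-w, 1:]) = [:-w, 1:] * P"
      "(\<Prod>w\<in>#add_mset w M. max r (cmod w)) = max r (cmod w) * Q"
    by (simp_all only: P_def Q_def image_mset_add_mset prod_mset.add_mset)
  have m: "0 \<le> max r (cmod w)" "cmod w \<le> max r (cmod w)" "r \<le> max r (cmod w)" using assms by auto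
  have 1: "cmod (w * coeff P k) * r ^ k \<le> real (size M choose k) * (max r (cmod w) * Q)" for k
  proof -
    have "cmod w * (cmod (coeff P k) * r ^ k) \<le> max r (cmod w) * (real (size M choose k) * Q)"
      by (rule mult_mono[OF m(2) IH]) (use m assms in \<open>auto\<close>)
    then show ?thesis by (simp add: norm_mult mult_ac)
  qed
  show ?case
  proof (cases k)
    case 0
    moreover have "coeff ([:-w, 1:] * P) 0 = - (w * coeff P 0)" by simp
    ultimately show ?thesis using 1[of 0] unfolding P by (simp only: norm_minus_cancel binomial_n_0)
  next
    case (Suc l)
    have 2: "cmod (coeff P l) * r ^ k \<le> real (size M choose l) * (max r (cmod w) * Q)"
    proof -
      have "r * (cmod (coeff P l) * r ^ l) \<le> max r (cmod w) * (real (size M choose l) * Q)"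
        by (rule mult_mono[OF m(3) IH]) (use m assms in \<open>auto\<close>)
      then show ?thesis by (simp add: Suc mult_ac)
    qed
    have "coeff (\<Prod>w\<in>#add_mset w M. [:-w, 1:]) k = coeff P l - w * coeff P k"
      unfolding P by (simp add: Suc)
    then have "cmod (coeff (\<Prod>w\<in>#add_mset w M. [:-w, 1:]) k) * r ^ k \<le>
        (cmod (coeff P l) + cmod (w * coeff P k)) * r ^ k"
      using assms norm_triangle_ineq4[of "coeff P l" "w * coeff P k"] by (intro mult_right_mono) auto
    also have "\<dots> \<le> real (size M choose l) * (max r (cmod w) * Q) + real (size M choose k) * (max r (cmod w) * Q)"
      using 1[of k] 2 by (simp add: distrib_right)
    also have "\<dots> = real (size (add_mset w M) choose k) * (max r (cmod w) * Q)"
      by (simp add: Suc distrib_right)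
    finally show ?thesis unfolding P .
  qed
qed

text \<open>The values of \<open>s = ln \<bar>z\<bar>\<close> for which the \<open>k\<close>-th term is the largest; a nondegenerate interval exactly when
  \<open>k\<close> is a vertex of the Newton polygon of \<open>p\<close>.\<close>
definition dom_set :: "complex poly \<Rightarrow> nat \<Rightarrow> real set" where
  "dom_set p k = {s. \<forall>j. cmod (coeff p j) * exp (real j * s) \<le> cmod (coeff p k) * exp (real k * s)}"

lemma dom_set_iff:
  "s \<in> dom_set p k \<longleftrightarrow> (\<forall>j. cmod (coeff p j) \<le> cmod (coeff p k) * exp ((real k - real j) * s))"
proof -
  have "cmod (coeff p j) * exp (real j * s) \<le> cmod (coeff p k) * exp (real k * s) \<longleftrightarrow>
     cmod (coeff p j) \<le> cmod (coeff p k) * exp ((real k - real j) * s)" for j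
  proof -
    have "exp (real k * s) = exp ((real k - real j) * s) * exp (real j * s)"
      by (simp add: left_diff_distrib flip: exp_add)
    then show ?thesis by (simp only: mult.assoc[symmetric] mult_le_cancel_right_pos exp_gt_zero)
  qed
  then show ?thesis by (simp add: dom_set_def)
qed

lemma dom_set_nonzero:
  assumes "p \<noteq> 0" "s \<in> dom_set p k"
  shows "coeff p k \<noteq> 0" "k \<le> degree p"
proof -
  show "coeff p k \<noteq> 0"
  proof
    assume "coeff p k = 0"
    then have "cmod (lead_coeff p) \<le> 0" using assms(2) by (simp add: dom_set_iff del: norm_le_zero_iff)
    then show False using assms(1) by simp
  qed
  then show "k \<le> degree p" by (rule le_degree)
qed

lemma dom_set_exists:
  obtains k where "k \<le> degree p" "s \<in> dom_set p k"
proof -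
  define f where "f j = cmod (coeff p j) * exp (real j * s)" for j
  have "Max (f ` {..degree p}) \<in> f ` {..degree p}" by (intro Max_in) auto
  then obtain k where "k \<in> {..degree p}" and Max: "Max (f ` {..degree p}) = f k" by (rule imageE)
  then have k: "k \<le> degree p" by simp
  have "f j \<le> f k" for j
  proof (cases "j \<le> degree p")
    case True
    then show ?thesis unfolding Max[symmetric] by (intro Max_ge) auto
  next
    case False
    then show ?thesis by (simp add: f_def coeff_eq_0)
  qed
  then show ?thesis using that[of k] k by (auto simp: dom_set_def f_def)
qed

text \<open>Each comparison restricts s from one side only: terms below k are compared at s1, terms
  above k at s2. Hence the set is an interval.\<close>

lemma dom_set_between:
  assumes "s1 \<in> dom_set p k" "s2 \<in> dom_set p k" "s1 \<le> s" "s \<le> s2"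
  shows "s \<in> dom_set p k"
  unfolding dom_set_iff
proof
  fix j
  show "cmod (coeff p j) \<le> cmod (coeff p k) * exp ((real k - real j) * s)"
  proof (cases "j \<le> k")
    case True
    have "cmod (coeff p j) \<le> cmod (coeff p k) * exp ((real k - real j) * s1)"
      using assms(1) by (simp add: dom_set_iff)
    also have "\<dots> \<le> cmod (coeff p k) * exp ((real k - real j) * s)"
      using True assms(3) by (intro mult_left_mono) (auto intro!: mult_left_mono)
    finally show ?thesis .
  next
    case False
    have "cmod (coeff p j) \<le> cmod (coeff p k) * exp ((real k - real j) * s2)"
      using assms(2) by (simp add: dom_set_iff)
    also have "\<dots> \<le> cmod (coeff p k) * exp ((real k - real j) * s)"
      using False assms(4) by (intro mult_left_mono) (auto intro!: mult_left_mono_neg)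
    finally show ?thesis .
  qed
qed

lemma closed_dom_set: "closed (dom_set p k)"
  unfolding dom_set_def by (intro closed_Collect_all closed_Collect_le continuous_intros)

text \<open>Room \<delta> on both sides of s becomes geometric decay at rate \<delta> away from k:
  terms up to k are compared at s - \<delta>, later ones at s + \<delta>.\<close>

lemma dom_set_margin:
  assumes "s - \<delta> \<in> dom_set p k" "s + \<delta> \<in> dom_set p k"
  shows "cmod (coeff p j) * exp (real j * s) \<le>
    cmod (coeff p k) * exp (real k * s) * exp (- \<delta> * \<bar>real j - real k\<bar>)"
proof -
  define t where "t = (if j \<le> k then s - \<delta> else s + \<delta>)"
  have t: "t \<in> dom_set p k" using assms by (simp add: t_def)
  then have "cmod (coeff p j) * exp (real j * s) \<le>
     cmod (coeff p k) * exp ((real k - real j) * t) * exp (real j * s)"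
    by (intro mult_right_mono) (auto simp: dom_set_iff)
  also have "(real k - real j) * t = real k * s - real j * s + (- \<delta> * \<bar>real j - real k\<bar>)"
    by (simp add: t_def algebra_simps abs_if)
  also have "cmod (coeff p k) * exp \<dots> * exp (real j * s) =
     cmod (coeff p k) * exp (real k * s) * exp (- \<delta> * \<bar>real j - real k\<bar>)"
    by (simp only: mult.assoc exp_add[symmetric]) (simp add: algebra_simps)
  finally show ?thesis .
qed

section \<open>Modes as functions of the logarithmic radius\<close>

definition mode_sum :: "complex poly \<Rightarrow> nat \<Rightarrow> real \<Rightarrow> complex" where
  "mode_sum p m s = (\<Sum>z\<in>#proots p. refl_pos (exp s) z ^ m)"

lemma norm_sum_mset_le: "norm (\<Sum>z\<in>#M. f z :: complex) \<le> (\<Sum>z\<in>#M. norm (f z))"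
  by (induction M) (auto intro: norm_triangle_le)

text \<open>In the logarithmic radius a zero acts through a two-sided exponential kernel centred at
  ln |z|. The origin causes no exception, because sgn 0 = 0 makes both sides vanish.\<close>

lemma refl_pos_exp:
  "refl_pos (exp s) z = of_real (exp (- \<bar>s - ln (cmod z)\<bar>)) * sgn z"
proof (cases "z = 0")
  case False
  have "exp s / (max (exp s) (cmod z))\<^sup>2 * cmod z = exp (- \<bar>s - ln (cmod z)\<bar>)"
  proof -
    define t where "t = ln (cmod z)"
    have z: "cmod z = exp t" using False by (simp add: t_def)
    have "max (exp s) (cmod z) = exp (max s t)" by (simp add: z max_def)
    then have "exp s / (max (exp s) (cmod z))\<^sup>2 * cmod z = exp (s + t - 2 * max s t)"
      by (simp add: z exp_add exp_diff exp_double)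
    also have "s + t - 2 * max s t = - \<bar>s - t\<bar>" by (simp add: max_def)
    finally show ?thesis by (simp add: t_def)
  qed
  then have "complex_of_real (exp s / (max (exp s) (cmod z))\<^sup>2 * cmod z) = of_real (exp (- \<bar>s - ln (cmod z)\<bar>))"
    by simp
  moreover have "z = of_real (cmod z) * sgn z" using False by (simp add: sgn_eq)
  ultimately show ?thesis unfolding refl_pos_def by (metis mult.assoc of_real_mult)
qed (simp add: refl_pos_def)

lemma norm_refl_pos_power:
  "cmod (refl_pos (exp s) z ^ m) \<le> exp (- real m * \<bar>s - ln (cmod z)\<bar>)"
proof -
  have "cmod (refl_pos (exp s) z) \<le> exp (- \<bar>s - ln (cmod z)\<bar>)"
    by (simp add: refl_pos_exp norm_mult norm_sgn)
  then have "cmod (refl_pos (exp s) z) ^ m \<le> exp (- \<bar>s - ln (cmod z)\<bar>) ^ m"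
    by (intro power_mono) auto
  then show ?thesis by (simp add: norm_power exp_of_nat_mult[symmetric])
qed

lemma mode_sum_le_degree: "cmod (mode_sum p m s) \<le> real (degree p)"
proof -
  have "cmod (mode_sum p m s) \<le> (\<Sum>z\<in>#proots p. cmod (refl_pos (exp s) z ^ m))"
    unfolding mode_sum_def by (rule norm_sum_mset_le)
  also have "\<dots> \<le> (\<Sum>z\<in>#proots p. 1)"
  proof (rule sum_mset_mono)
    fix z
    show "cmod (refl_pos (exp s) z ^ m) \<le> 1"
      by (rule order.trans[OF norm_refl_pos_power]) simp
  qed
  also have "\<dots> = real (degree p)" by (simp add: size_proots_complex)
  finally show ?thesis .
qed

text \<open>Rescaling by exp s and dividing by the k-th term moves the circle to the unit circle
  with k-th coefficient 1; \<open>refl_pos\<close> is invariant under the rescaling.\<close>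

lemma mode_sum_le_inner:
  assumes p: "p \<noteq> 0" and dom: "s - \<eta> \<in> dom_set p k" "s + \<eta> \<in> dom_set p k"
    and \<eta>: "0 < \<eta>" "\<eta> \<le> 1" and m: "m > 0"
  shows "cmod (mode_sum p m s) \<le> 4 * real m * (ln (6/\<eta>) * exp (256 * pi / \<eta>))"
proof -
  define E where "E = complex_of_real (exp s)"
  define C where "C = coeff p k * E ^ k"
  have E: "E \<noteq> 0" "cmod E = exp s" by (auto simp: E_def)
  have k: "coeff p k \<noteq> 0" "k \<le> degree p" using dom_set_nonzero[OF p dom(1)] by auto
  have C: "C \<noteq> 0" using k E by (simp add: C_def)
  have "cmod (\<Sum>w\<in>#image_mset (\<lambda>z. z / E) (proots p). refl_pos 1 w ^ m) \<le> 4 * real m * (ln (6/\<eta>) * exp (256 * pi / \<eta>))"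
  proof (rule dominated_annulus_mode_bound[where n = "degree p" and k = k
        and b = "\<lambda>j. coeff p j * E ^ j / C" and L = "lead_coeff p * E ^ size (proots p) / C"])
    fix z
    have "(\<Sum>j\<le>degree p. coeff p j * E ^ j / C * z ^ j) = poly p (E * z) / C"
      by (simp add: poly_altdef sum_divide_distrib power_mult_distrib mult_ac)
    also have "\<dots> = lead_coeff p * (\<Prod>w\<in>#proots p. E * z - w) / C"
      by (simp only: poly_eq_prod_proots)
    also have "(\<Prod>w\<in>#M. E * z - w) = E ^ size M * (\<Prod>w\<in>#image_mset (\<lambda>z. z / E) M. z - w)" for M
      using E by (induction M) (simp_all add: field_simps)
    finally show "(\<Sum>j\<le>degree p. coeff p j * E ^ j / C * z ^ j) =
        lead_coeff p * E ^ size (proots p) / C * (\<Prod>w\<in>#image_mset (\<lambda>z. z / E) (proots p). z - w)"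
      by simp
  next
    show "lead_coeff p * E ^ size (proots p) / C \<noteq> 0" using p E C by simp
    show "coeff p k * E ^ k / C = 1" using C by (simp add: C_def)
    fix j
    have Ej: "cmod (E ^ j) = exp (real j * s)" for j
      by (simp add: norm_power E exp_of_nat_mult[symmetric])
    show "cmod (coeff p j * E ^ j / C) \<le> exp (- \<eta> * \<bar>real j - real k\<bar>)"
      using dom_set_margin[OF dom, of j] k
      by (simp add: norm_divide norm_mult C_def Ej divide_le_eq mult_ac)
  qed (use k \<eta> m in auto)
  moreover have "refl_pos 1 (z / E) = refl_pos (exp s) z" for z
  proof -
    have "max 1 (cmod (z / E)) = max (exp s) (cmod z) / exp s"
      by (simp add: norm_divide E max_def field_simps)
    then show ?thesis
      by (simp add: refl_pos_def E_def power_divide power2_eq_square)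
  qed
  ultimately show ?thesis by (simp add: mode_sum_def multiset.map_comp comp_def)
qed

text \<open>On the circle, ln |p| exceeds the logarithm of the k-th term by at most ln (degree + 1),
  and its mean falls short of it by at most the logarithm of the binomial coefficient. No margin
  around s is required, in contrast to the Harnack bound.\<close>

lemma mode_sum_le_binomial:
  assumes p: "p \<noteq> 0" and dom: "s \<in> dom_set p k" and m: "m > 0"
  shows "cmod (mode_sum p m s) \<le> 2 * m * (ln (real (degree p) + 1) + ln (real (degree p choose k)))"
proof -
  define \<beta> where "\<beta> r = ln (\<Sum>j\<le>degree p. cmod (coeff p j) * r ^ j)" for r
  define r where "r = exp s"
  define A where "A = ln (cmod (lead_coeff p))"
  have r: "r > 0" "\<And>j. r ^ j = exp (real j * s)" by (auto simp: r_def exp_of_nat_mult)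
  have k: "coeff p k \<noteq> 0" "k \<le> degree p" using dom_set_nonzero[OF p dom] by auto
  have sum_pos: "(\<Sum>j\<le>degree p. cmod (coeff p j) * x ^ j) > 0" if "x > 0" for x
  proof (rule sum_pos2[of _ k])
    show "0 < cmod (coeff p k) * x ^ k" using k that by simp
  qed (use k that in auto)
  have "A + (\<Sum>z\<in>#proots p. ln (max r (cmod z))) + cmod (\<Sum>z\<in>#proots p. refl_pos r z ^ m) / real (2 * m) \<le> \<beta> r"
  proof (rule jensen_mode[where \<delta> = 1])
    fix z assume z: "r \<le> cmod z" "cmod z < r + 1" "z \<notin># proots p"
    have "cmod (poly p z) \<le> (\<Sum>j\<le>degree p. cmod (coeff p j) * cmod z ^ j)"
      unfolding poly_altdef by (intro sum_norm_le) (simp add: norm_mult norm_power)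
    moreover have "cmod (poly p z) > 0" using z(3) p by simp
    ultimately have "ln (cmod (poly p z)) \<le> \<beta> (cmod z)"
      unfolding \<beta>_def by (intro ln_le_cancel_iff[THEN iffD2] sum_pos) (use z r in auto)
    then show "A + (\<Sum>w\<in>#proots p. ln (cmod (z - w))) \<le> \<beta> (cmod z)"
      using ln_cmod_poly[OF p z(3)] by (simp add: A_def)
  next
    show "(\<beta> \<longlongrightarrow> \<beta> r) (at_right r)"
      unfolding \<beta>_def using sum_pos[OF r(1)] by (intro tendsto_intros) auto
  qed (use r m in auto)
  moreover have "\<beta> r \<le> ln (real (degree p) + 1) + ln (cmod (coeff p k) * r ^ k)"
  proof -
    have "(\<Sum>j\<le>degree p. cmod (coeff p j) * r ^ j) \<le> (\<Sum>j\<le>degree p. cmod (coeff p k) * r ^ k)"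
      using dom by (intro sum_mono) (auto simp: dom_set_def r(2))
    also have "\<dots> = (real (degree p) + 1) * (cmod (coeff p k) * r ^ k)" by simp
    finally have "\<beta> r \<le> ln ((real (degree p) + 1) * (cmod (coeff p k) * r ^ k))"
      unfolding \<beta>_def using sum_pos[OF r(1)] k r(1) by (intro ln_le_cancel_iff[THEN iffD2]) auto
    also have "\<dots> = ln (real (degree p) + 1) + ln (cmod (coeff p k) * r ^ k)"
      using k r(1) by (subst ln_mult) auto
    finally show ?thesis .
  qed
  moreover have "ln (cmod (coeff p k) * r ^ k) \<le> ln (real (degree p choose k)) + (A + (\<Sum>z\<in>#proots p. ln (max r (cmod z))))"
  proof -
    define Q where "Q M = (\<Prod>w\<in>#M. max r (cmod w))" for M
    have Q: "Q M > 0 \<and> ln (Q M) = (\<Sum>z\<in>#M. ln (max r (cmod z)))" for M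
    proof (induction M)
      case (add w M)
      have "max r (cmod w) > 0" using r(1) by (auto simp: less_max_iff_disj)
      moreover have "Q (add_mset w M) = max r (cmod w) * Q M" by (simp add: Q_def)
      ultimately show ?case using add by (simp add: ln_mult_pos del: less_max_iff_disj)
    qed (simp add: Q_def)
    have "coeff p k = lead_coeff p * coeff (\<Prod>w\<in>#proots p. [:-w, 1:]) k"
      by (metis coeff_smult complex_poly_decompose_multiset)
    then have "cmod (coeff p k) * r ^ k = cmod (lead_coeff p) * (cmod (coeff (\<Prod>w\<in>#proots p. [:-w, 1:]) k) * r ^ k)"
      by (simp add: norm_mult)
    also have "\<dots> \<le> cmod (lead_coeff p) * (real (degree p choose k) * Q (proots p))"
      using coeff_prod_linear_bound[OF r(1), of "proots p" k]
      by (intro mult_left_mono) (auto simp: size_proots_complex Q_def)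
    finally have "ln (cmod (coeff p k) * r ^ k) \<le> ln (cmod (lead_coeff p) * (real (degree p choose k) * Q (proots p)))"
      using k r(1) p Q[of "proots p"] by (intro ln_le_cancel_iff[THEN iffD2]) auto
    also have "\<dots> = A + (ln (real (degree p choose k)) + ln (Q (proots p)))"
      using k p Q[of "proots p"] unfolding A_def by (subst ln_mult, simp, subst ln_mult) auto
    finally show ?thesis using Q[of "proots p"] by simp
  qed
  ultimately have "cmod (\<Sum>z\<in>#proots p. refl_pos r z ^ m) / real (2 * m) \<le>
      ln (real (degree p) + 1) + ln (real (degree p choose k))" by linarith
  then show ?thesis using m by (simp add: mode_sum_def r_def field_simps)
qed

text \<open>A closer zero would have a logarithmic modulus with room 4 on both sides inside the
  segment. There the k-th term exceeds the sum of all others, so the polynomial cannot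
  vanish.\<close>

lemma dom_set_zero_free:
  assumes p: "p \<noteq> 0" and dom: "s - D \<in> dom_set p k" "s + D \<in> dom_set p k"
    and z: "z \<in># proots p" "z \<noteq> 0"
  shows "D - 4 \<le> \<bar>s - ln (cmod z)\<bar>"
proof (rule ccontr)
  assume *: "\<not> D - 4 \<le> \<bar>s - ln (cmod z)\<bar>"
  define t where "t = ln (cmod z)"
  have t: "t - 4 \<in> dom_set p k" "t + 4 \<in> dom_set p k"
    using * unfolding t_def[symmetric] by (intro dom_set_between[OF dom]; linarith)+
  have k: "coeff p k \<noteq> 0" "k \<le> degree p" using dom_set_nonzero[OF p dom(1)] by auto
  have zj: "cmod z ^ j = exp (real j * t)" for j
    using z by (simp add: t_def exp_of_nat_mult)
  define C where "C = cmod (coeff p k) * exp (real k * t)"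
  have C: "C > 0" using k by (simp add: C_def)
  \<comment> \<open>The ratio 1/16 leaves a factor 1/4 to spare after a geometric series of ratio
    1/4; the other terms then add up to at most 2/3 of the k-th one.\<close>
  have e4: "exp (- 4) \<le> (1/16 :: real)"
  proof -
    have "1 + 2 + 2\<^sup>2 / 2 \<le> exp (2::real)" by (rule exp_lower_Taylor_quadratic) simp
    then have e2: "5 \<le> exp (2::real)" by (simp add: power2_eq_square)
    have "5 * 5 \<le> exp (2::real) * exp 2" by (rule mult_mono[OF e2 e2]) auto
    then have "16 \<le> exp (2::real) * exp 2" by simp
    also have "\<dots> = exp 4" by (simp flip: exp_add)
    finally have "inverse (exp 4) \<le> inverse (16 :: real)" by (intro le_imp_inverse_le) auto
    then show ?thesis by (simp add: exp_minus)
  qed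
  have tm: "cmod (coeff p j * z ^ j) \<le> C * (1/4 * (1/4) ^ nat \<bar>int j - int k\<bar>)" if "j \<noteq> k" for j
  proof -
    define d where "d = nat \<bar>int j - int k\<bar>"
    have d: "\<bar>real j - real k\<bar> = real d" "d \<ge> 1" using that by (auto simp: d_def)
    have "exp (- 4 * real d) = exp (-4) ^ d" by (simp add: exp_of_nat_mult[symmetric] mult.commute)
    also have "\<dots> \<le> (1/16) ^ d" using e4 by (intro power_mono) auto
    also have "\<dots> = (1/4) ^ d * (1/4) ^ d" by (simp add: power_mult_distrib[symmetric])
    also have "\<dots> \<le> (1/4) ^ 1 * (1/4) ^ d"
      using d by (intro mult_right_mono power_decreasing) auto
    finally have "exp (- 4 * real d) \<le> 1/4 * (1/4) ^ d" by simp
    then have "C * exp (- 4 * \<bar>real j - real k\<bar>) \<le> C * (1/4 * (1/4) ^ d)"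
      using C d by (intro mult_left_mono) auto
    then show ?thesis
      using dom_set_margin[OF t, of j] by (simp add: norm_mult norm_power zj C_def d_def)
  qed
  have "coeff p k * z ^ k = - (\<Sum>j\<in>{..degree p} - {k}. coeff p j * z ^ j)"
  proof -
    have "0 = (\<Sum>j\<le>degree p. coeff p j * z ^ j)" using z p by (simp flip: poly_altdef)
    also have "\<dots> = coeff p k * z ^ k + (\<Sum>j\<in>{..degree p} - {k}. coeff p j * z ^ j)"
      using k by (intro sum.remove) auto
    finally show ?thesis by (simp add: eq_neg_iff_add_eq_0)
  qed
  then have "C = cmod (\<Sum>j\<in>{..degree p} - {k}. coeff p j * z ^ j)"
  proof -
    have "C = cmod (coeff p k * z ^ k)" by (simp only: C_def norm_mult norm_power zj)
    then show ?thesis using \<open>coeff p k * z ^ k = _\<close> by (simp only: norm_minus_cancel)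
  qed
  also have "\<dots> \<le> (\<Sum>j\<in>{..degree p} - {k}. C * (1/4 * (1/4) ^ nat \<bar>int j - int k\<bar>))"
    by (intro sum_norm_le tm) auto
  also have "\<dots> \<le> (\<Sum>j\<le>degree p. C * (1/4 * (1/4) ^ nat \<bar>int j - int k\<bar>))"
    using C by (intro sum_mono2) auto
  also have "\<dots> = C * (1/4 * (\<Sum>j\<le>degree p. (1/4) ^ nat \<bar>int j - int k\<bar>))"
    by (simp add: sum_distrib_left)
  also have "\<dots> \<le> C * (1/4 * (2 / (1 - 1/4)))"
    using C k by (intro mult_left_mono sum_geometric_dist) auto
  finally show False using C by simp
qed

section \<open>Integration over all radii\<close>

lemma has_bochner_integral_exp_abs:
  fixes a c :: real
  assumes "c > 0"
  shows "has_bochner_integral lborel (\<lambda>s. exp (- c * \<bar>s - a\<bar>)) (2 / c)"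
proof -
  have "has_bochner_integral lborel (\<lambda>x::real. indicator {0..} x *\<^sub>R exp (- \<bar>x\<bar>)) 1"
    using has_bochner_integral_I0i_power_exp_m'[of 0]
    by (rule has_bochner_integral_cong[THEN iffD1, rotated 3]) (auto split: split_indicator)
  then have "has_bochner_integral lborel (\<lambda>x::real. exp (- \<bar>x\<bar>)) (2 *\<^sub>R 1)"
    by (rule has_bochner_integral_even_function) simp
  then have "has_bochner_integral lborel (\<lambda>x. exp (- \<bar>- (c * a) + c * x\<bar>)) ((2 *\<^sub>R 1) /\<^sub>R \<bar>c\<bar>)"
    using assms by (subst (asm) lborel_has_bochner_integral_real_affine_iff[of c _ _ "- (c * a)"]) auto
  moreover have "- \<bar>- (c * a) + c * x\<bar> = - c * \<bar>x - a\<bar>" for x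
  proof -
    have "- (c * a) + c * x = c * (x - a)" by (simp add: right_diff_distrib)
    then show ?thesis using assms by (simp add: abs_mult)
  qed
  ultimately show ?thesis using assms by (simp add: divide_inverse mult.commute)
qed

lemma has_bochner_integral_sum_mset:
  fixes f :: "'b \<Rightarrow> 'c \<Rightarrow> 'd :: {banach, second_countable_topology}"
  assumes "\<And>z. z \<in># zs \<Longrightarrow> has_bochner_integral M (f z) (I z)"
  shows "has_bochner_integral M (\<lambda>t. \<Sum>z\<in>#zs. f z t) (\<Sum>z\<in>#zs. I z)"
  using assms by (induction zs) (auto intro!: has_bochner_integral_add)

text \<open>The kernel of each zero integrates to 2 / m wherever it is centred, so integration over
  s forgets the moduli and keeps only the directions.\<close>

lemma has_bochner_integral_mode_sum:
  assumes m: "m > 0"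
  shows "has_bochner_integral lborel (mode_sum p m) (2 / m * (\<Sum>z\<in>#proots p. sgn z ^ m))"
proof -
  have "has_bochner_integral lborel (\<lambda>s. refl_pos (exp s) z ^ m) (of_real (2 / m) * sgn z ^ m)" for z
  proof -
    have "refl_pos (exp s) z ^ m = of_real (exp (- real m * \<bar>s - ln (cmod z)\<bar>)) * sgn z ^ m" for s
    proof -
      have "exp (- \<bar>s - ln (cmod z)\<bar>) ^ m = exp (- real m * \<bar>s - ln (cmod z)\<bar>)"
        by (simp add: exp_of_nat_mult[symmetric])
      then show ?thesis by (simp only: refl_pos_exp power_mult_distrib of_real_power[symmetric])
    qed
    moreover have "has_bochner_integral lborel (\<lambda>s. of_real (exp (- real m * \<bar>s - ln (cmod z)\<bar>)) * sgn z ^ m)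
        (complex_of_real (2 / m) * sgn z ^ m)"
      using m by (intro has_bochner_integral_mult_left has_bochner_integral_of_real has_bochner_integral_exp_abs) simp
    ultimately show ?thesis by (simp only:)
  qed
  then have "has_bochner_integral lborel (mode_sum p m) (\<Sum>z\<in>#proots p. of_real (2 / m) * sgn z ^ m)"
    unfolding mode_sum_def[abs_def] by (rule has_bochner_integral_sum_mset)
  also have "(\<Sum>z\<in>#proots p. of_real (2 / m) * sgn z ^ m) = 2 / m * (\<Sum>z\<in>#proots p. sgn z ^ m)"
    by (simp add: sum_mset_distrib_left)
  finally show ?thesis by simp
qed

lemma sum_mset_nonneg_real:
  fixes f :: "'b \<Rightarrow> real"
  assumes "\<And>z. f z \<ge> 0"
  shows "(\<Sum>z\<in>#M. f z) \<ge> 0"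
  by (induction M) (use assms in auto)

lemma emeasure_lborel_diameter:
  fixes X :: "real set"
  assumes "\<And>x y. x \<in> X \<Longrightarrow> y \<in> X \<Longrightarrow> y - x \<le> \<delta>" "\<delta> \<ge> 0"
  shows "emeasure lborel X \<le> ennreal \<delta>"
proof (cases "X = {}")
  case False
  then obtain x0 where x0: "x0 \<in> X" by auto
  have bdd: "bdd_below X"
    using assms(1)[OF _ x0] by (intro bdd_belowI[of _ "x0 - \<delta>"]) (simp add: algebra_simps)
  have "X \<subseteq> {Inf X..Inf X + \<delta>}"
  proof
    fix y assume y: "y \<in> X"
    have "y - \<delta> \<le> Inf X" using assms(1)[OF _ y] False by (intro cInf_greatest) (auto simp: algebra_simps)
    then show "y \<in> {Inf X..Inf X + \<delta>}" using cInf_lower[OF y bdd] by auto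
  qed
  then have "emeasure lborel X \<le> emeasure lborel {Inf X..Inf X + \<delta>}" by (intro emeasure_mono) auto
  also have "\<dots> = ennreal \<delta>" using assms(2) by simp
  finally show ?thesis .
qed simp

text \<open>Expressed by membership instead of endpoints, so that bounded, unbounded and empty
  intervals need no separate treatment.\<close>

definition edge :: "real \<Rightarrow> real set \<Rightarrow> real set" where
  "edge \<delta> I = {s \<in> I. s - \<delta> \<notin> I \<or> s + \<delta> \<notin> I}"

text \<open>Each of the two one-sided parts has diameter at most \<delta>: for points x < y of the
  left part further apart than \<delta>, the point y - \<delta> would lie in the interval I after
  all.\<close>

lemma edge_measure:
  assumes I: "closed I" "\<And>s1 s2 s. s1 \<in> I \<Longrightarrow> s2 \<in> I \<Longrightarrow> s1 \<le> s \<Longrightarrow> s \<le> s2 \<Longrightarrow> s \<in> I" and "\<delta> > 0"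
  shows "edge \<delta> I \<in> sets lborel" "emeasure lborel (edge \<delta> I) \<le> ennreal (2 * \<delta>)"
proof -
  define X where "X = {s \<in> I. s - \<delta> \<notin> I}"
  define Y where "Y = {s \<in> I. s + \<delta> \<notin> I}"
  have [measurable]: "I \<in> sets borel" using I(1) by simp
  have XY: "edge \<delta> I = X \<union> Y" by (auto simp: edge_def X_def Y_def)
  have mX: "X \<in> sets lborel" and mY: "Y \<in> sets lborel" unfolding X_def Y_def by measurable
  then show "edge \<delta> I \<in> sets lborel" unfolding XY by simp
  have "y - x \<le> \<delta>" if "x \<in> X" "y \<in> X" for x y
    using that I(2)[of x y "y - \<delta>"] \<open>\<delta> > 0\<close> by (force simp: X_def)
  then have 1: "emeasure lborel X \<le> ennreal \<delta>" using assms by (intro emeasure_lborel_diameter) auto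
  have "y - x \<le> \<delta>" if "x \<in> Y" "y \<in> Y" for x y
    using that I(2)[of x y "x + \<delta>"] \<open>\<delta> > 0\<close> by (force simp: Y_def)
  then have 2: "emeasure lborel Y \<le> ennreal \<delta>" using assms by (intro emeasure_lborel_diameter) auto
  have "emeasure lborel (edge \<delta> I) \<le> emeasure lborel X + emeasure lborel Y"
    unfolding XY using mX mY by (rule emeasure_subadditive)
  also have "\<dots> \<le> ennreal \<delta> + ennreal \<delta>" by (intro add_mono 1 2)
  also have "\<dots> = ennreal (2 * \<delta>)" using \<open>\<delta> > 0\<close> by (simp flip: ennreal_plus)
  finally show "emeasure lborel (edge \<delta> I) \<le> ennreal (2 * \<delta>)" .
qed

lemma edge_dom_set:
  assumes "\<delta> > 0"
  shows "integrable lborel (indicat_real (edge \<delta> (dom_set p k)))"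
    and "integral\<^sup>L lborel (indicat_real (edge \<delta> (dom_set p k))) \<le> 2 * \<delta>"
proof -
  have *: "edge \<delta> (dom_set p k) \<in> sets lborel" "emeasure lborel (edge \<delta> (dom_set p k)) \<le> ennreal (2 * \<delta>)"
    using edge_measure[of "dom_set p k" \<delta>] closed_dom_set[of p k] dom_set_between[of _ p k] assms by blast+
  have fin: "emeasure lborel (edge \<delta> (dom_set p k)) < \<infinity>"
    using *(2) by (metis ennreal_less_top infinity_ennreal_def order.strict_trans1)
  with * show "integrable lborel (indicat_real (edge \<delta> (dom_set p k)))"
    by (intro integrable_real_indicator) auto
  have "measure lborel (edge \<delta> (dom_set p k)) \<le> 2 * \<delta>"
    unfolding measure_def using *(2) assms by (intro enn2real_leI) auto
  then show "integral\<^sup>L lborel (indicat_real (edge \<delta> (dom_set p k))) \<le> 2 * \<delta>"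
    by simp
qed

text \<open>The vertices in W1 are handled by Harnack, those in W2 by the bound B. The mode is
  majorized by cases: deeper than D inside a segment zeros are far away and only a tail T remains;
  within D of an end the bound is E or B; within \<eta> of an end of a segment from W1 the trivial
  bound n is used.\<close>

theorem sgn_power_sum_bound:
  fixes p :: "complex poly" and \<eta> D B :: real
  assumes p: "p \<noteq> 0" "degree p \<le> n" and m: "m > 0" and \<eta>: "0 < \<eta>" "\<eta> \<le> 1" and D: "D > 0"
    and fin: "finite W1" "finite W2"
    and W: "\<And>k s1 s2. s1 \<in> dom_set p k \<Longrightarrow> s2 \<in> dom_set p k \<Longrightarrow> s1 < s2 \<Longrightarrow> k \<in> W1 \<union> W2"
    and B: "\<And>k s. k \<in> W2 \<Longrightarrow> s \<in> dom_set p k \<Longrightarrow> cmod (mode_sum p m s) \<le> B" "B \<ge> 0"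
  shows "2 / m * cmod (\<Sum>z\<in>#proots p. sgn z ^ m) \<le>
     card W1 * (2 * \<eta> * real n + 2 * D * (4 * real m * (ln (6/\<eta>) * exp (256 * pi / \<eta>))))
     + card W2 * (2 * D * B) + 4 * real n * exp (- (D - 4) / 2)"
proof -
  define E where "E = 4 * real m * (ln (6/\<eta>) * exp (256 * pi / \<eta>))"
  have E: "E \<ge> 0" using \<eta> by (simp add: E_def)
  \<comment> \<open>Half of the kernel's decay supplies the small factor, the other half keeps the
    tail integrable in s.\<close>
  define T where "T s = (\<Sum>z\<in>#proots p. exp (- (D - 4) / 2) * exp (- (1/2) * \<bar>s - ln (cmod z)\<bar>))" for s
  define F where "F s = (\<Sum>k\<in>W1. n * indicat_real (edge \<eta> (dom_set p k)) s + E * indicat_real (edge D (dom_set p k)) s)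
      + (\<Sum>k\<in>W2. B * indicat_real (edge D (dom_set p k)) s) + T s" for s
  have T: "has_bochner_integral lborel T (\<Sum>z\<in>#proots p. exp (- (D - 4) / 2) * (2 / (1/2)))"
    unfolding T_def[abs_def]
    by (intro has_bochner_integral_sum_mset has_bochner_integral_mult_right has_bochner_integral_exp_abs) simp
  have T0: "T s \<ge> 0" for s unfolding T_def by (rule sum_mset_nonneg_real) simp
  \<comment> \<open>Radii at which a term dominates only at a single point escape assumption W; they
    are finitely many, hence negligible.\<close>
  define N where "N = (\<Union>k\<in>{k. k \<le> degree p \<and> (\<forall>s1\<in>dom_set p k. \<forall>s2\<in>dom_set p k. s1 = s2)}. dom_set p k)"
  have "finite N"
    unfolding N_def
  proof (intro finite_UN_I)
    fix k assume "k \<in> {k. k \<le> degree p \<and> (\<forall>s1\<in>dom_set p k. \<forall>s2\<in>dom_set p k. s1 = s2)}"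
    then have "dom_set p k = {} \<or> (\<exists>s. dom_set p k = {s})" by blast
    then show "finite (dom_set p k)" by auto
  qed simp
  have le: "cmod (mode_sum p m s) \<le> F s" if s: "s \<notin> N" for s
  proof -
    obtain k where k: "k \<le> degree p" "s \<in> dom_set p k" by (rule dom_set_exists)
    with s obtain s1 s2 where "s1 \<in> dom_set p k" "s2 \<in> dom_set p k" "s1 \<noteq> s2"
      unfolding N_def by blast
    then have kW: "k \<in> W1 \<union> W2" using W[of s1 k s2] W[of s2 k s1] by linarith
    define u where "u k = n * indicat_real (edge \<eta> (dom_set p k)) s + E * indicat_real (edge D (dom_set p k)) s" for k
    define v where "v k = B * indicat_real (edge D (dom_set p k)) s" for k
    have uv: "u k \<ge> 0" "v k \<ge> 0" for k using E B(2) by (auto simp: u_def v_def)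
    have F: "F s = sum u W1 + sum v W2 + T s" by (simp add: F_def u_def v_def)
    have u_le: "u k \<le> F s" if "k \<in> W1" for k
      using member_le_sum[of k W1 u] that uv fin T0[of s] sum_nonneg[of W2 v] unfolding F by force
    have v_le: "v k \<le> F s" if "k \<in> W2" for k
      using member_le_sum[of k W2 v] that uv fin T0[of s] sum_nonneg[of W1 u] unfolding F by force
    have T_le: "T s \<le> F s" using sum_nonneg[of W1 u] sum_nonneg[of W2 v] uv unfolding F by force
    show ?thesis
    proof (cases "s \<in> edge D (dom_set p k)")
      case False
      then have dom: "s - D \<in> dom_set p k" "s + D \<in> dom_set p k" using k by (auto simp: edge_def)
      have "cmod (mode_sum p m s) \<le> (\<Sum>z\<in>#proots p. cmod (refl_pos (exp s) z ^ m))"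
        unfolding mode_sum_def by (rule norm_sum_mset_le)
      also have "\<dots> \<le> T s"
        unfolding T_def
      proof (rule sum_mset_mono)
        fix z assume z: "z \<in># proots p"
        show "cmod (refl_pos (exp s) z ^ m) \<le> exp (- (D - 4) / 2) * exp (- (1/2) * \<bar>s - ln (cmod z)\<bar>)"
        proof (cases "z = 0")
          case True
          then show ?thesis using m by (simp add: refl_pos_def power_0_left)
        next
          case False
          define d where "d = \<bar>s - ln (cmod z)\<bar>"
          have d: "D - 4 \<le> d" "d \<ge> 0"
            using dom_set_zero_free[OF p(1) dom z False] by (auto simp: d_def)
          have "cmod (refl_pos (exp s) z ^ m) \<le> exp (- real m * d)"
            unfolding d_def by (rule norm_refl_pos_power)
          also have "\<dots> \<le> exp (- 1 * d)"
            using m d by (intro exp_le_cancel_iff[THEN iffD2] mult_right_mono) auto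
          also have "\<dots> \<le> exp (- (D - 4) / 2 + - (1/2) * d)"
          proof -
            have "- 1 * d = - d / 2 + - (1/2) * d" by simp
            also have "\<dots> \<le> - (D - 4) / 2 + - (1/2) * d"
              using d(1) by (intro add_right_mono divide_right_mono) auto
            finally show ?thesis by (simp only: exp_le_cancel_iff)
          qed
          finally show ?thesis by (simp only: exp_add d_def)
        qed
      qed
      finally show ?thesis using T_le by linarith
    next
      case edge: True
      show ?thesis
      proof (cases "k \<in> W2")
        case True
        have "cmod (mode_sum p m s) \<le> v k" using B(1)[OF True k(2)] edge by (simp add: v_def)
        then show ?thesis using v_le[OF True] by linarith
      next
        case False
        then have k1: "k \<in> W1" using kW by simp
        have "cmod (mode_sum p m s) \<le> u k"
        proof (cases "s \<in> edge \<eta> (dom_set p k)")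
          case True
          then show ?thesis using mode_sum_le_degree[of p m s] p(2) E edge by (simp add: u_def)
        next
          case False
          then have dom: "s - \<eta> \<in> dom_set p k" "s + \<eta> \<in> dom_set p k" using k by (auto simp: edge_def)
          then show ?thesis using mode_sum_le_inner[OF p(1) dom \<eta> m] edge False by (simp add: u_def E_def)
        qed
        then show ?thesis using u_le[OF k1] by linarith
      qed
    qed
  qed
  have AE: "AE s in lborel. cmod (mode_sum p m s) \<le> F s"
    using le by (intro AE_I[where N = N] finite_imp_null_set_lborel[THEN null_setsD1]
        finite_imp_null_set_lborel[THEN null_setsD2] \<open>finite N\<close>) auto
  note g = has_bochner_integral_mode_sum[OF m, of p]
  have F: "has_bochner_integral lborel F
     ((\<Sum>k\<in>W1. n * integral\<^sup>L lborel (indicat_real (edge \<eta> (dom_set p k))) + E * integral\<^sup>L lborel (indicat_real (edge D (dom_set p k))))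
     + (\<Sum>k\<in>W2. B * integral\<^sup>L lborel (indicat_real (edge D (dom_set p k))))
     + (\<Sum>z\<in>#proots p. exp (- (D - 4) / 2) * (2 / (1/2))))"
    unfolding F_def[abs_def]
    by (intro has_bochner_integral_add has_bochner_integral_sum has_bochner_integral_mult_right
        has_bochner_integral_integrable edge_dom_set(1) \<eta> D T)
  then have intF: "integrable lborel F" by (simp add: has_bochner_integral_iff)
  have "2 / m * cmod (\<Sum>z\<in>#proots p. sgn z ^ m) = cmod (integral\<^sup>L lborel (mode_sum p m))"
    using has_bochner_integral_integral_eq[OF g] m by (simp add: norm_mult norm_divide)
  also have "\<dots> \<le> (\<integral>s. cmod (mode_sum p m s) \<partial>lborel)" by (rule integral_norm_bound)
  also have "\<dots> \<le> integral\<^sup>L lborel F"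
    using AE intF has_bochner_integral_iff[THEN iffD1, OF g] by (intro integral_mono_AE integrable_norm) auto
  also have "\<dots> = (\<Sum>k\<in>W1. n * integral\<^sup>L lborel (indicat_real (edge \<eta> (dom_set p k))) + E * integral\<^sup>L lborel (indicat_real (edge D (dom_set p k))))
     + (\<Sum>k\<in>W2. B * integral\<^sup>L lborel (indicat_real (edge D (dom_set p k))))
     + (\<Sum>z\<in>#proots p. exp (- (D - 4) / 2) * (2 / (1/2)))"
    using F by (rule has_bochner_integral_integral_eq)
  also have "\<dots> \<le> (\<Sum>k\<in>W1. n * (2 * \<eta>) + E * (2 * D)) + (\<Sum>k\<in>W2. B * (2 * D))
     + n * (4 * exp (- (D - 4) / 2))"
  proof (intro add_mono sum_mono mult_left_mono edge_dom_set(2) \<eta> D E B(2))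
    have "real (degree p) * (4 * exp (- (D - 4) / 2)) \<le> n * (4 * exp (- (D - 4) / 2))"
      using p(2) by (intro mult_right_mono) auto
    then show "(\<Sum>z\<in>#proots p. exp (- (D - 4) / 2) * (2 / (1/2))) \<le> n * (4 * exp (- (D - 4) / 2))"
      by (simp add: size_proots_complex)
  qed simp
  finally show ?thesis by (simp add: E_def algebra_simps)
qed

section \<open>Records of exchangeable sequences\<close>

text \<open>Records are strict, so ties never create additional ones, and position 0 is a record
  vacuously. K discards early positions but not the comparison with them.\<close>

definition records :: "nat \<Rightarrow> nat \<Rightarrow> (nat \<Rightarrow> real) \<Rightarrow> nat set" where
  "records K N y = {k \<in> {K..<N}. \<forall>j<k. y j < y k}"

lemma finite_records [simp]: "finite (records K N y)"
  by (simp add: records_def)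

lemma records_subset: "records K N y \<subseteq> {K..<N}"
  by (auto simp: records_def)

lemma sum_if_at_most_one:
  fixes c :: real
  assumes "finite A" "A \<noteq> {}" "c \<ge> 1" "\<And>x y. x \<in> A \<Longrightarrow> y \<in> A \<Longrightarrow> P x \<Longrightarrow> P y \<Longrightarrow> x = y"
  shows "(\<Sum>x\<in>A. if P x then c else 1) \<le> real (card A) - 1 + c"
proof (cases "\<exists>x\<in>A. P x")
  case True
  then obtain x where x: "x \<in> A" "P x" by auto
  have "(\<Sum>y\<in>A. if P y then c else 1) = (\<Sum>y\<in>A. 1 + (if y = x then c - 1 else 0))"
    using x assms(4) by (intro sum.cong) auto
  also have "\<dots> = real (card A) - 1 + c"
    using x assms(1) by (simp add: sum.distrib)
  finally show ?thesis by simp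
next
  case False
  then have "(\<Sum>y\<in>A. if P y then c else 1) = (\<Sum>y\<in>A. 1)" by (intro sum.cong) auto
  then show ?thesis using assms(3) by simp
qed

text \<open>A permutation is split into the index b whose value is moved to position N and a
  permutation q of the rest. Whether N is a record depends on b alone and, by strictness, holds for
  at most one of the N + 1 choices, which yields the factor N + c. Ties only lower the count, hence
  an inequality and no assumption on y.\<close>

lemma sum_permutations_records:
  fixes y :: "nat \<Rightarrow> real" and c :: real
  assumes c: "c \<ge> 1"
  shows "(\<Sum>\<pi> | \<pi> permutes {..<N}. c ^ card (records K N (y \<circ> \<pi>)))
           \<le> fact N * (\<Prod>k\<in>{K..<N}. 1 + (c - 1) / (real k + 1))"
proof (induction N arbitrary: y)
  case 0
  have "records K 0 y' = {}" for y' by (auto simp: records_def)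
  then show ?case by simp
next
  case (Suc N)
  define P where "P = (\<Prod>k\<in>{K..<N}. 1 + (c - 1) / (real k + 1))"
  have P: "P \<ge> 0" unfolding P_def using c by (intro prod_nonneg) auto
  define R where "R b = (K \<le> N \<and> (\<forall>j<N. (y \<circ> Transposition.transpose N b) j < (y \<circ> Transposition.transpose N b) N))" for b
  have Suc_eq: "{..<Suc N} = insert N {..<N}" by auto
  have step: "c ^ card (records K (Suc N) (y \<circ> (Transposition.transpose N b \<circ> q))) \<le>
      (if R b then c else 1) * c ^ card (records K N ((y \<circ> Transposition.transpose N b) \<circ> q))"
    if q: "q permutes {..<N}" for b q
  proof -
    have qN: "q N = N" by (rule permutes_not_in[OF q]) simp
    have "records K (Suc N) (y \<circ> (Transposition.transpose N b \<circ> q)) \<subseteq>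
      (if R b then {N} else {}) \<union> records K N ((y \<circ> Transposition.transpose N b) \<circ> q)"
    proof
      fix k assume k: "k \<in> records K (Suc N) (y \<circ> (Transposition.transpose N b \<circ> q))"
      show "k \<in> (if R b then {N} else {}) \<union> records K N ((y \<circ> Transposition.transpose N b) \<circ> q)"
      proof (cases "k = N")
        case True
        have lt: "\<forall>i<N. (y \<circ> Transposition.transpose N b) (q i) < (y \<circ> Transposition.transpose N b) (q N)"
          using k True unfolding records_def comp_def by blast
        have "(y \<circ> Transposition.transpose N b) j < (y \<circ> Transposition.transpose N b) N" if "j < N" for j
        proof -
          have "j \<in> q ` {..<N}" using that permutes_image[OF q] by simp
          then obtain i where "i < N" "j = q i" by blast
          then show ?thesis using lt unfolding qN by blast
        qed
        moreover have "K \<le> N" using k True unfolding records_def by simp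
        ultimately have "R b" unfolding R_def by blast
        then show ?thesis using True by simp
      next
        case False
        then show ?thesis using k unfolding records_def by (auto simp: comp_def)
      qed
    qed
    then have "card (records K (Suc N) (y \<circ> (Transposition.transpose N b \<circ> q))) \<le>
      card ((if R b then {N} else {}) \<union> records K N ((y \<circ> Transposition.transpose N b) \<circ> q))"
      by (intro card_mono) auto
    also have "\<dots> \<le> (if R b then 1 else 0) + card (records K N ((y \<circ> Transposition.transpose N b) \<circ> q))"
      by (rule order.trans[OF card_Un_le]) auto
    finally have "c ^ card (records K (Suc N) (y \<circ> (Transposition.transpose N b \<circ> q))) \<le>
        c ^ ((if R b then 1 else 0) + card (records K N ((y \<circ> Transposition.transpose N b) \<circ> q)))"
      using c by (rule power_increasing)
    then show ?thesis by (simp add: power_add split: if_splits)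
  qed
  have "(\<Sum>\<pi> | \<pi> permutes {..<Suc N}. c ^ card (records K (Suc N) (y \<circ> \<pi>))) =
     (\<Sum>b\<in>insert N {..<N}. \<Sum>q | q permutes {..<N}. c ^ card (records K (Suc N) (y \<circ> (Transposition.transpose N b \<circ> q))))"
    unfolding Suc_eq by (rule sum_over_permutations_insert) auto
  also have "\<dots> \<le> (\<Sum>b\<in>insert N {..<N}. \<Sum>q | q permutes {..<N}. (if R b then c else 1) * c ^ card (records K N ((y \<circ> Transposition.transpose N b) \<circ> q)))"
    by (intro sum_mono step) auto
  also have "\<dots> = (\<Sum>b\<in>insert N {..<N}. (if R b then c else 1) * (\<Sum>q | q permutes {..<N}. c ^ card (records K N ((y \<circ> Transposition.transpose N b) \<circ> q))))"
    by (simp only: sum_distrib_left)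
  also have "\<dots> \<le> (\<Sum>b\<in>insert N {..<N}. (if R b then c else 1) * (fact N * P))"
    unfolding P_def using c by (intro sum_mono mult_left_mono Suc.IH) auto
  also have "\<dots> = (\<Sum>b\<in>insert N {..<N}. if R b then c else 1) * (fact N * P)"
    by (simp only: sum_distrib_right)
  also have "\<dots> \<le> (fact (Suc N) * (\<Prod>k\<in>{K..<Suc N}. 1 + (c - 1) / (real k + 1)))"
  proof (cases "K \<le> N")
    case True
    have "(\<Sum>b\<in>insert N {..<N}. if R b then c else 1) \<le> real (card (insert N {..<N})) - 1 + c"
    proof (rule sum_if_at_most_one)
      fix b b' assume b: "b \<in> insert N {..<N}" "b' \<in> insert N {..<N}" "R b" "R b'"
      show "b = b'"
      proof (rule ccontr)
        assume ne: "b \<noteq> b'"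
        have lt: "y b' < y b" if "R b" "b \<noteq> b'" "b \<in> insert N {..<N}" "b' \<in> insert N {..<N}" for b b'
        proof -
          \<comment> \<open>The position at which the value y b' sits once b and N are
            exchanged.\<close>
          define j where "j = (if b' = N then b else b')"
          have "j < N" "Transposition.transpose N b j = b'" using that by (auto simp: j_def transpose_def)
          with \<open>R b\<close> show ?thesis by (auto simp: R_def)
        qed
        show False using lt[OF b(3) ne b(1,2)] lt[OF b(4) ne[symmetric] b(2,1)] by simp
      qed
    qed (use c in auto)
    then have "(\<Sum>b\<in>insert N {..<N}. if R b then c else 1) \<le> (real N + 1) * (1 + (c - 1) / (real N + 1))"
    proof -
      have "(real N + 1) * (1 + (c - 1) / (real N + 1)) = real N + c" by (simp add: field_simps)
      moreover have "real (card (insert N {..<N})) = real N + 1" by simp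
      ultimately show ?thesis
        using \<open>(\<Sum>b\<in>insert N {..<N}. if R b then c else 1) \<le> _\<close> by linarith
    qed
    then have "(\<Sum>b\<in>insert N {..<N}. if R b then c else 1) * (fact N * P) \<le> (real N + 1) * (1 + (c - 1) / (real N + 1)) * (fact N * P)"
      using P by (intro mult_right_mono) auto
    also have "\<dots> = (real N + 1) * fact N * (P * (1 + (c - 1) / (real N + 1)))" by (simp only: mult_ac)
    also have "\<dots> = fact (Suc N) * (\<Prod>k\<in>{K..<Suc N}. 1 + (c - 1) / (real k + 1))"
      using True by (simp add: P_def add.commute)
    finally show ?thesis .
  next
    case False
    then have "(\<Sum>b\<in>insert N {..<N}. if R b then c else 1) = real N + 1" by (simp add: R_def)
    moreover have "P = 1" "(\<Prod>k\<in>{K..<Suc N}. 1 + (c - 1) / (real k + 1)) = 1"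
      using False by (simp_all add: P_def)
    ultimately show ?thesis by (simp add: add.commute)
  qed
  finally show ?case .
qed

text \<open>Since 1 / (k + 1) \<le> ln ((k + 1) / k), the factor at k is at most ((k + 1) / k) powr
  (c - 1), and the product telescopes.\<close>

lemma prod_records_le:
  fixes c :: real
  assumes "c \<ge> 1" "1 \<le> K" "K \<le> N"
  shows "(\<Prod>k\<in>{K..<N}. 1 + (c - 1) / (real k + 1)) \<le> (real N / real K) powr (c - 1)"
  using assms(3)
proof (induction N rule: dec_induct)
  case base
  then show ?case using assms by simp
next
  case (step N)
  have N: "N \<ge> 1" using step assms by simp
  have "1 + (c - 1) / (real N + 1) \<le> exp ((c - 1) * (1 / (real N + 1)))"
    using exp_ge_add_one_self[of "(c - 1) * (1 / (real N + 1))"] by simp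
  also have "\<dots> \<le> exp ((c - 1) * ln (real (Suc N) / real N))"
  proof -
    have "ln (real N / real (Suc N)) \<le> real N / real (Suc N) - 1"
      using N by (intro ln_le_minus_one) auto
    also have "\<dots> = - (1 / (real N + 1))" by (simp add: field_simps)
    finally have "1 / (real N + 1) \<le> ln (real (Suc N) / real N)"
      using N by (simp add: ln_div)
    then have "(c - 1) * (1 / (real N + 1)) \<le> (c - 1) * ln (real (Suc N) / real N)"
      using assms by (intro mult_left_mono) auto
    then show ?thesis by (simp only: exp_le_cancel_iff)
  qed
  also have "\<dots> = (real (Suc N) / real N) powr (c - 1)"
    using N by (simp add: powr_def mult.commute)
  finally have 1: "1 + (c - 1) / (real N + 1) \<le> (real (Suc N) / real N) powr (c - 1)" .
  have "(\<Prod>k\<in>{K..<Suc N}. 1 + (c - 1) / (real k + 1)) =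
     (\<Prod>k\<in>{K..<N}. 1 + (c - 1) / (real k + 1)) * (1 + (c - 1) / (real N + 1))"
    using step by simp
  also have "\<dots> \<le> (real N / real K) powr (c - 1) * (real (Suc N) / real N) powr (c - 1)"
    using 1 step.IH assms by (intro mult_mono) auto
  also have "\<dots> = (real (Suc N) / real K) powr (c - 1)"
  proof -
    have "real N / real K * (real (Suc N) / real N) = real (Suc N) / real K"
      using N by simp
    then show ?thesis by (subst powr_mult[symmetric]) (simp_all only: divide_nonneg_nonneg of_nat_0_le_iff)
  qed
  finally show ?case .
qed

text \<open>A finite product of indicator-like factors is evidently measurable, unlike the
  cardinality of a random set.\<close>

lemma power_card_records:
  "(c::real) ^ card (records K N y) = (\<Prod>k\<in>{K..<N}. if \<forall>j\<in>{..<k}. y j < y k then c else 1)"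
proof -
  have "(\<Prod>k\<in>{K..<N}. if \<forall>j\<in>{..<k}. y j < y k then c else 1) = (\<Prod>k\<in>{K..<N} \<inter> {k. \<forall>j\<in>{..<k}. y j < y k}. c)"
    by (simp add: prod.If_cases)
  also have "{K..<N} \<inter> {k. \<forall>j\<in>{..<k}. y j < y k} = records K N y" by (auto simp: records_def)
  finally show ?thesis by simp
qed

section \<open>Distribution-free tail bounds for record counts\<close>

context prob_space
begin

text \<open>The joint law is an infinite product of one measure, which is invariant under every
  injective reindexing; this covers permutations of an initial segment as well as its
  reversal.\<close>

lemma exchangeable:
  fixes Y :: "nat \<Rightarrow> 'a \<Rightarrow> real" and F :: "(nat \<Rightarrow> real) \<Rightarrow> real"
  assumes ind: "indep_vars (\<lambda>_. borel) Y UNIV"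
    and id: "\<And>k. distr M borel (Y k) = distr M borel (Y 0)"
    and F [measurable]: "F \<in> borel_measurable (Pi\<^sub>M UNIV (\<lambda>_. borel))" and \<pi>: "inj \<pi>"
  shows "expectation (\<lambda>\<omega>. F (\<lambda>i. Y (\<pi> i) \<omega>)) = expectation (\<lambda>\<omega>. F (\<lambda>i. Y i \<omega>))"
proof -
  have rv [measurable]: "random_variable borel (Y i)" for i using ind by (auto simp: indep_vars_def)
  define D where "D = distr M borel (Y 0)"
  interpret D: prob_space D unfolding D_def by (rule prob_space_distr) simp
  have setsD [measurable_cong]: "sets D = sets borel" by (simp add: D_def)
  have setsP [measurable_cong]: "sets (Pi\<^sub>M UNIV (\<lambda>_::nat. D)) = sets (Pi\<^sub>M UNIV (\<lambda>_. borel))"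
    by (intro sets_PiM_cong) (auto simp: setsD)
  have "distr M (Pi\<^sub>M UNIV (\<lambda>_. borel)) (\<lambda>x. \<lambda>i\<in>UNIV. Y i x) = Pi\<^sub>M UNIV (\<lambda>i. distr M borel (Y i))"
    using ind by (subst (asm) indep_vars_iff_distr_eq_PiM) auto
  also have "Pi\<^sub>M UNIV (\<lambda>i. distr M borel (Y i)) = Pi\<^sub>M UNIV (\<lambda>_. D)"
    unfolding D_def by (intro PiM_cong refl id)
  finally have P: "distr M (Pi\<^sub>M UNIV (\<lambda>_. borel)) (\<lambda>\<omega> i. Y i \<omega>) = Pi\<^sub>M UNIV (\<lambda>_. D)"
    by (simp add: restrict_UNIV)
  have R: "distr (Pi\<^sub>M UNIV (\<lambda>_. D)) (Pi\<^sub>M UNIV (\<lambda>_. D)) (\<lambda>x i. x (\<pi> i)) = Pi\<^sub>M UNIV (\<lambda>_. D)"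
    using distr_PiM_reindex[of UNIV "\<lambda>_. D" \<pi> UNIV] \<pi> by (simp add: D.prob_space_axioms restrict_UNIV)
  have comp: "(\<lambda>x. x i) \<in> borel_measurable (Pi\<^sub>M UNIV (\<lambda>_::nat. borel :: real measure))" for i
    by (rule measurable_component_singleton) simp
  have mY: "(\<lambda>\<omega> i. Y i \<omega>) \<in> measurable M (Pi\<^sub>M UNIV (\<lambda>_. borel))"
    by (rule measurable_abs_UNIV) (rule rv)
  have m\<pi>: "(\<lambda>x i. x (\<pi> i)) \<in> measurable (Pi\<^sub>M UNIV (\<lambda>_::nat. borel :: real measure)) (Pi\<^sub>M UNIV (\<lambda>_. borel))"
    by (rule measurable_abs_UNIV) (rule comp)
  have mF: "(\<lambda>x. F (\<lambda>i. x (\<pi> i))) \<in> borel_measurable (Pi\<^sub>M UNIV (\<lambda>_. borel))"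
    by (rule measurable_compose[OF m\<pi> F])
  have "expectation (\<lambda>\<omega>. F (\<lambda>i. Y (\<pi> i) \<omega>)) = (\<integral>x. F (\<lambda>i. x (\<pi> i)) \<partial>distr M (Pi\<^sub>M UNIV (\<lambda>_. borel)) (\<lambda>\<omega> i. Y i \<omega>))"
    by (rule integral_distr[OF mY mF, symmetric])
  also have "\<dots> = (\<integral>x. F (\<lambda>i. x (\<pi> i)) \<partial>Pi\<^sub>M UNIV (\<lambda>_. D))" by (simp only: P)
  also have "\<dots> = (\<integral>x. F x \<partial>distr (Pi\<^sub>M UNIV (\<lambda>_. D)) (Pi\<^sub>M UNIV (\<lambda>_. D)) (\<lambda>x i. x (\<pi> i)))"
    by (rule integral_distr[symmetric])
       (simp_all only: m\<pi> F measurable_cong_sets[OF setsP setsP] measurable_cong_sets[OF setsP refl] measurable_cong_sets[OF refl setsP])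
  also have "\<dots> = (\<integral>x. F x \<partial>Pi\<^sub>M UNIV (\<lambda>_. D))" by (simp only: R)
  also have "\<dots> = (\<integral>x. F x \<partial>distr M (Pi\<^sub>M UNIV (\<lambda>_. borel)) (\<lambda>\<omega> i. Y i \<omega>))" by (simp only: P)
  also have "\<dots> = expectation (\<lambda>\<omega>. F (\<lambda>i. Y i \<omega>))"
    by (rule integral_distr[OF mY F])
  finally show ?thesis .
qed

text \<open>Averaging over all permutations of the first N indices leaves the expectation unchanged,
  while the average obeys a bound at every single outcome. This is why the law of Y is
  irrelevant.\<close>

lemma expectation_records:
  fixes Y :: "nat \<Rightarrow> 'a \<Rightarrow> real" and c :: real
  assumes ind: "indep_vars (\<lambda>_. borel) Y UNIV"
    and id: "\<And>k. distr M borel (Y k) = distr M borel (Y 0)"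
    and c: "c \<ge> 1" and \<pi>: "inj \<pi>"
  shows "expectation (\<lambda>\<omega>. c ^ card (records K N (\<lambda>i. Y (\<pi> i) \<omega>))) \<le> (\<Prod>k\<in>{K..<N}. 1 + (c - 1) / (real k + 1))"
proof -
  have rv [measurable]: "random_variable borel (Y i)" for i using ind by (auto simp: indep_vars_def)
  define F where "F y = c ^ card (records K N y)" for y
  have comp [measurable]: "(\<lambda>x. x i) \<in> borel_measurable (Pi\<^sub>M UNIV (\<lambda>_::nat. borel :: real measure))" for i
    by (rule measurable_component_singleton) simp
  have F: "F \<in> borel_measurable (Pi\<^sub>M UNIV (\<lambda>_. borel))"
    unfolding F_def[abs_def] power_card_records by measurable
  have ex: "expectation (\<lambda>\<omega>. F (\<lambda>i. Y (\<rho> i) \<omega>)) = expectation (\<lambda>\<omega>. F (\<lambda>i. Y i \<omega>))" if "inj \<rho>" for \<rho>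
    by (rule exchangeable[OF ind id F that])
  have int: "integrable M (\<lambda>\<omega>. F (\<lambda>i. Y (\<rho> i) \<omega>))" for \<rho>
  proof (rule integrable_const_bound[where B = "c ^ (N - K)"])
    have "card (records K N y) \<le> N - K" for y
      using card_mono[of "{K..<N}" "records K N y"] by (auto simp: records_subset)
    then show "AE \<omega> in M. norm (F (\<lambda>i. Y (\<rho> i) \<omega>)) \<le> c ^ (N - K)"
      using c by (auto simp: F_def intro!: power_increasing AE_I2)
    show "(\<lambda>\<omega>. F (\<lambda>i. Y (\<rho> i) \<omega>)) \<in> borel_measurable M"
      by (rule measurable_compose[OF measurable_abs_UNIV F]) (rule rv)
  qed
  have card: "card {\<rho>. \<rho> permutes {..<N}} = fact N" by (rule card_permutations) auto
  have "fact N * expectation (\<lambda>\<omega>. F (\<lambda>i. Y i \<omega>)) = (\<Sum>\<rho> | \<rho> permutes {..<N}. expectation (\<lambda>\<omega>. F (\<lambda>i. Y i \<omega>)))"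
    using card by simp
  also have "\<dots> = (\<Sum>\<rho> | \<rho> permutes {..<N}. expectation (\<lambda>\<omega>. F (\<lambda>i. Y (\<rho> i) \<omega>)))"
    by (rule sum.cong[OF refl], rule ex[symmetric], rule permutes_inj) simp
  also have "\<dots> = expectation (\<lambda>\<omega>. \<Sum>\<rho> | \<rho> permutes {..<N}. F (\<lambda>i. Y (\<rho> i) \<omega>))"
    by (rule Bochner_Integration.integral_sum[symmetric]) (rule int)
  also have "\<dots> \<le> expectation (\<lambda>\<omega>. fact N * (\<Prod>k\<in>{K..<N}. 1 + (c - 1) / (real k + 1)))"
  proof (rule integral_mono)
    fix \<omega>
    show "(\<Sum>\<rho> | \<rho> permutes {..<N}. F (\<lambda>i. Y (\<rho> i) \<omega>)) \<le> fact N * (\<Prod>k\<in>{K..<N}. 1 + (c - 1) / (real k + 1))"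
      using sum_permutations_records[OF c, where y = "\<lambda>i. Y i \<omega>"] by (simp add: F_def comp_def)
  qed (auto intro!: int)
  also have "\<dots> = fact N * (\<Prod>k\<in>{K..<N}. 1 + (c - 1) / (real k + 1))" by (simp add: prob_space)
  finally have "expectation (\<lambda>\<omega>. F (\<lambda>i. Y i \<omega>)) \<le> (\<Prod>k\<in>{K..<N}. 1 + (c - 1) / (real k + 1))"
    by simp
  then show ?thesis unfolding F_def ex[OF \<pi>, unfolded F_def] .
qed

text \<open>Markov's inequality for the exponential moment c ^ card.\<close>

lemma prob_many_records:
  fixes Y :: "nat \<Rightarrow> 'a \<Rightarrow> real" and c q :: real
  assumes ind: "indep_vars (\<lambda>_. borel) Y UNIV"
    and id: "\<And>k. distr M borel (Y k) = distr M borel (Y 0)"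
    and c: "c > 1" and \<pi>: "inj \<pi>" and K: "1 \<le> K" "K \<le> N"
  defines "A \<equiv> {\<omega> \<in> space M. q \<le> card (records K N (\<lambda>i. Y (\<pi> i) \<omega>))}"
  shows "A \<in> events" "prob A \<le> (real N / real K) powr (c - 1) * c powr (- q)"
proof -
  have rv [measurable]: "random_variable borel (Y i)" for i using ind by (auto simp: indep_vars_def)
  define f where "f \<omega> = c ^ card (records K N (\<lambda>i. Y (\<pi> i) \<omega>))" for \<omega>
  have f [measurable]: "f \<in> borel_measurable M"
    unfolding f_def[abs_def] power_card_records by measurable
  have A: "A = {\<omega> \<in> space M. c powr q \<le> f \<omega>}"
    using c by (auto simp: A_def f_def powr_realpow[symmetric])
  show "A \<in> events" unfolding A by measurable
  have int: "integrable M f"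
  proof (rule integrable_const_bound[where B = "c ^ (N - K)"])
    have "card (records K N y) \<le> N - K" for y
      using card_mono[of "{K..<N}" "records K N y"] by (auto simp: records_subset)
    then show "AE \<omega> in M. norm (f \<omega>) \<le> c ^ (N - K)"
      using c by (auto simp: f_def intro!: power_increasing AE_I2)
  qed measurable
  have "prob A \<le> expectation f / c powr q"
    unfolding A using c by (intro integral_Markov_inequality_measure[where A = "{}"] int) (auto simp: f_def)
  also have "\<dots> \<le> (real N / real K) powr (c - 1) / c powr q"
    using expectation_records[OF ind id _ \<pi>, of c K N] prod_records_le[OF _ K, of c] c
    unfolding f_def by (intro divide_right_mono) auto
  finally show "prob A \<le> (real N / real K) powr (c - 1) * c powr (- q)"
    by (simp add: powr_minus divide_inverse)
qed

end

section \<open>Almost sure statements by Borel-Cantelli\<close>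

context prob_space
begin

text \<open>With base l the tail bound is at most a constant times n powr (\<kappa> (l - 1) - c ln
  l), hence of order n powr (- 2). A small c demands a large l, which in turn forces \<kappa> to be
  small. The reindexing may vary with n, since only the probability for each n separately
  enters.\<close>

lemma AE_eventually_few_records:
  fixes Y :: "nat \<Rightarrow> 'a \<Rightarrow> real" and c l \<kappa> :: real
  assumes ind: "indep_vars (\<lambda>_. borel) Y UNIV"
    and id: "\<And>k. distr M borel (Y k) = distr M borel (Y 0)"
    and l: "l > 1" "c * ln l \<ge> 3" "\<kappa> * (l - 1) \<le> 1"
    and K: "\<And>n. n \<ge> 1 \<Longrightarrow> 1 \<le> K n" "\<And>n. n \<ge> 1 \<Longrightarrow> K n \<le> Suc n"
      "\<And>n. n \<ge> 1 \<Longrightarrow> real (Suc n) / real (K n) \<le> 4 * real n powr \<kappa>"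
    and \<pi>: "\<And>n. inj (\<pi> n)"
  shows "AE \<omega> in M. \<forall>\<^sub>F n in sequentially. card (records (K n) (Suc n) (\<lambda>i. Y (\<pi> n i) \<omega>)) < c * ln (real n)"
proof -
  define A where "A n = (if n = 0 then {} else {\<omega> \<in> space M. c * ln (real n) \<le> card (records (K n) (Suc n) (\<lambda>i. Y (\<pi> n i) \<omega>))})" for n
  have A: "A n \<in> events" for n
    using prob_many_records(1)[OF ind id l(1) \<pi> K(1,2)] by (simp add: A_def)
  have bound: "prob (A n) \<le> 4 powr (l - 1) * real n powr (- 2)" if n: "n \<ge> 1" for n
  proof -
    have "prob (A n) \<le> (real (Suc n) / real (K n)) powr (l - 1) * l powr (- (c * ln (real n)))"
      using prob_many_records(2)[OF ind id l(1) \<pi>[of n] K(1,2)[OF n], of "c * ln (real n)"] n by (simp only: A_def) simp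
    also have "\<dots> \<le> (4 powr (l - 1) * real n powr 1) * real n powr (- 3)"
    proof (rule mult_mono)
      have "(real (Suc n) / real (K n)) powr (l - 1) \<le> (4 * real n powr \<kappa>) powr (l - 1)"
        using K(3)[OF n] l by (intro powr_mono2) auto
      also have "\<dots> = 4 powr (l - 1) * real n powr (\<kappa> * (l - 1))"
        using n by (simp add: powr_mult powr_powr)
      also have "\<dots> \<le> 4 powr (l - 1) * real n powr 1"
        using n l by (intro mult_left_mono powr_mono) auto
      finally show "(real (Suc n) / real (K n)) powr (l - 1) \<le> 4 powr (l - 1) * real n powr 1" .
      have "l powr (- (c * ln (real n))) = real n powr (- (c * ln l))"
        using n l by (simp add: powr_def mult_ac)
      also have "\<dots> \<le> real n powr (- 3)"
        using n l by (intro powr_mono) auto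
      finally show "l powr (- (c * ln (real n))) \<le> real n powr (- 3)" .
    qed auto
    also have "\<dots> = 4 powr (l - 1) * (real n powr 1 * real n powr (- 3))" by (simp only: mult.assoc)
    also have "real n powr 1 * real n powr (- 3) = real n powr (- 2)" by (simp only: powr_add[symmetric]) simp
    finally show ?thesis .
  qed
  have "summable (\<lambda>n. prob (A n))"
  proof (rule summable_comparison_test_ev)
    show "summable (\<lambda>n. 4 powr (l - 1) * real n powr (- 2))"
      by (intro summable_mult) (simp add: summable_real_powr_iff)
    show "\<forall>\<^sub>F n in sequentially. norm (prob (A n)) \<le> 4 powr (l - 1) * real n powr (- 2)"
      using bound by (intro eventually_sequentiallyI[of 1]) auto
  qed
  then have "AE \<omega> in M. \<forall>\<^sub>F n in sequentially. \<omega> \<in> space M - A n"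
    by (intro borel_cantelli_AE1 A) (auto simp: emeasure_eq_measure)
  then show ?thesis
  proof (eventually_elim)
    case (elim \<omega>)
    then show ?case using eventually_gt_at_top[of 0]
      by eventually_elim (auto simp: A_def not_le)
  qed
qed

text \<open>The first sqrt n coefficients, read from either end, vanish together with summable
  probability. This bounds both the multiplicity of the zero at the origin and the deficit of the
  degree by sqrt n.\<close>

lemma AE_eventually_nonzero:
  fixes X :: "nat \<Rightarrow> 'a \<Rightarrow> complex"
  assumes ind: "indep_vars (\<lambda>_. borel) X UNIV"
    and id: "\<And>k. distr M borel (X k) = distr M borel (X 0)"
    and nz: "\<P>(\<omega> in M. X 0 \<omega> = 0) < 1"
    and \<pi>: "\<And>n. inj (\<pi> n)"
  shows "AE \<omega> in M. \<forall>\<^sub>F n in sequentially. \<exists>i\<le>nat \<lfloor>sqrt (real n)\<rfloor>. X (\<pi> n i) \<omega> \<noteq> 0"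
proof -
  have rv [measurable]: "random_variable borel (X i)" for i using ind by (auto simp: indep_vars_def)
  define p where "p = prob (X 0 -` {0} \<inter> space M)"
  have p: "0 \<le> p" "p < 1" using nz by (auto simp: p_def vimage_def Int_def conj_commute)
  have pk: "prob (X k -` {0} \<inter> space M) = p" for k
  proof -
    have "prob (X k -` {0} \<inter> space M) = measure (distr M borel (X k)) {0}" by (simp add: measure_distr)
    also have "\<dots> = measure (distr M borel (X 0)) {0}" by (simp only: id[of k])
    also have "\<dots> = p" by (simp add: measure_distr p_def)
    finally show ?thesis .
  qed
  define r where "r n = nat \<lfloor>sqrt (real n)\<rfloor>" for n
  define A where "A n = (\<Inter>k\<in>\<pi> n ` {..r n}. X k -` {0} \<inter> space M)" for n
  have A: "A n \<in> events" for n unfolding A_def by (intro sets.finite_INT) auto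
  have probA: "prob (A n) = p ^ Suc (r n)" for n
  proof -
    have "prob (A n) = (\<Prod>k\<in>\<pi> n ` {..r n}. prob (X k -` {0} \<inter> space M))"
      unfolding A_def by (intro indep_varsD[OF ind]) auto
    also have "\<dots> = p ^ card (\<pi> n ` {..r n})" by (simp add: pk)
    also have "card (\<pi> n ` {..r n}) = Suc (r n)"
      using \<pi>[of n] by (subst card_image) (auto intro: inj_on_subset)
    finally show ?thesis .
  qed
  \<comment> \<open>The maximum with 1/2 covers p = 0, where the logarithm would not give a positive
    rate.\<close>
  define a where "a = - ln (max p (1/2))"
  have a: "a > 0" using p by (auto simp: a_def max_def)
  have bound: "prob (A n) \<le> exp (- a * sqrt (real n))" for n
  proof -
    have "sqrt (real n) \<le> real (Suc (r n))" unfolding r_def by linarith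
    then have "exp (- a * real (Suc (r n))) \<le> exp (- a * sqrt (real n))" using a by simp
    moreover have "p ^ Suc (r n) \<le> (max p (1/2)) ^ Suc (r n)" using p by (intro power_mono) auto
    moreover have "(max p (1/2)) ^ Suc (r n) = exp (- a * real (Suc (r n)))"
    proof -
      have "exp (- a) = max p (1/2)" by (simp add: a_def)
      then have "(max p (1/2)) ^ Suc (r n) = exp (- a) ^ Suc (r n)" by simp
      also have "\<dots> = exp (real (Suc (r n)) * (- a))" by (rule exp_of_nat_mult[symmetric])
      finally show ?thesis by (simp add: mult.commute)
    qed
    ultimately show ?thesis unfolding probA by linarith
  qed
  have "summable (\<lambda>n. prob (A n))"
  proof (rule summable_comparison_test_ev)
    show "summable (\<lambda>n. real n powr (- 2))" by (simp add: summable_real_powr_iff)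
    have "\<forall>\<^sub>F n in sequentially. exp (- a * sqrt (real n)) \<le> real n powr (- 2)"
      using a by real_asymp
    then show "\<forall>\<^sub>F n in sequentially. norm (prob (A n)) \<le> real n powr (- 2)"
      by eventually_elim (use bound in \<open>auto intro: order.trans\<close>)
  qed
  then have "AE \<omega> in M. \<forall>\<^sub>F n in sequentially. \<omega> \<in> space M - A n"
    by (intro borel_cantelli_AE1 A) (auto simp: emeasure_eq_measure)
  then show ?thesis
  proof (eventually_elim)
    case (elim \<omega>)
    then show ?case by eventually_elim (auto simp: A_def r_def)
  qed
qed

end

section \<open>Vanishing of the error terms\<close>

lemma tendsto_error_terms:
  fixes c \<kappa> :: real
  assumes "\<kappa> > 0"
  shows "(\<lambda>n. (2 * c * ln n * (2 * (2 * ln n + 4) * (4 * m * (ln (6 / (512 * pi / ln n)) * n powr (1/2)))) +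
     (2 + 12 * ln n) * (2 * (2 * ln n + 4) * (2 * m * (ln (n + 1) + n powr (1 - \<kappa>) * ln n))) + 4) / real n) \<longlonglongrightarrow> 0"
proof -
  have 1: "(\<lambda>n. (2 * c * ln n * (2 * (2 * ln n + 4) * (4 * m * (ln (6 / (512 * pi / ln n)) * n powr (1/2))))) / real n) \<longlonglongrightarrow> 0"
    by real_asymp
  have 2: "(\<lambda>n. ((2 + 12 * ln n) * (2 * (2 * ln n + 4) * (2 * m * (ln (n + 1) + n powr (1 - \<kappa>) * ln n)))) / real n) \<longlonglongrightarrow> 0"
  proof -
    have "(\<lambda>n::nat. ln (real n) ^ i * (1 / real n powr \<kappa>)) \<longlonglongrightarrow> 0" for i
      using assms by real_asymp
    note P = tendsto_mult_right_zero[OF this]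
    \<comment> \<open>With L = ln n the product (2 + 12 L) * 2 * (2 L + 4) * 2 m * L equals 32 m L +
      208 m L^2 + 96 m L^3.\<close>
    have "(\<lambda>n::nat. ((2 + 12 * ln n) * (2 * (2 * ln n + 4) * (2 * m * ln (n + 1)))) / real n +
        (32 * m * (ln n ^ 1 * (1 / real n powr \<kappa>)) + 208 * m * (ln n ^ 2 * (1 / real n powr \<kappa>))
          + 96 * m * (ln n ^ 3 * (1 / real n powr \<kappa>)))) \<longlonglongrightarrow> 0 + (0 + 0 + 0)"
      by (intro tendsto_add P) real_asymp
    moreover have "\<forall>\<^sub>F n::nat in sequentially. ((2 + 12 * ln n) * (2 * (2 * ln n + 4) * (2 * m * ln (n + 1)))) / real n +
        (32 * m * (ln n ^ 1 * (1 / real n powr \<kappa>)) + 208 * m * (ln n ^ 2 * (1 / real n powr \<kappa>))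
          + 96 * m * (ln n ^ 3 * (1 / real n powr \<kappa>))) =
        ((2 + 12 * ln n) * (2 * (2 * ln n + 4) * (2 * m * (ln (n + 1) + n powr (1 - \<kappa>) * ln n)))) / real n"
      using eventually_gt_at_top[of 0]
    proof eventually_elim
      case (elim n)
      define q where "q = 1 / real n powr \<kappa>"
      have "real n powr (1 - \<kappa>) = real n * q" using elim by (simp add: powr_diff q_def)
      then show ?case unfolding q_def[symmetric]
        using elim by (simp add: field_simps power2_eq_square power3_eq_cube)
    qed
    ultimately show ?thesis by (simp add: tendsto_cong)
  qed
  have 3: "(\<lambda>n. 4 / real n) \<longlonglongrightarrow> 0" by real_asymp
  show ?thesis unfolding add_divide_distrib
    using tendsto_add[OF tendsto_add[OF 1 2] 3] by simp
qed

section \<open>Weyl's criterion for sectors\<close>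

text \<open>The divisor is n and not the size of U: zeros at the origin are dropped and the degree
  can be below n, so the total mass is 1 only in the limit.\<close>

definition unit_mean :: "complex multiset \<Rightarrow> nat \<Rightarrow> (complex \<Rightarrow> 'a::real_normed_vector) \<Rightarrow> 'a" where
  "unit_mean U n f = (\<Sum>u\<in>#U. f u) /\<^sub>R real n"

lemma unit_mean_sum:
  "unit_mean U n (\<lambda>u. \<Sum>i\<in>A. f i u) = (\<Sum>i\<in>A. unit_mean U n (f i))"
proof -
  have "(\<Sum>u\<in>#U. \<Sum>i\<in>A. f i u) = (\<Sum>i\<in>A. \<Sum>u\<in>#U. f i u)"
    by (induction U) (auto simp: sum.distrib)
  then show ?thesis by (simp add: unit_mean_def scaleR_sum_right)
qed

lemma unit_mean_cmult:
  fixes f :: "complex \<Rightarrow> 'a::real_normed_algebra"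
  shows "unit_mean U n (\<lambda>u. c * f u) = c * unit_mean U n f"
proof -
  have "(\<Sum>u\<in>#U. c * f u) = c * (\<Sum>u\<in>#U. f u)"
    by (induction U) (auto simp: distrib_left)
  then show ?thesis by (simp add: unit_mean_def)
qed

lemma unit_mean_cong: "(\<And>u. u \<in># U \<Longrightarrow> f u = g u) \<Longrightarrow> unit_mean U n f = unit_mean U n g"
  unfolding unit_mean_def by (metis (mono_tags, lifting) image_mset_cong)

lemma unit_mean_cnj: "unit_mean U n (\<lambda>u. cnj (f u)) = cnj (unit_mean U n f)"
proof -
  have "(\<Sum>u\<in>#U. cnj (f u)) = cnj (\<Sum>u\<in>#U. f u)" by (induction U) auto
  then show ?thesis by (simp add: unit_mean_def)
qed

lemma unit_mean_Re: "unit_mean U n (\<lambda>u. Re (f u)) = Re (unit_mean U n f)"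
proof -
  have "(\<Sum>u\<in>#U. Re (f u)) = Re (\<Sum>u\<in>#U. f u)" by (induction U) auto
  then show ?thesis by (simp add: unit_mean_def)
qed

lemma unit_power_cnj:
  assumes "cmod u = 1"
  shows "u ^ i * cnj u ^ k = (if k \<le> i then u ^ (i - k) else cnj u ^ (k - i))"
proof -
  have u: "u * cnj u = 1" using assms by (simp add: complex_norm_square[symmetric])
  show ?thesis
  proof (cases "k \<le> i")
    case True
    then have "u ^ i * cnj u ^ k = u ^ (i - k) * (u * cnj u) ^ k"
      by (simp add: power_mult_distrib flip: power_add mult.assoc)
    then show ?thesis using True u by simp
  next
    case False
    then have "u ^ i * cnj u ^ k = (u * cnj u) ^ i * cnj u ^ (k - i)"
      by (simp add: power_mult_distrib mult.assoc flip: power_add)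
    then show ?thesis using False u by simp
  qed
qed

locale equidistributed_modes =
  fixes U :: "nat \<Rightarrow> complex multiset"
  assumes unit: "\<And>n u. u \<in># U n \<Longrightarrow> cmod u = 1"
    and modes: "\<And>m. m > 0 \<Longrightarrow> (\<lambda>n. unit_mean (U n) n (\<lambda>u. u ^ m)) \<longlonglongrightarrow> 0"
    and mass: "(\<lambda>n. real (size (U n)) / real n) \<longlonglongrightarrow> 1"
begin

text \<open>The rotation c is carried along so that an arc in any direction can later be described
  by the real part of u * c alone.\<close>

lemma mean_mixed_power:
  assumes c: "cmod c = 1"
  shows "(\<lambda>n. unit_mean (U n) n (\<lambda>u. (u * c) ^ i * cnj (u * c) ^ k)) \<longlonglongrightarrow> (if i = k then 1 else 0)"
proof -
  have pos: "(\<lambda>n. unit_mean (U n) n (\<lambda>u. (u * c) ^ m)) \<longlonglongrightarrow> (if m = 0 then 1 else 0)" for m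
  proof (cases "m = 0")
    case True
    have "unit_mean (U n) n (\<lambda>u. 1 :: complex) = of_real (real (size (U n)) / real n)" for n
      by (simp add: unit_mean_def scaleR_conv_of_real divide_inverse mult.commute)
    moreover have "(\<lambda>n. complex_of_real (real (size (U n)) / real n)) \<longlonglongrightarrow> of_real 1"
      by (rule tendsto_of_real[OF mass])
    ultimately show ?thesis using True by simp
  next
    case False
    have "unit_mean (U n) n (\<lambda>u. (u * c) ^ m) = c ^ m * unit_mean (U n) n (\<lambda>u. u ^ m)" for n
      by (simp add: unit_mean_cmult[symmetric] power_mult_distrib mult.commute)
    then show ?thesis using tendsto_mult[OF tendsto_const modes[of m], of "c ^ m"] False by simp
  qed
  have unit': "cmod (u * c) = 1" if "u \<in># U n" for u n
    using unit[OF that] c by (simp add: norm_mult)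
  show ?thesis
  proof (cases "k \<le> i")
    case True
    have "unit_mean (U n) n (\<lambda>u. (u * c) ^ i * cnj (u * c) ^ k) = unit_mean (U n) n (\<lambda>u. (u * c) ^ (i - k))" for n
      using True by (intro unit_mean_cong) (simp only: unit_power_cnj[OF unit'] if_True)
    then show ?thesis using pos[of "i - k"] True by (simp add: le_antisym split: if_splits)
  next
    case False
    have "unit_mean (U n) n (\<lambda>u. (u * c) ^ i * cnj (u * c) ^ k) = cnj (unit_mean (U n) n (\<lambda>u. (u * c) ^ (k - i)))" for n
      unfolding unit_mean_cnj[symmetric] using False
      by (intro unit_mean_cong) (simp only: unit_power_cnj[OF unit'] if_False complex_cnj_power)
    then show ?thesis using tendsto_cnj[OF pos[of "k - i"]] False by simp
  qed
qed

text \<open>Writing Re w = (w + cnj w) / 2 and expanding binomially, the limit and the integral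
  agree term by term, so the integral of cos t ^ j need not be evaluated.\<close>

lemma mean_Re_power:
  assumes c: "cmod c = 1"
  shows "(\<lambda>n. unit_mean (U n) n (\<lambda>u. Re (u * c) ^ j)) \<longlonglongrightarrow> integral {0..2*pi} (\<lambda>t. cos t ^ j) / (2 * pi)"
proof -
  define L where "L = (\<Sum>k\<le>j. of_nat (j choose k) / 2 ^ j * (if k = j - k then 1 else 0 :: complex))"
  have eq: "complex_of_real (Re w ^ j) = (\<Sum>k\<le>j. of_nat (j choose k) / 2 ^ j * (w ^ k * cnj w ^ (j - k)))" for w
  proof -
    have "complex_of_real (Re w) = (w + cnj w) / 2" by (simp add: complex_add_cnj)
    then have "complex_of_real (Re w ^ j) = (w + cnj w) ^ j / 2 ^ j"
      by (simp only: of_real_power power_divide)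
    also have "\<dots> = (\<Sum>k\<le>j. of_nat (j choose k) / 2 ^ j * (w ^ k * cnj w ^ (j - k)))"
      unfolding binomial_ring sum_divide_distrib by (intro sum.cong) (auto simp: field_simps)
    finally show ?thesis .
  qed
  have "(\<lambda>n. unit_mean (U n) n (\<lambda>u. complex_of_real (Re (u * c) ^ j))) \<longlonglongrightarrow> L"
    unfolding eq L_def unit_mean_sum unit_mean_cmult
    by (intro tendsto_sum tendsto_mult tendsto_const mean_mixed_power c)
  then have "(\<lambda>n. Re (unit_mean (U n) n (\<lambda>u. complex_of_real (Re (u * c) ^ j)))) \<longlonglongrightarrow> Re L"
    by (rule tendsto_Re)
  then have lim: "(\<lambda>n. unit_mean (U n) n (\<lambda>u. Re (u * c) ^ j)) \<longlonglongrightarrow> Re L"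
    unfolding unit_mean_Re[symmetric] by (simp only: Re_complex_of_real)
  have mixed: "((\<lambda>t. cis t ^ k * cnj (cis t) ^ l) has_integral of_real (2 * pi) * (if k = l then 1 else 0)) {0..2*pi}" for k l
  proof -
    have "cis t ^ k * cnj (cis t) ^ l = cis (of_int (int k - int l) * t)" for t
    proof -
      have "cis t ^ k * cnj (cis t) ^ l = cis (real k * t + real l * (- t))"
        unfolding cis_cnj Complex.DeMoivre cis_mult ..
      also have "real k * t + real l * (- t) = of_int (int k - int l) * t"
        by (simp add: left_diff_distrib)
      finally show ?thesis .
    qed
    then show ?thesis using has_integral_cis[of "int k - int l"] by (simp split: if_splits)
  qed
  have "((\<lambda>t. complex_of_real (Re (cis t) ^ j)) has_integral
      (\<Sum>k\<le>j. of_nat (j choose k) / 2 ^ j * (of_real (2 * pi) * (if k = j - k then 1 else 0 :: complex)))) {0..2*pi}"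
    unfolding eq by (intro has_integral_sum has_integral_mult_right mixed) auto
  also have "(\<Sum>k\<le>j. of_nat (j choose k) / 2 ^ j * (of_real (2 * pi) * (if k = j - k then 1 else 0 :: complex))) = of_real (2 * pi) * L"
    unfolding L_def sum_distrib_left by (intro sum.cong) auto
  finally have "((\<lambda>t. Re (complex_of_real (Re (cis t) ^ j))) has_integral Re (of_real (2 * pi) * L)) {0..2*pi}"
    by (rule has_integral_Re)
  then have "integral {0..2*pi} (\<lambda>t. cos t ^ j) = 2 * pi * Re L"
    by (intro integral_unique) simp
  then show ?thesis using lim by simp
qed

text \<open>Arcs are determined by Re (u * c), so approximation by polynomials in one variable on
  [-1, 1] takes the place of trigonometric polynomials.\<close>

lemma mean_continuous:
  fixes f :: "real \<Rightarrow> real"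
  assumes c: "cmod c = 1" and f: "continuous_on {-1..1} f"
  shows "(\<lambda>n. unit_mean (U n) n (\<lambda>u. f (Re (u * c)))) \<longlonglongrightarrow> integral {0..2*pi} (\<lambda>t. f (cos t)) / (2 * pi)"
proof (rule LIMSEQ_I)
  fix e :: real assume e: "e > 0"
  define I where "I g = integral {0..2*pi} (\<lambda>t. g (cos t)) / (2 * pi)" for g :: "real \<Rightarrow> real"
  obtain q where q: "real_polynomial_function q" "\<And>x. x \<in> {-1..1} \<Longrightarrow> \<bar>f x - q x\<bar> < e / 4"
    using Stone_Weierstrass_real_polynomial_function[of "{-1..1}" f "e / 4"] f e by auto
  obtain a d where qa: "q = (\<lambda>x. \<Sum>i\<le>d. a i * x ^ i)"
    using q(1) unfolding real_polynomial_function_iff_sum by blast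
  have Iq: "I q = (\<Sum>i\<le>d. a i * (integral {0..2*pi} (\<lambda>t. cos t ^ i) / (2 * pi)))"
    unfolding I_def qa
    by (subst integral_sum) (auto simp: sum_divide_distrib intro!: integrable_continuous_interval continuous_intros)
  have lim_q: "(\<lambda>n. unit_mean (U n) n (\<lambda>u. q (Re (u * c)))) \<longlonglongrightarrow> I q"
  proof -
    have "(\<lambda>n. unit_mean (U n) n (\<lambda>u. q (Re (u * c)))) \<longlonglongrightarrow> (\<Sum>i\<le>d. a i * (integral {0..2*pi} (\<lambda>t. cos t ^ i) / (2 * pi)))"
      unfolding qa unit_mean_sum unit_mean_cmult
      by (intro tendsto_sum tendsto_mult tendsto_const mean_Re_power c)
    then show ?thesis by (simp only: Iq)
  qed
  have cont: "continuous_on {0..2*pi} (\<lambda>t. g (cos t))" if "continuous_on {-1..1} g" for g :: "real \<Rightarrow> real"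
    by (rule continuous_on_compose2[OF that]) (auto intro!: continuous_intros)
  have contq: "continuous_on {-1..1} q" unfolding qa by (intro continuous_intros)
  have If: "\<bar>I f - I q\<bar> \<le> e / 4"
  proof -
    have "\<bar>integral {0..2*pi} (\<lambda>t. f (cos t)) - integral {0..2*pi} (\<lambda>t. q (cos t))\<bar> =
        norm (integral {0..2*pi} (\<lambda>t. f (cos t) - q (cos t)))"
      by (subst integral_diff) (auto intro!: integrable_continuous_interval cont f contq)
    also have "\<dots> \<le> e / 4 * (2 * pi - 0)"
    proof (rule integral_bound)
      show "continuous_on {0..2*pi} (\<lambda>t. f (cos t) - q (cos t))"
        by (intro continuous_on_diff cont f contq)
      show "norm (f (cos t) - q (cos t)) \<le> e / 4" for t
        using q(2)[of "cos t"] by simp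
    qed simp
    finally have "\<bar>integral {0..2*pi} (\<lambda>t. f (cos t)) - integral {0..2*pi} (\<lambda>t. q (cos t))\<bar> / (2 * pi) \<le> e / 4"
      by (simp add: divide_le_eq mult.commute)
    then show ?thesis unfolding I_def diff_divide_distrib[symmetric] abs_divide by simp
  qed
  have mean_f: "\<bar>unit_mean (U n) n (\<lambda>u. f (Re (u * c))) - unit_mean (U n) n (\<lambda>u. q (Re (u * c)))\<bar>
      \<le> e / 4 * (real (size (U n)) / real n)" for n
  proof -
    have "\<bar>(\<Sum>u\<in>#V. f (Re (u * c))) - (\<Sum>u\<in>#V. q (Re (u * c)))\<bar> \<le> e / 4 * real (size V)"
      if "\<And>u. u \<in># V \<Longrightarrow> cmod u = 1" for V
      using that
    proof (induction V)
      case (add u V)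
      have "\<bar>Re (u * c)\<bar> \<le> 1"
        using abs_Re_le_cmod[of "u * c"] add.prems[of u] c by (simp add: norm_mult del: times_complex.sel)
      then have "\<bar>f (Re (u * c)) - q (Re (u * c))\<bar> < e / 4" by (intro q(2)) auto
      moreover have "\<bar>(\<Sum>u\<in>#V. f (Re (u * c))) - (\<Sum>u\<in>#V. q (Re (u * c)))\<bar> \<le> e / 4 * real (size V)"
        using add by auto
      moreover have "\<bar>(x + X) - (y + Y)\<bar> \<le> e / 4 * real (size (add_mset u V))"
        if "\<bar>x - y\<bar> < e / 4" "\<bar>X - Y\<bar> \<le> e / 4 * real (size V)" for x X y Y
      proof -
        have "e / 4 * real (size (add_mset u V)) = e / 4 * real (size V) + e / 4"
          by (simp add: distrib_left)
        then show ?thesis using that by arith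
      qed
      ultimately show ?case unfolding image_mset_add_mset sum_mset.add_mset by blast
    qed simp
    from this[of "U n"] unit[of _ n]
    have "\<bar>(\<Sum>u\<in>#U n. f (Re (u * c))) - (\<Sum>u\<in>#U n. q (Re (u * c)))\<bar> \<le> e / 4 * real (size (U n))"
      by blast
    then have "\<bar>(\<Sum>u\<in>#U n. f (Re (u * c))) - (\<Sum>u\<in>#U n. q (Re (u * c)))\<bar> / real n \<le> e / 4 * real (size (U n)) / real n"
      by (rule divide_right_mono) simp
    moreover have "\<bar>x /\<^sub>R real n - y /\<^sub>R real n\<bar> = \<bar>x - y\<bar> / real n" for x y :: real
    proof -
      have "x /\<^sub>R real n - y /\<^sub>R real n = (x - y) / real n"
        by (simp add: divide_inverse right_diff_distrib mult.commute)
      then show ?thesis by simp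
    qed
    ultimately show ?thesis unfolding unit_mean_def times_divide_eq_right by (simp only:)
  qed
  have "\<forall>\<^sub>F n in sequentially. \<bar>unit_mean (U n) n (\<lambda>u. q (Re (u * c))) - I q\<bar> < e / 4"
    using tendstoD[OF lim_q, of "e / 4"] e by (simp add: dist_real_def)
  moreover have "\<forall>\<^sub>F n in sequentially. real (size (U n)) / real n < 2"
    using mass by (rule order_tendstoD) simp
  ultimately have "\<forall>\<^sub>F n in sequentially. \<bar>unit_mean (U n) n (\<lambda>u. f (Re (u * c))) - I f\<bar> < e"
  proof eventually_elim
    case (elim n)
    have "e / 4 * (real (size (U n)) / real n) \<le> e / 4 * 2"
      using elim e by (intro mult_left_mono) auto
    then show ?case using mean_f[of n] If elim by linarith
  qed
  then show "\<exists>no. \<forall>n\<ge>no. norm (unit_mean (U n) n (\<lambda>u. f (Re (u * c))) - integral {0..2*pi} (\<lambda>t. f (cos t)) / (2 * pi)) < e"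
    by (simp add: eventually_sequentially I_def)
qed

text \<open>The indicator of the open arc of half-width \<delta> about cnj c is bounded below by a
  continuous function of the real part. Only lower bounds are proved; upper ones follow later from
  complementary arcs.\<close>

lemma cap_count_lower:
  assumes c: "cmod c = 1" and \<delta>: "0 < \<delta>" "\<delta> \<le> pi" and e: "e > 0"
  shows "\<forall>\<^sub>F n in sequentially. real (size {#u \<in># U n. cos \<delta> < Re (u * c)#}) / real n > \<delta> / pi - e"
proof -
  \<comment> \<open>A half-width slightly below \<delta>, losing less than e in d / pi and still
    positive for large e; \<phi> rises from 0 to 1 between cos \<delta> and cos d.\<close>
  define d where "d = max (\<delta> / 2) (\<delta> - pi * e / 2)"
  have d: "0 < d" "d < \<delta>" "d / pi > \<delta> / pi - e"
  proof -
    show "0 < d" "d < \<delta>" using \<delta> e by (auto simp: d_def less_max_iff_disj)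
    have "\<delta> - pi * e < d" using e pi_gt_zero by (auto simp: d_def less_max_iff_disj)
    then have "(\<delta> - pi * e) / pi < d / pi" by (intro divide_strict_right_mono) auto
    then show "d / pi > \<delta> / pi - e" by (simp add: diff_divide_distrib)
  qed
  have cos_less: "cos \<delta> < cos d" using d \<delta> by (intro cos_monotone_0_pi) auto
  define \<phi> where "\<phi> x = max 0 (min 1 ((x - cos \<delta>) / (cos d - cos \<delta>)))" for x
  have cont: "continuous_on {-1..1} \<phi>"
    unfolding \<phi>_def using cos_less by (intro continuous_intros) auto
  have \<phi>: "0 \<le> \<phi> x" "\<phi> x \<le> 1" "x \<le> cos \<delta> \<Longrightarrow> \<phi> x = 0" "cos d \<le> x \<Longrightarrow> \<phi> x = 1" for x
    using cos_less by (auto simp: \<phi>_def divide_nonpos_pos)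
  have contc: "continuous_on A (\<lambda>t. \<phi> (cos t))" for A
    by (rule continuous_on_compose2[OF cont]) (auto intro!: continuous_intros)
  have int: "(\<lambda>t. \<phi> (cos t)) integrable_on {a..b}" for a b
    by (rule integrable_continuous_interval[OF contc])
  have lower: "integral {0..2*pi} (\<lambda>t. \<phi> (cos t)) \<ge> 2 * d"
  proof -
    have split: "integral {0..2*pi} (\<lambda>t. \<phi> (cos t)) = integral {0..d} (\<lambda>t. \<phi> (cos t))
        + (integral {d..2*pi-d} (\<lambda>t. \<phi> (cos t)) + integral {2*pi-d..2*pi} (\<lambda>t. \<phi> (cos t)))"
    proof -
      have "integral {0..d} (\<lambda>t. \<phi> (cos t)) + integral {d..2*pi} (\<lambda>t. \<phi> (cos t)) = integral {0..2*pi} (\<lambda>t. \<phi> (cos t))"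
        using d \<delta> by (intro Henstock_Kurzweil_Integration.integral_combine int) auto
      moreover have "integral {d..2*pi-d} (\<lambda>t. \<phi> (cos t)) + integral {2*pi-d..2*pi} (\<lambda>t. \<phi> (cos t)) = integral {d..2*pi} (\<lambda>t. \<phi> (cos t))"
        using d \<delta> by (intro Henstock_Kurzweil_Integration.integral_combine int) auto
      ultimately show ?thesis by simp
    qed
    have one: "integral {0..d} (\<lambda>t. \<phi> (cos t)) = d"
    proof -
      have "cos d \<le> cos t" if "t \<in> {0..d}" for t using that d \<delta> by (intro cos_monotone_0_pi_le) auto
      then have "integral {0..d} (\<lambda>t. \<phi> (cos t)) = integral {0..d} (\<lambda>t. 1)"
        by (intro integral_cong \<phi>) auto
      then show ?thesis using d by simp
    qed
    have two: "integral {2*pi-d..2*pi} (\<lambda>t. \<phi> (cos t)) = d"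
    proof -
      have "cos d \<le> cos t" if "t \<in> {2*pi-d..2*pi}" for t
      proof -
        have "cos d \<le> cos (2 * pi - t)" using that d \<delta> by (intro cos_monotone_0_pi_le) auto
        then show ?thesis by simp
      qed
      then have "integral {2*pi-d..2*pi} (\<lambda>t. \<phi> (cos t)) = integral {2*pi-d..2*pi} (\<lambda>t. 1)"
        by (intro integral_cong \<phi>) auto
      then show ?thesis using d by simp
    qed
    have "integral {d..2*pi-d} (\<lambda>t. \<phi> (cos t)) \<ge> 0" by (intro integral_nonneg int \<phi>)
    then show ?thesis unfolding split one two by simp
  qed
  have "2 * d / (2 * pi) \<le> integral {0..2*pi} (\<lambda>t. \<phi> (cos t)) / (2 * pi)"
    using lower by (intro divide_right_mono) auto
  then have "\<delta> / pi - e < integral {0..2*pi} (\<lambda>t. \<phi> (cos t)) / (2 * pi)"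
    using d(3) by simp
  then have "\<forall>\<^sub>F n in sequentially. \<delta> / pi - e < unit_mean (U n) n (\<lambda>u. \<phi> (Re (u * c)))"
    using order_tendstoD(1)[OF mean_continuous[OF c cont]] by blast
  then show ?thesis
  proof eventually_elim
    case (elim n)
    have "(\<Sum>u\<in>#V. \<phi> (Re (u * c))) \<le> real (size {#u \<in># V. cos \<delta> < Re (u * c)#})" for V
    proof (induction V)
      case (add u V)
      then show ?case using \<phi>(2,3)[of "Re (u * c)"] by (auto simp: not_less simp del: times_complex.sel)
    qed simp
    then have "unit_mean (U n) n (\<lambda>u. \<phi> (Re (u * c))) \<le> real (size {#u \<in># U n. cos \<delta> < Re (u * c)#}) / real n"
      unfolding unit_mean_def real_scaleR_def divide_inverse
      by (subst mult.commute) (intro mult_right_mono, auto)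
    with elim show ?case by linarith
  qed
qed

end

lemma cos_le_outside:
  fixes x \<delta> :: real
  assumes "0 \<le> \<delta>" "\<delta> \<le> \<bar>x\<bar>" "\<bar>x\<bar> \<le> 2 * pi - \<delta>"
  shows "cos x \<le> cos \<delta>"
proof -
  have "cos \<bar>x\<bar> \<le> cos \<delta>"
  proof (cases "\<bar>x\<bar> \<le> pi")
    case True
    then show ?thesis using assms by (intro cos_monotone_0_pi_le) auto
  next
    case False
    have "cos (2 * pi - \<bar>x\<bar>) \<le> cos \<delta>" using assms False by (intro cos_monotone_0_pi_le) auto
    then show ?thesis by simp
  qed
  then show ?thesis by simp
qed

text \<open>The open sectors before, inside and after the given one have limiting shares that add up
  to 1, the limit of the total mass. Lower bounds for all three hence imply the upper bound, and
  zeros on the boundary rays or at the origin need no estimate of their own.\<close>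

theorem sector_count_tendsto:
  fixes Z :: "nat \<Rightarrow> complex multiset"
  assumes modes: "\<And>m. m > 0 \<Longrightarrow> (\<lambda>n. cmod (\<Sum>z\<in>#Z n. sgn z ^ m) / real n) \<longlonglongrightarrow> 0"
    and total: "(\<lambda>n. real (size (Z n)) / real n) \<longlonglongrightarrow> 1"
    and zero: "(\<lambda>n. real (count (Z n) 0) / real n) \<longlonglongrightarrow> 0"
    and ab: "0 \<le> \<alpha>" "\<alpha> < \<beta>" "\<beta> \<le> 2 * pi"
  shows "(\<lambda>n. real (size {#z \<in># Z n. \<alpha> \<le> Arg2pi z \<and> Arg2pi z \<le> \<beta>#}) / real n) \<longlonglongrightarrow> (\<beta> - \<alpha>) / (2 * pi)"
proof -
  define U where "U n = image_mset sgn {#z \<in># Z n. z \<noteq> 0#}" for n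
  interpret equidistributed_modes U
  proof
    show "cmod u = 1" if "u \<in># U n" for n u using that by (auto simp: U_def norm_sgn)
    show "(\<lambda>n. unit_mean (U n) n (\<lambda>u. u ^ m)) \<longlonglongrightarrow> 0" if m: "m > 0" for m
    proof (rule tendsto_norm_zero_cancel)
      have P: "(\<Sum>u\<in>#image_mset sgn {#z \<in># V. z \<noteq> 0#}. u ^ m) = (\<Sum>z\<in>#V. sgn z ^ m)" for V :: "complex multiset"
        using m by (induction V) (simp_all add: power_0_left)
      have "norm (unit_mean (U n) n (\<lambda>u. u ^ m)) = cmod (\<Sum>z\<in>#Z n. sgn z ^ m) / real n" for n
        unfolding unit_mean_def U_def P norm_scaleR by (simp add: divide_inverse mult.commute)
      then show "(\<lambda>n. norm (unit_mean (U n) n (\<lambda>u. u ^ m))) \<longlonglongrightarrow> 0" using modes[OF m] by simp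
    qed
    have "size (Z n) = size (U n) + count (Z n) 0" for n
    proof -
      have "size V = size {#z \<in># V. z \<noteq> 0#} + count V 0" for V :: "complex multiset" by (induction V) auto
      then show ?thesis unfolding U_def size_image_mset .
    qed
    then have "real (size (U n)) / real n = real (size (Z n)) / real n - real (count (Z n) 0) / real n" for n
      by (simp add: diff_divide_distrib[symmetric])
    then show "(\<lambda>n. real (size (U n)) / real n) \<longlonglongrightarrow> 1"
      using tendsto_diff[OF total zero] by simp
  qed
  define C where "C a b n = real (size {#z \<in># Z n. z \<noteq> 0 \<and> a < Arg2pi z \<and> Arg2pi z < b#})" for a b n
  have lower: "\<forall>\<^sub>F n in sequentially. C a b n / real n > (b - a) / (2 * pi) - e"
    if ab: "0 \<le> a" "a \<le> b" "b \<le> 2 * pi" and e: "e > 0" for a b e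
  proof (cases "a = b")
    case True
    then show ?thesis using e by (intro always_eventually allI) (auto simp: C_def intro: less_le_trans[of _ 0])
  next
    case False
    define \<gamma> where "\<gamma> = (a + b) / 2"
    define \<delta> where "\<delta> = (b - a) / 2"
    have \<delta>: "0 < \<delta>" "\<delta> \<le> pi" using False ab by (auto simp: \<delta>_def)
    have "\<forall>\<^sub>F n in sequentially. real (size {#u \<in># U n. cos \<delta> < Re (u * cis (- \<gamma>))#}) / real n > \<delta> / pi - e"
      by (rule cap_count_lower) (use \<delta> e in auto)
    then show ?thesis
    proof eventually_elim
      case (elim n)
      have imp: "a < Arg2pi z \<and> Arg2pi z < b" if z: "z \<noteq> 0" "cos \<delta> < Re (sgn z * cis (- \<gamma>))" for z
      proof -
        define \<theta> where "\<theta> = Arg2pi z"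
        have \<theta>: "0 \<le> \<theta>" "\<theta> < 2 * pi" by (auto simp: \<theta>_def Arg2pi_ge_0 Arg2pi_lt_2pi)
        have "z = of_real (cmod z) * cis \<theta>" using Arg2pi_eq[of z] by (simp add: \<theta>_def cis_conv_exp)
        then have "sgn z = cis \<theta>" using z(1)
          by (metis nonzero_mult_div_cancel_left norm_eq_zero of_real_eq_0_iff sgn_eq)
        then have "Re (sgn z * cis (- \<gamma>)) = cos (\<theta> - \<gamma>)" by (simp only: cis_mult) simp
        then have "\<not> (\<delta> \<le> \<bar>\<theta> - \<gamma>\<bar> \<and> \<bar>\<theta> - \<gamma>\<bar> \<le> 2 * pi - \<delta>)"
          using z(2) cos_le_outside[of \<delta> "\<theta> - \<gamma>"] \<delta> by auto
        \<comment> \<open>Because the sector lies inside [0, 2 pi], angles do not wrap around, so a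
          large cosine can only mean that \<theta> is near \<gamma> itself.\<close>
        moreover have "\<bar>\<theta> - \<gamma>\<bar> \<le> 2 * pi - \<delta>"
          using \<theta> ab by (simp add: \<gamma>_def \<delta>_def abs_le_iff field_simps)
        ultimately have "\<bar>\<theta> - \<gamma>\<bar> < \<delta>" by simp
        moreover have "2 * \<gamma> = a + b" "2 * \<delta> = b - a" by (simp_all add: \<gamma>_def \<delta>_def)
        ultimately have "a < \<theta>" "\<theta> < b" by linarith+
        then show ?thesis by (simp add: \<theta>_def)
      qed
      have "size {#u \<in># image_mset sgn {#z \<in># V. z \<noteq> 0#}. cos \<delta> < Re (u * cis (- \<gamma>))#}
          \<le> size {#z \<in># V. z \<noteq> 0 \<and> a < Arg2pi z \<and> Arg2pi z < b#}" for V
        by (induction V) (use imp in \<open>auto simp del: times_complex.sel\<close>)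
      then have "real (size {#u \<in># U n. cos \<delta> < Re (u * cis (- \<gamma>))#}) \<le> C a b n"
        by (simp add: C_def U_def)
      then have "real (size {#u \<in># U n. cos \<delta> < Re (u * cis (- \<gamma>))#}) / real n \<le> C a b n / real n"
        by (intro divide_right_mono) auto
      moreover have "\<delta> / pi = (b - a) / (2 * pi)" by (simp add: \<delta>_def)
      ultimately show ?case using elim by linarith
    qed
  qed
  define S where "S n = real (size {#z \<in># Z n. \<alpha> \<le> Arg2pi z \<and> Arg2pi z \<le> \<beta>#})" for n
  have S: "C \<alpha> \<beta> n \<le> S n" "S n + C 0 \<alpha> n + C \<beta> (2 * pi) n \<le> real (size (Z n))" for n
  proof -
    have "size {#z \<in># V. z \<noteq> 0 \<and> \<alpha> < Arg2pi z \<and> Arg2pi z < \<beta>#} \<le> size {#z \<in># V. \<alpha> \<le> Arg2pi z \<and> Arg2pi z \<le> \<beta>#}" for V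
      by (induction V) auto
    then show "C \<alpha> \<beta> n \<le> S n" by (simp add: C_def S_def)
    have "size {#z \<in># V. \<alpha> \<le> Arg2pi z \<and> Arg2pi z \<le> \<beta>#} + size {#z \<in># V. z \<noteq> 0 \<and> 0 < Arg2pi z \<and> Arg2pi z < \<alpha>#}
        + size {#z \<in># V. z \<noteq> 0 \<and> \<beta> < Arg2pi z \<and> Arg2pi z < 2 * pi#} \<le> size V" for V
      by (induction V) (use ab in auto)
    from this[of "Z n"] show "S n + C 0 \<alpha> n + C \<beta> (2 * pi) n \<le> real (size (Z n))"
      unfolding C_def S_def by linarith
  qed
  have "(\<lambda>n. S n / real n) \<longlonglongrightarrow> (\<beta> - \<alpha>) / (2 * pi)"
  proof (rule LIMSEQ_I)
    fix e :: real assume e: "e > 0"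
    define L A1 B1 where "L = (\<beta> - \<alpha>) / (2 * pi)" and "A1 = (\<alpha> - 0) / (2 * pi)" and "B1 = (2 * pi - \<beta>) / (2 * pi)"
    have LAB: "A1 + B1 = 1 - L" by (simp add: L_def A1_def B1_def diff_divide_distrib)
    have arith: "\<bar>s - L\<bar> < e" if "c1 > L - e / 4" "c2 > A1 - e / 4" "c3 > B1 - e / 4" "t < 1 + e / 4"
        "c1 \<le> s" "s + c2 + c3 \<le> t" for s t c1 c2 c3 :: real
      using that LAB e by linarith
    have "\<forall>\<^sub>F n in sequentially. C \<alpha> \<beta> n / real n > L - e / 4"
         "\<forall>\<^sub>F n in sequentially. C 0 \<alpha> n / real n > A1 - e / 4"
         "\<forall>\<^sub>F n in sequentially. C \<beta> (2 * pi) n / real n > B1 - e / 4"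
      unfolding L_def A1_def B1_def by (intro lower; use ab e in simp)+
    moreover have "\<forall>\<^sub>F n in sequentially. real (size (Z n)) / real n < 1 + e / 4"
      using total by (rule order_tendstoD) (use e in simp)
    ultimately have "\<forall>\<^sub>F n in sequentially. \<bar>S n / real n - (\<beta> - \<alpha>) / (2 * pi)\<bar> < e"
    proof eventually_elim
      case (elim n)
      have "C \<alpha> \<beta> n / real n \<le> S n / real n" using S(1) by (intro divide_right_mono) auto
      moreover have "S n / real n + C 0 \<alpha> n / real n + C \<beta> (2 * pi) n / real n \<le> real (size (Z n)) / real n"
        unfolding add_divide_distrib[symmetric] using S(2) by (intro divide_right_mono) auto
      ultimately show ?case unfolding L_def[symmetric] by (rule arith[OF elim])
    qed
    then show "\<exists>no. \<forall>n\<ge>no. norm (S n / real n - (\<beta> - \<alpha>) / (2 * pi)) < e"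
      by (simp add: eventually_sequentially)
  qed
  then show ?thesis unfolding S_def .
qed

section \<open>Equidistribution of the arguments\<close>

text \<open>Reversal of 0, ..., n, continued by the identity so that it is injective on all indices,
  as exchangeability requires.\<close>

definition rev_idx :: "nat \<Rightarrow> nat \<Rightarrow> nat" where
  "rev_idx n j = (if j \<le> n then n - j else j)"

lemma inj_rev_idx: "inj (rev_idx n)"
  by (rule injI) (auto simp: rev_idx_def split: if_splits)

text \<open>Dominance at a negative s forces strictly smaller moduli at all earlier indices, at a
  positive s at all later ones. Two distinct points of the segment guarantee a nonzero s.\<close>

lemma dom_set_records:
  assumes p: "p \<noteq> 0" "degree p \<le> n" and dom: "s1 \<in> dom_set p k" "s2 \<in> dom_set p k" "s1 < s2"
  defines "y \<equiv> \<lambda>j. cmod (coeff p j)"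
  shows "k \<le> n" "k \<in> records 0 (Suc n) y \<or> n - k \<in> records 0 (Suc n) (\<lambda>i. y (rev_idx n i))"
proof -
  have k: "coeff p k \<noteq> 0" "k \<le> degree p" using dom_set_nonzero[OF p(1) dom(1)] by auto
  then show kn: "k \<le> n" using p(2) by simp
  have yk: "y k > 0" using k by (simp add: y_def)
  have lt: "y j < y k" if "s \<in> dom_set p k" "(real k - real j) * s < 0" for s j
  proof -
    have "y j \<le> y k * exp ((real k - real j) * s)" using that(1) by (simp add: dom_set_iff y_def)
    also have "\<dots> < y k * 1" using that(2) yk by (intro mult_strict_left_mono) auto
    finally show ?thesis by simp
  qed
  show "k \<in> records 0 (Suc n) y \<or> n - k \<in> records 0 (Suc n) (\<lambda>i. y (rev_idx n i))"
  proof (cases "s1 < 0")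
    case True
    have "y j < y k" if "j < k" for j
      using that True by (intro lt[OF dom(1)]) (simp add: mult_pos_neg)
    then show ?thesis using kn by (auto simp: records_def)
  next
    case False
    then have "s2 > 0" using dom(3) by simp
    then have "y j < y k" if "j > k" for j
      using that by (intro lt[OF dom(2)]) (simp add: mult_neg_pos)
    then have "y (rev_idx n i) < y (rev_idx n (n - k))" if "i < n - k" for i
      using that kn by (auto simp: rev_idx_def)
    then show ?thesis using kn by (auto simp: records_def)
  qed
qed

lemma ln_binomial_le:
  assumes "k \<le> d" "d \<le> n" "k < K \<or> d - k < K" "n \<ge> 1"
  shows "ln (real (d choose k)) \<le> real K * ln (real n)"
proof -
  have *: "d choose i \<le> n ^ K" if "i \<le> d" "i < K" for i
  proof -
    have "d choose i \<le> d ^ i" using that by (intro binomial_le_pow)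
    also have "\<dots> \<le> n ^ i" using assms by (intro power_mono) auto
    also have "\<dots> \<le> n ^ K" using assms that by (intro power_increasing) auto
    finally show ?thesis .
  qed
  have "d choose k \<le> n ^ K"
    using assms(3) *[of k] *[of "d - k"] binomial_symmetric[OF assms(1)] assms(1) by auto
  then have "real (d choose k) \<le> real n ^ K" by (metis of_nat_le_iff of_nat_power)
  moreover have "real (d choose k) > 0" using assms(1) by simp
  ultimately have "ln (real (d choose k)) \<le> ln (real n ^ K)"
    using assms(4) by (intro ln_le_cancel_iff[THEN iffD2]) auto
  then show ?thesis using assms(4) by (simp add: ln_realpow)
qed

text \<open>The leading term 2048 pi c n is the number 2 c ln n of vertices far from the ends times
  the cost 2 \<eta> n of the two ends of a segment. Everything else is of smaller order than
  n.\<close>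

theorem sgn_power_sum_records:
  fixes p :: "complex poly" and c \<kappa> :: real
  assumes p: "p \<noteq> 0" "degree p \<le> n" and m: "m > 0" and n: "ln (real n) \<ge> 512 * pi"
    and K: "1 \<le> K" "real K \<le> real n powr (1 - \<kappa>)"
  defines "y \<equiv> \<lambda>j. cmod (coeff p j)"
  assumes R1: "card (records K (Suc n) y) \<le> c * ln (real n)"
      "card (records K (Suc n) (\<lambda>i. y (rev_idx n i))) \<le> c * ln (real n)"
    and R2: "card (records 1 (Suc n) y) \<le> 6 * ln (real n)"
      "card (records 1 (Suc n) (\<lambda>i. y (rev_idx n i))) \<le> 6 * ln (real n)"
  shows "2 / m * cmod (\<Sum>z\<in>#proots p. sgn z ^ m) \<le> 2048 * pi * c * n +
     (2 * c * ln n * (2 * (2 * ln n + 4) * (4 * m * (ln (6 / (512 * pi / ln n)) * n powr (1/2)))) +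
     (2 + 12 * ln n) * (2 * (2 * ln n + 4) * (2 * m * (ln (real n + 1) + n powr (1 - \<kappa>) * ln n))) + 4)"
proof -
  \<comment> \<open>Chosen so that exp (256 pi / \<eta>) is exactly sqrt n; the assumption on ln n
    is \<eta> \<le> 1. Likewise D is chosen so that exp (- (D - 4) / 2) is 1 / n.\<close>
  define \<eta> where "\<eta> = 512 * pi / ln (real n)"
  define D where "D = 2 * ln (real n) + 4"
  have ln_pos: "ln (real n) > 0" using n pi_gt_zero by (smt (verit) mult_pos_pos)
  have n1: "n \<ge> 1" using ln_pos by (cases n) auto
  have \<eta>: "0 < \<eta>" "\<eta> \<le> 1" using n ln_pos by (auto simp: \<eta>_def divide_le_eq)
  have D: "D > 0" using ln_pos by (simp add: D_def)
  define E where "E = 4 * real m * (ln (6/\<eta>) * exp (256 * pi / \<eta>))"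
  define B where "B = 2 * real m * (ln (real n + 1) + n powr (1 - \<kappa>) * ln n)"
  have E: "E = 4 * m * (ln (6 / (512 * pi / ln n)) * n powr (1/2))"
  proof -
    have "256 * pi / \<eta> = 1/2 * ln (real n)" using ln_pos by (simp add: \<eta>_def)
    then have "exp (256 * pi / \<eta>) = n powr (1/2)" using n1 by (simp add: powr_def)
    then show ?thesis by (simp add: E_def \<eta>_def)
  qed
  have E0: "E \<ge> 0" unfolding E_def using \<eta> by simp
  have B0: "B \<ge> 0" unfolding B_def using ln_pos n1 by simp
  define V where "V = (\<lambda>i. n - i) ` records K (Suc n) (\<lambda>i. y (rev_idx n i))"
  define W1 where "W1 = records K (Suc n) y \<union> V"
  \<comment> \<open>Position 0 is inserted by hand because the record bound is available only from
    position 1 on; it accounts for the 2 in the bound 2 + 12 ln n.\<close>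
  define W2 where "W2 = {k \<in> insert 0 (records 1 (Suc n) y) \<union> (\<lambda>i. n - i) ` insert 0 (records 1 (Suc n) (\<lambda>i. y (rev_idx n i))).
      k < K \<or> n - k < K}"
  have fin: "finite W1" "finite W2" by (auto simp: W1_def W2_def V_def)
  have card1: "real (card W1) \<le> 2 * c * ln (real n)"
  proof -
    have "card W1 \<le> card (records K (Suc n) y) + card (records K (Suc n) (\<lambda>i. y (rev_idx n i)))"
      unfolding W1_def V_def by (rule order.trans[OF card_Un_le]) (intro add_mono card_image_le order.refl, simp)
    then have "real (card W1) \<le> real (card (records K (Suc n) y)) + real (card (records K (Suc n) (\<lambda>i. y (rev_idx n i))))"
      by linarith
    then show ?thesis using R1 by linarith
  qed
  have card2: "real (card W2) \<le> 2 + 12 * ln (real n)"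
  proof -
    let ?A = "insert 0 (records 1 (Suc n) y)" and ?B = "insert 0 (records 1 (Suc n) (\<lambda>i. y (rev_idx n i)))"
    have "card W2 \<le> card (?A \<union> (\<lambda>i. n - i) ` ?B)" unfolding W2_def by (intro card_mono) auto
    also have "\<dots> \<le> card ?A + card ?B"
      by (rule order.trans[OF card_Un_le]) (intro add_mono card_image_le order.refl, simp)
    also have "\<dots> \<le> Suc (card (records 1 (Suc n) y)) + Suc (card (records 1 (Suc n) (\<lambda>i. y (rev_idx n i))))"
      by (intro add_mono card_insert_le_m1) (auto simp: card_insert_if)
    finally show ?thesis using R2 by linarith
  qed
  have "2 / m * cmod (\<Sum>z\<in>#proots p. sgn z ^ m) \<le>
     card W1 * (2 * \<eta> * real n + 2 * D * (4 * real m * (ln (6/\<eta>) * exp (256 * pi / \<eta>))))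
     + card W2 * (2 * D * B) + 4 * real n * exp (- (D - 4) / 2)"
  proof (rule sgn_power_sum_bound[OF p m \<eta> D fin])
    fix k s1 s2 assume dom: "s1 \<in> dom_set p k" "s2 \<in> dom_set p k" "s1 < s2"
    note r = dom_set_records[OF p dom]
    have "k \<in> records 0 (Suc n) y \<or> n - k \<in> records 0 (Suc n) (\<lambda>i. y (rev_idx n i))"
      using r(2) by (simp only: y_def)
    then show "k \<in> W1 \<union> W2"
    proof
      assume *: "k \<in> records 0 (Suc n) y"
      show ?thesis
      proof (cases "K \<le> k")
        case True
        then have "k \<in> records K (Suc n) y" using * by (simp add: records_def)
        then show ?thesis by (simp add: W1_def)
      next
        case False
        have "k = 0 \<or> k \<in> records 1 (Suc n) y" using * by (auto simp: records_def)
        then show ?thesis using False by (auto simp: W2_def)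
      qed
    next
      assume *: "n - k \<in> records 0 (Suc n) (\<lambda>i. y (rev_idx n i))"
      have k: "k = n - (n - k)" using r(1) by simp
      show ?thesis
      proof (cases "K \<le> n - k")
        case True
        then have "n - k \<in> records K (Suc n) (\<lambda>i. y (rev_idx n i))" using * by (simp add: records_def)
        then have "k \<in> V" unfolding V_def using k by (metis image_eqI)
        then show ?thesis by (simp add: W1_def)
      next
        case False
        have "n - k \<in> insert 0 (records 1 (Suc n) (\<lambda>i. y (rev_idx n i)))" using * by (auto simp: records_def)
        then have "k \<in> (\<lambda>i. n - i) ` insert 0 (records 1 (Suc n) (\<lambda>i. y (rev_idx n i)))"
          using k by (metis image_eqI)
        then show ?thesis using False by (auto simp: W2_def)
      qed
    qed
  next
    fix k s assume k: "k \<in> W2" "s \<in> dom_set p k"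
    have kd: "k \<le> degree p" using dom_set_nonzero[OF p(1) k(2)] by simp
    \<comment> \<open>The degree may be smaller than n, but then k is even closer to the degree than
      to n.\<close>
    have "k < K \<or> degree p - k < K" using k(1) p(2) by (auto simp: W2_def)
    then have "ln (real (degree p choose k)) \<le> real K * ln (real n)"
      by (intro ln_binomial_le kd p n1)
    also have "\<dots> \<le> n powr (1 - \<kappa>) * ln (real n)" using K ln_pos by (intro mult_right_mono) auto
    finally have "ln (real (degree p choose k)) \<le> n powr (1 - \<kappa>) * ln (real n)" .
    moreover have "ln (real (degree p) + 1) \<le> ln (real n + 1)"
      using p(2) by (intro ln_le_cancel_iff[THEN iffD2]) auto
    ultimately have "2 * real m * (ln (real (degree p) + 1) + ln (real (degree p choose k))) \<le> B"
      unfolding B_def by (intro mult_left_mono add_mono) auto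
    moreover have "cmod (mode_sum p m s) \<le> 2 * real m * (ln (real (degree p) + 1) + ln (real (degree p choose k)))"
      using mode_sum_le_binomial[OF p(1) k(2) m] by simp
    ultimately show "cmod (mode_sum p m s) \<le> B" by linarith
  qed (rule B0)
  also have "\<dots> = card W1 * (2 * \<eta> * n) + card W1 * (2 * D * E) + card W2 * (2 * D * B) + 4"
  proof -
    have "exp (- (D - 4) / 2) = 1 / real n" using n1 by (simp add: D_def exp_minus inverse_eq_divide)
    then show ?thesis using n1 by (simp add: E_def distrib_left)
  qed
  also have "\<dots> \<le> (2 * c * ln (real n)) * (2 * \<eta> * n) + (2 * c * ln (real n)) * (2 * D * E)
      + (2 + 12 * ln (real n)) * (2 * D * B) + 4"
    using \<eta> D E0 B0 by (intro add_mono mult_right_mono card1 card2 order.refl) auto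
  also have "(2 * c * ln (real n)) * (2 * \<eta> * n) = 2048 * pi * c * n"
    using ln_pos by (simp add: \<eta>_def)
  finally show ?thesis unfolding E D_def B_def by (simp only: add.assoc)
qed

section \<open>From random coefficients to zero counts\<close>

lemma sector_zeros_eq_size:
  "sector_zeros p \<alpha> \<beta> = size {#z \<in># proots p. \<alpha> \<le> Arg2pi z \<and> Arg2pi z \<le> \<beta>#}"
proof (cases "p = 0")
  case False
  have "set_mset {#z \<in># proots p. \<alpha> \<le> Arg2pi z \<and> Arg2pi z \<le> \<beta>#} = {z. poly p z = 0 \<and> \<alpha> \<le> Arg2pi z \<and> Arg2pi z \<le> \<beta>}"
    using False by auto
  then show ?thesis
    using False by (simp add: sector_zeros_def size_multiset_overloaded_eq)
qed (simp add: sector_zeros_def)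

lemma coeff_random_poly: "coeff (random_poly \<xi> n \<omega>) j = (if j \<le> n then \<xi> j \<omega> else 0)"
  by (simp add: random_poly_def coeff_sum coeff_monom)

lemma degree_random_poly: "degree (random_poly \<xi> n \<omega>) \<le> n"
  by (rule degree_le) (simp add: coeff_random_poly)

lemma count_proots_0_le:
  fixes p :: "complex poly"
  assumes "coeff p k \<noteq> 0"
  shows "count (proots p) 0 \<le> k"
proof -
  have p: "p \<noteq> 0" using assms by auto
  have "monom 1 (order 0 p) dvd p" using p by (simp add: monom_1_dvd_iff)
  then have "\<forall>j<order 0 p. coeff p j = 0" using monom_1_dvd_iff'[of "order 0 p" p] by blast
  then have "\<not> k < order 0 p" using assms by blast
  then show ?thesis using p by simp
qed

lemma nonneg_tendsto_zeroI:
  fixes f :: "nat \<Rightarrow> real"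
  assumes "\<And>e. e > 0 \<Longrightarrow> \<forall>\<^sub>F n in sequentially. f n < e" "\<And>n. f n \<ge> 0"
  shows "f \<longlonglongrightarrow> 0"
proof (rule tendstoI)
  fix e :: real assume "e > 0"
  from assms(1)[OF this] show "\<forall>\<^sub>F n in sequentially. dist (f n) 0 < e"
    by eventually_elim (use assms(2) in simp)
qed

text \<open>The cut-off between the two kinds of vertices. The factor 4 comes from n + 1 \<le> 2 n
  and from rounding down, which loses at most a factor 2.\<close>

lemma floor_powr_bounds:
  fixes \<kappa> :: real
  assumes "0 \<le> \<kappa>" "\<kappa> \<le> 1" "n \<ge> 1"
  defines "K \<equiv> nat \<lfloor>real n powr (1 - \<kappa>)\<rfloor>"
  shows "1 \<le> K" "K \<le> Suc n" "real (Suc n) / real K \<le> 4 * real n powr \<kappa>" "real K \<le> real n powr (1 - \<kappa>)"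
proof -
  define x where "x = real n powr (1 - \<kappa>)"
  have n: "real n \<ge> 1" using assms(3) by simp
  have x: "1 \<le> x" "x \<le> real n"
    using n assms(1,2) powr_mono[of "1 - \<kappa>" 1 "real n"] by (auto simp: x_def ge_one_powr_ge_zero)
  have "1 \<le> \<lfloor>x\<rfloor>" using x by simp
  then show K1: "1 \<le> K" unfolding K_def x_def[symmetric] by linarith
  have "real_of_int \<lfloor>x\<rfloor> = real K" using x unfolding K_def x_def[symmetric] by simp
  then have K: "real K \<le> x" "x < real K + 1" by linarith+
  then show "real K \<le> real n powr (1 - \<kappa>)" by (simp add: x_def)
  have "real K \<le> real (Suc n)" using K(1) x(2) by simp
  then show "K \<le> Suc n" by (simp only: of_nat_le_iff)
  have xn: "x * real n powr \<kappa> = real n" using n unfolding x_def by (simp add: powr_add[symmetric])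
  have "real (Suc n) \<le> 2 * real n" using n by simp
  also have "\<dots> = 2 * (x * real n powr \<kappa>)" by (simp only: xn)
  also have "\<dots> \<le> 2 * (2 * real K * real n powr \<kappa>)"
    using K(2) K1 by (intro mult_left_mono mult_right_mono) auto
  finally have "real (Suc n) \<le> 4 * real n powr \<kappa> * real K" by (simp add: mult_ac)
  then show "real (Suc n) / real K \<le> 4 * real n powr \<kappa>" using K1 by (subst pos_divide_le_eq) auto
qed

theorem theorem3:
  fixes M :: "'a measure" and \<xi> :: "nat \<Rightarrow> 'a \<Rightarrow> complex" and \<alpha> \<beta> :: real
  assumes "prob_space M"
    and "prob_space.indep_vars M (\<lambda>_. borel) \<xi> UNIV"
    and "\<And>k. distr M borel (\<xi> k) = distr M borel (\<xi> 0)"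
    and "\<P>(\<omega> in M. \<xi> 0 \<omega> = 0) < 1"
    and "0 \<le> \<alpha>" and "\<alpha> < \<beta>" and "\<beta> \<le> 2 * pi"
  shows "AE \<omega> in M. (\<lambda>n. real (sector_zeros (random_poly \<xi> n \<omega>) \<alpha> \<beta>) / real n)
           \<longlonglongrightarrow> (\<beta> - \<alpha>) / (2 * pi)"
proof -
  interpret prob_space M by fact
  note ind = assms(2) and id = assms(3)
  have rv [measurable]: "random_variable borel (\<xi> i)" for i using ind by (auto simp: indep_vars_def)
  define Y where "Y i \<omega> = cmod (\<xi> i \<omega>)" for i \<omega>
  have indY: "indep_vars (\<lambda>_. borel) Y UNIV"
    unfolding Y_def[abs_def] by (rule indep_vars_compose2[OF ind]) simp
  have idY: "distr M borel (Y k) = distr M borel (Y 0)" for k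
  proof -
    have "distr M borel (Y j) = distr (distr M borel (\<xi> j)) borel cmod" for j
      by (subst distr_distr) (auto simp: comp_def Y_def[abs_def])
    then show ?thesis using id[of k] by (simp only:)
  qed
  \<comment> \<open>A countable family of record densities tending to 0, so that one almost sure
    event serves all of them; \<open>l\<close> solves c ln l = 3 and \<open>\<kappa>\<close> is then
    small enough for \<kappa> (l - 1) \<le> 1.\<close>
  define c where "c i = 1 / (real i + 1)" for i :: nat
  define l where "l i = exp (3 / c i)" for i
  define \<kappa> where "\<kappa> i = min (1/2) (1 / (l i - 1))" for i
  define K where "K i n = nat \<lfloor>real n powr (1 - \<kappa> i)\<rfloor>" for i n
  have c: "c i > 0" for i by (simp add: c_def)
  have l: "l i > 1" "c i * ln (l i) \<ge> 3" for i using c[of i] by (auto simp: l_def)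
  have \<kappa>: "0 < \<kappa> i" "0 \<le> \<kappa> i" "\<kappa> i \<le> 1" "\<kappa> i * (l i - 1) \<le> 1" for i
  proof -
    have "\<kappa> i * (l i - 1) \<le> 1 / (l i - 1) * (l i - 1)" unfolding \<kappa>_def using l(1)[of i] by (intro mult_right_mono) auto
    then show "\<kappa> i * (l i - 1) \<le> 1" using l(1)[of i] by simp
    show "0 < \<kappa> i" "0 \<le> \<kappa> i" "\<kappa> i \<le> 1" using l(1)[of i] by (auto simp: \<kappa>_def min_def)
  qed
  have inj_id: "inj (\<lambda>i::nat. i)" by simp
  have few: "AE \<omega> in M. \<forall>\<^sub>F n in sequentially. card (records (K i n) (Suc n) (\<lambda>j. Y (\<pi> n j) \<omega>)) < c i * ln (real n)"
    if "\<And>n. inj (\<pi> n)" for \<pi> :: "nat \<Rightarrow> nat \<Rightarrow> nat" and i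
    unfolding K_def
    by (rule AE_eventually_few_records[OF indY idY l \<kappa>(4) floor_powr_bounds(1-3)[OF \<kappa>(2,3)] that])
  \<comment> \<open>For all records from position 1 on one takes l = 2 and \<kappa> = 1; this is the
    origin of the constant 6.\<close>
  have "6 * ln (2::real) \<ge> 3"
  proof -
    have "1 / 2 \<le> ln (2 :: real)" using ln_le_minus_one[of "1/2 :: real"] by (simp add: ln_div)
    then show ?thesis by simp
  qed
  then have some: "AE \<omega> in M. \<forall>\<^sub>F n in sequentially. card (records 1 (Suc n) (\<lambda>j. Y (\<pi> n j) \<omega>)) < 6 * ln (real n)"
    if "\<And>n. inj (\<pi> n)" for \<pi> :: "nat \<Rightarrow> nat \<Rightarrow> nat"
    by (intro AE_eventually_few_records[OF indY idY, where l = 2 and \<kappa> = 1] that) auto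
  have E1: "AE \<omega> in M. \<forall>i. \<forall>\<^sub>F n in sequentially. card (records (K i n) (Suc n) (\<lambda>j. Y j \<omega>)) < c i * ln (real n)"
    unfolding AE_all_countable using few[of "\<lambda>_ j. j"] by simp
  have E2: "AE \<omega> in M. \<forall>i. \<forall>\<^sub>F n in sequentially. card (records (K i n) (Suc n) (\<lambda>j. Y (rev_idx n j) \<omega>)) < c i * ln (real n)"
    unfolding AE_all_countable using few[of rev_idx] inj_rev_idx by blast
  have E3: "AE \<omega> in M. \<forall>\<^sub>F n in sequentially. card (records 1 (Suc n) (\<lambda>j. Y j \<omega>)) < 6 * ln (real n)"
    using some[of "\<lambda>_ j. j"] by simp
  have E4: "AE \<omega> in M. \<forall>\<^sub>F n in sequentially. card (records 1 (Suc n) (\<lambda>j. Y (rev_idx n j) \<omega>)) < 6 * ln (real n)"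
    using some[of rev_idx] inj_rev_idx by blast
  have E5: "AE \<omega> in M. \<forall>\<^sub>F n in sequentially. \<exists>i\<le>nat \<lfloor>sqrt (real n)\<rfloor>. \<xi> i \<omega> \<noteq> 0"
    using AE_eventually_nonzero[OF ind id assms(4), of "\<lambda>_ j. j"] by simp
  have E6: "AE \<omega> in M. \<forall>\<^sub>F n in sequentially. \<exists>i\<le>nat \<lfloor>sqrt (real n)\<rfloor>. \<xi> (rev_idx n i) \<omega> \<noteq> 0"
    by (rule AE_eventually_nonzero[OF ind id assms(4) inj_rev_idx])
  from E1 E2 E3 E4 E5 E6 show ?thesis
  proof eventually_elim
    case (elim \<omega>)
    define P where "P n = random_poly \<xi> n \<omega>" for n
    define r where "r n = nat \<lfloor>sqrt (real n)\<rfloor>" for n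
    have r: "real (r n) \<le> sqrt (real n)" "r n \<le> n" for n
    proof -
      show "real (r n) \<le> sqrt (real n)" unfolding r_def by simp
      also have "\<dots> \<le> real n" by (cases n) (auto simp: real_sqrt_le_iff intro!: real_le_lsqrt simp: power2_eq_square)
      finally show "r n \<le> n" by simp
    qed
    have deg: "degree (P n) \<le> n" for n unfolding P_def by (rule degree_random_poly)
    have low: "\<forall>\<^sub>F n in sequentially. P n \<noteq> 0 \<and> count (proots (P n)) 0 \<le> r n"
      using elim(5)
    proof eventually_elim
      case (elim n)
      then obtain i where i: "i \<le> r n" "\<xi> i \<omega> \<noteq> 0" by (auto simp: r_def)
      then have "coeff (P n) i \<noteq> 0" using r(2)[of n] by (simp add: P_def coeff_random_poly)
      then show ?case using count_proots_0_le[of "P n" i] i by auto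
    qed
    have high: "\<forall>\<^sub>F n in sequentially. n \<le> degree (P n) + r n"
      using elim(6)
    proof eventually_elim
      case (elim n)
      then obtain i where i: "i \<le> r n" "\<xi> (rev_idx n i) \<omega> \<noteq> 0" by (auto simp: r_def)
      then have "i \<le> n" using r(2)[of n] by simp
      then have "coeff (P n) (n - i) \<noteq> 0" using i by (simp add: P_def coeff_random_poly rev_idx_def)
      then have "n - i \<le> degree (P n)" by (rule le_degree)
      then show ?case using i \<open>i \<le> n\<close> by simp
    qed
    have r0: "(\<lambda>n. real (r n) / real n) \<longlonglongrightarrow> 0"
    proof (rule tendsto_sandwich)
      show "(\<lambda>n. 0 :: real) \<longlonglongrightarrow> 0" by simp
      show "(\<lambda>n. sqrt (real n) / real n) \<longlonglongrightarrow> 0" by real_asymp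
    qed (use r(1) in \<open>auto intro!: always_eventually divide_right_mono\<close>)
    have zero: "(\<lambda>n. real (count (proots (P n)) 0) / real n) \<longlonglongrightarrow> 0"
    proof (rule tendsto_sandwich[OF _ _ tendsto_const r0])
      show "\<forall>\<^sub>F n in sequentially. real (count (proots (P n)) 0) / real n \<le> real (r n) / real n"
        using low by eventually_elim (auto intro!: divide_right_mono simp del: count_proots)
    qed (auto intro!: always_eventually)
    have total: "(\<lambda>n. real (size (proots (P n))) / real n) \<longlonglongrightarrow> 1"
    proof (rule tendsto_sandwich)
      show "(\<lambda>n. 1 - real (r n) / real n) \<longlonglongrightarrow> 1" using tendsto_diff[OF tendsto_const r0, of 1] by simp
      show "\<forall>\<^sub>F n in sequentially. 1 - real (r n) / real n \<le> real (size (proots (P n))) / real n"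
        using high eventually_gt_at_top[of 0]
      proof eventually_elim
        case (elim n)
        then have "(real n - real (r n)) / real n \<le> real (degree (P n)) / real n"
          by (intro divide_right_mono) auto
        then show ?case using elim by (simp add: size_proots_complex diff_divide_distrib)
      qed
      show "\<forall>\<^sub>F n in sequentially. real (size (proots (P n))) / real n \<le> 1"
        using eventually_gt_at_top[of 0] by eventually_elim (use deg in \<open>auto simp: size_proots_complex\<close>)
    qed simp
    have modes: "(\<lambda>n. cmod (\<Sum>z\<in>#proots (P n). sgn z ^ m) / real n) \<longlonglongrightarrow> 0" if m: "m > 0" for m
    proof (rule nonneg_tendsto_zeroI)
      fix e :: real assume e: "e > 0"
      \<comment> \<open>The choice makes m / 2 times the leading coefficient 2048 pi c smaller than
        e; the remaining terms vanish after division by n.\<close>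
      obtain i where i: "1024 * pi * real m / e < real i" using reals_Archimedean2 by blast
      have ci: "real m / 2 * (2048 * pi * c i) < e"
      proof -
        have "1024 * pi * real m < e * (real i + 1)" using i e by (simp add: field_simps)
        then show ?thesis by (simp add: c_def field_simps)
      qed
      define err where "err n = 2 * c i * ln (real n) * (2 * (2 * ln (real n) + 4) * (4 * real m * (ln (6 / (512 * pi / ln (real n))) * real n powr (1/2)))) +
         (2 + 12 * ln (real n)) * (2 * (2 * ln (real n) + 4) * (2 * real m * (ln (real n + 1) + real n powr (1 - \<kappa> i) * ln (real n)))) + 4" for n
      have err: "(\<lambda>n. err n / real n) \<longlonglongrightarrow> 0"
        using tendsto_error_terms[OF \<kappa>(1)[of i], of "c i" "real m"] by (simp add: err_def add.commute)
      have "(\<lambda>n. real m / 2 * (2048 * pi * c i + err n / real n)) \<longlonglongrightarrow> real m / 2 * (2048 * pi * c i + 0)"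
        by (intro tendsto_intros err)
      then have "\<forall>\<^sub>F n in sequentially. real m / 2 * (2048 * pi * c i + err n / real n) < e"
        by (rule order_tendstoD) (use ci in simp)
      moreover have "\<forall>\<^sub>F n in sequentially. ln (real n) \<ge> 512 * pi"
        by real_asymp
      ultimately show "\<forall>\<^sub>F n in sequentially. cmod (\<Sum>z\<in>#proots (P n). sgn z ^ m) / real n < e"
        using elim(1)[rule_format, of i] elim(2)[rule_format, of i] elim(3,4) low eventually_gt_at_top[of 0]
      proof eventually_elim
        case (elim n)
        define y where "y j = cmod (coeff (P n) j)" for j
        \<comment> \<open>Coefficients beyond n are 0 and do not match Y, but records up to n look
          only at indices that f keeps at most n.\<close>
        have rec: "records a (Suc n) (\<lambda>j. y (f j)) = records a (Suc n) (\<lambda>j. Y (f j) \<omega>)"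
          if "\<And>j. j \<le> n \<Longrightarrow> f j \<le> n" for a f
          using that by (auto simp: records_def y_def Y_def P_def coeff_random_poly)
        have rev: "rev_idx n j \<le> n" if "j \<le> n" for j using that by (simp add: rev_idx_def)
        have "2 / real m * cmod (\<Sum>z\<in>#proots (P n). sgn z ^ m) \<le> 2048 * pi * c i * real n + err n"
          unfolding err_def
        proof (rule sgn_power_sum_records[where K = "K i n", OF _ deg m])
          show "P n \<noteq> 0" "512 * pi \<le> ln (real n)" using elim by auto
          show "1 \<le> K i n" "real (K i n) \<le> real n powr (1 - \<kappa> i)"
            using floor_powr_bounds(1,4)[OF \<kappa>(2,3)[of i], of n] elim by (auto simp: K_def)
          show "real (card (records (K i n) (Suc n) (\<lambda>j. cmod (coeff (P n) j)))) \<le> c i * ln (real n)"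
            using rec[of "\<lambda>j. j" "K i n"] elim by (simp add: y_def)
          show "real (card (records (K i n) (Suc n) (\<lambda>j. cmod (coeff (P n) (rev_idx n j))))) \<le> c i * ln (real n)"
            using rec[of "rev_idx n" "K i n"] rev elim by (simp add: y_def)
          show "real (card (records 1 (Suc n) (\<lambda>j. cmod (coeff (P n) j)))) \<le> 6 * ln (real n)"
            using rec[of "\<lambda>j. j" 1] elim by (simp add: y_def)
          show "real (card (records 1 (Suc n) (\<lambda>j. cmod (coeff (P n) (rev_idx n j))))) \<le> 6 * ln (real n)"
            using rec[of "rev_idx n" 1] rev elim by (simp add: y_def)
        qed
        then have "real m / 2 * (2 / real m * cmod (\<Sum>z\<in>#proots (P n). sgn z ^ m)) / real n \<le>
            real m / 2 * (2048 * pi * c i * real n + err n) / real n"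
          by (intro divide_right_mono mult_left_mono) auto
        also have "\<dots> = real m / 2 * (2048 * pi * c i + err n / real n)"
          using elim by (simp add: add_divide_distrib distrib_left)
        also have "\<dots> < e" using elim by blast
        finally show ?case using m by simp
      qed
    qed simp
    show ?case
      using sector_count_tendsto[of "\<lambda>n. proots (P n)", OF modes total zero assms(5-7)]
      unfolding P_def sector_zeros_eq_size .
  qed
qed

end
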